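(* Let $n\ge 1$ be fixed and let $p$ be a monic polynomial of degree $d\ge n$. Then \[ m_n(p) - \sum_{\pi\in NC(n)} \kappa_\pi^d(p) = - \frac{n}{2 d} \sum_{\substack{r,s\ge1,\ r+s=n}}\ \sum_{\pi \in S_{NC}(r,s)} \frac{\kappa_\pi^d(p)}{rs} +O(1/d^2).\]
   Context: For a monic polynomial $p$ of degree $d$ with roots $\lambda_1,\dots,\lambda_d$, write $p(x)=\sum_{i=0}^d(-1)^ia^p_ix^{d-i}$ and $m_n(p)=\frac1d\sum_i\lambda_i^n$. Let $(d)_k=d(d-1)\cdots(d-k+1)$. For a set partition $\pi$ of $\{1,\dots,n\}$ with $|\pi|$ blocks, set $a^p_\pi=\prod_{V\in\pi}a^p_{|V|}$, $N!_\pi=\prod_V|V|!$, $(d)_\pi=\prod_V(d)_{|V|}$. Finite free cumulants: for $n=1,\dots,d$, $\kappa_n^d(p)=\frac{(-d)^n}{d(n-1)!}\sum_{\pi\in P(n)}(-1)^{|\pi|}\frac{N!_\pi a_\pi^p(|\pi|-1)!}{(d)_\pi}$, where $P(n)$ is the set of all set partitions of $\{1,\dots,n\}$; and $\kappa^d_\pi(p)=\prod_{V\in\pi}\kappa^d_{|V|}(p)$. $NC(n)$ is the set of non-crossing partitions of $\{1,\dots,n\}$. For a permutation $\alpha$, $\kappa^d_\alpha(p)$ means $\kappa^d_{f(\alpha)}(p)$ where $f(\alpha)$ is the partition into cycles of $\alpha$; $\#(\alpha)$ denotes the number of cycles. For $r,s\ge1$, let $\gamma_{r,s}=(1,\dots,r)(r+1,\dots,r+s)\in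 S_{r+s}$. The set $S_{NC}(r,s)$ of annular non-crossing permutations is the set of $\alpha\in S_{r+s}$ such that the subgroup generated by $\alpha$ and $\gamma_{r,s}$ acts transitively on $\{1,\dots,r+s\}$ and $\#(\alpha)+\#(\alpha^{-1}\gamma_{r,s})=r+s$ (equivalently, the cycles of $\alpha$ can be drawn without crossings on an annulus with $1,\dots,r$ clockwise on the outer circle and $r+1,\dots,r+s$ counterclockwise on the inner circle, each cycle bounding a disc oriented clockwise, and at least one cycle connecting the two circles). Here $O(1/d^2)$ stands for an expression $\sum_{k=2}^{n-1}d^{-k}E_k$ with each $E_k$ a linear combination, with coefficients depending only on $n$ and $k$, of products $\kappa^d_\sigma(p)$, $\sigma\in P(n)$. *)

theory Defs
  imports
    "HOL-Computational_Algebra.Computational_Algebra"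
    "HOL-Library.Disjoint_Sets"
    "HOL-Combinatorics.Cycles"
    "HOL-Combinatorics.Orbits"
    "HOL-Algebra.Sym_Groups"
begin

text \<open>The sign convention is \<open>p(x) = \<Sum>i\<le>d. (-1)^i * a_i * x^(d-i)\<close> with \<open>d = degree p\<close>,
  so \<open>a_0 = 1\<close> for monic \<open>p\<close>.\<close>

definition acoeff :: "complex poly \<Rightarrow> nat \<Rightarrow> complex" where
  "acoeff p i = (-1) ^ i * Polynomial.coeff p (Polynomial.degree p - i)"

text \<open>Empirical moments; \<open>proots\<close> counts the roots with multiplicity.\<close>

definition root_moment :: "complex poly \<Rightarrow> nat \<Rightarrow> complex" where
  "root_moment p n = (\<Sum>x\<in>#proots p. x ^ n) / of_nat (Polynomial.degree p)"

definition falling :: "nat \<Rightarrow> nat \<Rightarrow> complex" where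
  "falling d k = (\<Prod>i<k. of_nat d - of_nat i)"

definition set_partitions :: "nat \<Rightarrow> nat set set set" where
  "set_partitions n = {\<pi>. partition_on {1..n} \<pi>}"

definition noncrossing :: "nat set set \<Rightarrow> bool" where
  "noncrossing \<pi> \<longleftrightarrow>
     (\<forall>V\<in>\<pi>. \<forall>W\<in>\<pi>. \<forall>i j k l. i < j \<and> j < k \<and> k < l \<and> i \<in> V \<and> k \<in> V \<and> j \<in> W \<and> l \<in> W
        \<longrightarrow> V = W)"

definition NC :: "nat \<Rightarrow> nat set set set" where
  "NC n = {\<pi> \<in> set_partitions n. noncrossing \<pi>}"

definition acoeff_part :: "complex poly \<Rightarrow> nat set set \<Rightarrow> complex" where
  "acoeff_part p \<pi> = (\<Prod>V\<in>\<pi>. acoeff p (card V))"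

definition fact_part :: "nat set set \<Rightarrow> complex" where
  "fact_part \<pi> = (\<Prod>V\<in>\<pi>. fact (card V))"

definition falling_part :: "nat \<Rightarrow> nat set set \<Rightarrow> complex" where
  "falling_part d \<pi> = (\<Prod>V\<in>\<pi>. falling d (card V))"

text \<open>Finite free cumulants of \<open>p\<close>, meaningful for \<open>1 \<le> n \<le> d\<close> with \<open>d = degree p\<close>.\<close>

definition ff_cumulant :: "complex poly \<Rightarrow> nat \<Rightarrow> complex" where
  "ff_cumulant p n = (let d = Polynomial.degree p in
     (- of_nat d) ^ n / (of_nat d * fact (n - 1)) *
     (\<Sum>\<pi>\<in>set_partitions n.
        (-1) ^ card \<pi> * (fact_part \<pi> * acoeff_part p \<pi> * fact (card \<pi> - 1)) / falling_part d \<pi>))"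

definition ff_cumulant_part :: "complex poly \<Rightarrow> nat set set \<Rightarrow> complex" where
  "ff_cumulant_part p \<pi> = (\<Prod>V\<in>\<pi>. ff_cumulant p (card V))"

text \<open>The partition of \<open>{1..n}\<close> into the cycles of a permutation, fixed points being
  singleton blocks.\<close>

definition cycle_partition :: "nat \<Rightarrow> (nat \<Rightarrow> nat) \<Rightarrow> nat set set" where
  "cycle_partition n \<alpha> = Orbits.orbit \<alpha> ` {1..n}"

definition num_cycles :: "nat \<Rightarrow> (nat \<Rightarrow> nat) \<Rightarrow> nat" where
  "num_cycles n \<alpha> = card (cycle_partition n \<alpha>)"

definition ff_cumulant_perm :: "nat \<Rightarrow> complex poly \<Rightarrow> (nat \<Rightarrow> nat) \<Rightarrow> complex" where
  "ff_cumulant_perm n p \<alpha> = ff_cumulant_part p (cycle_partition n \<alpha>)"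

definition annulus_perm :: "nat \<Rightarrow> nat \<Rightarrow> nat \<Rightarrow> nat" where
  "annulus_perm r s = cycle_of_list [1..<r + 1] \<circ> cycle_of_list [r + 1..<r + s + 1]"

definition S_NC :: "nat \<Rightarrow> nat \<Rightarrow> (nat \<Rightarrow> nat) set" where
  "S_NC r s = {\<alpha>. \<alpha> permutes {1..r + s} \<and>
     (\<forall>i\<in>{1..r + s}. \<forall>j\<in>{1..r + s}.
        \<exists>g \<in> generate (sym_group (r + s)) {\<alpha>, annulus_perm r s}. g i = j) \<and>
     num_cycles (r + s) \<alpha> + num_cycles (r + s) (inv' \<alpha> \<circ> annulus_perm r s) = r + s}"

end

theory Submission
  imports Defs
begin

text \<open>
  Both the coefficients of \<open>p\<close> and its cumulants are encoded by exponential generating functions, and the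
  defining formula of the cumulants is the logarithm of the series \<open>\<Sum>k. a\<^sub>k x\<^sup>k / (d)\<^sub>k\<close>.  Since
  \<open>(-1)\<^sup>k (d)\<^sub>k\<close> is the sum of \<open>(-d)\<^bsup>#\<beta>\<^esup>\<close> over permutations \<open>\<beta>\<close> of \<open>k\<close> points,
  \<open>d\<^sup>k k! a\<^sub>k\<close> is the sum of \<open>(-d)\<^bsup>#\<alpha> + #\<beta>\<^esup> \<kappa>\<^sub>\<alpha>\<close> over all pairs \<open>(\<alpha>, \<beta>)\<close>.  Newton's identities
  then say that the power sum of the roots is, up to an explicit factor, the same sum restricted to the
  pairs generating a transitive group.  By the genus inequality such a pair has \<open>#\<alpha> + #\<beta> \<le> n + 1\<close>,
  so the moment is a polynomial in \<open>1/d\<close>.  The leading pairs are the factorizations \<open>\<alpha>\<beta> = \<gamma>\<close> of long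
  cycles with \<open>#\<alpha> + #\<beta> = n + 1\<close>, and their cycle partitions are the non-crossing ones; in the next
  order \<open>\<alpha>\<beta>\<close> has exactly two cycles, and conjugating it to \<open>\<gamma>\<^bsub>r,s\<^esub>\<close> gives the annular
  permutations.
\<close>

subsection \<open>Orbits of a family of permutations\<close>

text \<open>The weight \<open>-d\<close> on every cycle makes the falling factorials cancel: the sum
  over \<open>\<alpha>\<close> is \<open>(-d)^k k! a_k / (d)_k\<close>, the sum over
  \<open>\<beta>\<close> is \<open>(-1)^k (d)_k\<close>. The cancellation and Newton's identities
  are available only for \<open>k \<le> d\<close>, so transitive pairs are extracted by a recursion
  that can be truncated at \<open>d\<close> rather than by a logarithm of a full power series.
  Splitting off the part that contains a chosen point gives this recursion alike for pairs, single
  permutations and set partitions.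

  After normalisation, order \<open>d^-k\<close> collects the transitive pairs with
  \<open>n + 1 - k\<close> cycles in total. The normalising \<open>(n - 1)!\<close> is the number of
  long cycles, so it disappears in the leading term. At order \<open>1/d\<close> parity excludes
  long cycles. A product of cycle lengths \<open>r\<close> and \<open>s\<close>, with a fixed point
  on the cycle of length \<open>r\<close>, occurs \<open>(n - 1)! / s\<close> times; averaging over
  the exchange of \<open>r\<close> and \<open>s\<close> gives \<open>n! / (2 r s)\<close>, the
  origin of \<open>n / (2 d)\<close>. Order \<open>n\<close> is empty because two permutations have
  at least two cycles, so the error sum stops at \<open>n - 1\<close>.\<close>

text \<open>For permutations of a finite set, inverses are reachable by forward steps, so \<open>conn M\<close> is the orbit
  relation of the group generated by \<open>M\<close>.\<close>

definition conn :: "('a \<Rightarrow> 'a) set \<Rightarrow> ('a \<times> 'a) set" where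
  "conn M = (\<Union>f\<in>M. {(x, f x) |x. True})\<^sup>*"

text \<open>Agrees with \<open>cycle_partition n\<close> for \<open>X = {1..n}\<close>. An arbitrary
  carrier allows recursion over subsets without relabelling points.\<close>

definition cyc :: "'a set \<Rightarrow> ('a \<Rightarrow> 'a) \<Rightarrow> 'a set set" where
  "cyc X f = orbit f ` X"

lemma conn_refl [simp, intro]: "(x, x) \<in> conn M"
  by (simp add: conn_def)

lemma conn_step: "f \<in> M \<Longrightarrow> (x, f x) \<in> conn M"
  unfolding conn_def by (rule r_into_rtrancl) blast

lemma conn_trans: "(x, y) \<in> conn M \<Longrightarrow> (y, z) \<in> conn M \<Longrightarrow> (x, z) \<in> conn M"
  unfolding conn_def by (rule rtrancl_trans)

lemma conn_induct [consumes 1, case_names refl step]: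
  assumes "(x, y) \<in> conn M" "P x"
    "\<And>y f. (x, y) \<in> conn M \<Longrightarrow> f \<in> M \<Longrightarrow> P y \<Longrightarrow> P (f y)"
  shows "P y"
  using assms(1) unfolding conn_def
proof (induction rule: rtrancl_induct)
  case (step y z)
  then show ?case using assms(3)[unfolded conn_def] by auto
qed (rule assms(2))

lemma conn_subset:
  assumes "\<And>f x. f \<in> M \<Longrightarrow> (x, f x) \<in> conn N"
  shows "conn M \<subseteq> conn N"
proof (clarify)
  fix a b assume "(a, b) \<in> conn M"
  then show "(a, b) \<in> conn N"
    by (induction rule: conn_induct) (auto intro: conn_trans assms)
qed

lemma conn_mono: "M \<subseteq> N \<Longrightarrow> conn M \<subseteq> conn N"
  by (rule conn_subset) (auto intro: conn_step)

lemma conn_closed: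
  assumes "(x, y) \<in> conn M" "x \<in> A" "\<And>f z. f \<in> M \<Longrightarrow> z \<in> A \<Longrightarrow> f z \<in> A"
  shows "y \<in> A"
  using assms(1,2) by (induction rule: conn_induct) (auto intro: assms(3))

definition permset :: "'a set \<Rightarrow> ('a \<Rightarrow> 'a) set \<Rightarrow> bool" where
  "permset X M \<longleftrightarrow> finite X \<and> (\<forall>f\<in>M. f permutes X)"

lemma permset_simps [simp]:
  "permset X {} \<longleftrightarrow> finite X"
  "permset X (insert f M) \<longleftrightarrow> f permutes X \<and> permset X M"
  by (auto simp: permset_def)

lemma permset_finite: "permset X M \<Longrightarrow> finite X"
  by (simp add: permset_def)

lemma orbit_self:
  assumes "finite X" "f permutes X"
  shows "x \<in> orbit f x"
  by (intro permutation_self_in_orbit permutes_imp_permutation[OF assms])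

lemma orbit_subset_conn: "y \<in> orbit f x \<Longrightarrow> (x, y) \<in> conn {f}"
  by (induction rule: orbit.induct) (auto intro: conn_step conn_trans)

lemma conn_orbit:
  assumes "finite X" "f permutes X"
  shows "(x, y) \<in> conn {f} \<longleftrightarrow> y \<in> orbit f x"
proof
  assume "(x, y) \<in> conn {f}"
  then show "y \<in> orbit f x"
    by (induction rule: conn_induct) (auto intro: orbit.step orbit_self[OF assms])
qed (rule orbit_subset_conn)

lemma conn_sym:
  assumes "permset X M" "(x, y) \<in> conn M"
  shows "(y, x) \<in> conn M"
  using assms(2)
proof (induction rule: conn_induct)
  case (step y f)
  have f: "finite X" "f permutes X" using assms(1) step(2) by (auto simp: permset_def)
  then have "y \<in> orbit f (f y)"
    using orbit_self[OF f] permutation_orbit_step[OF permutes_imp_permutation[OF f]] by simp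
  then have "(f y, y) \<in> conn M"
    using subsetD[OF conn_mono[of "{f}" M] orbit_subset_conn] step(2) by simp
  then show ?case using step(3) by (rule conn_trans)
qed simp

lemma conn_inv_step:
  assumes "permset X M" "f \<in> M"
  shows "(x, inv' f x) \<in> conn M"
proof -
  have "f permutes X" using assms by (auto simp: permset_def)
  then have "(inv' f x, x) \<in> conn M"
    using conn_step[OF assms(2), of "inv' f x"] permutes_inverses(1) by metis
  then show ?thesis by (rule conn_sym[OF assms(1)])
qed

lemma conn_in:
  assumes "permset X M" "(x, y) \<in> conn M"
  shows "x \<in> X \<longleftrightarrow> y \<in> X"
  using assms(2)
  by (induction rule: conn_induct)
    (use assms(1) permutes_in_image in \<open>fastforce simp: permset_def\<close>)+

definition comps :: "'a set \<Rightarrow> ('a \<Rightarrow> 'a) set \<Rightarrow> 'a set set" where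
  "comps X M = (\<lambda>x. conn M `` {x}) ` X"

lemma cyc_comps:
  assumes "finite X" "f permutes X"
  shows "cyc X f = comps X {f}"
  unfolding cyc_def comps_def using conn_orbit[OF assms] by (auto simp: image_def)

lemma conn_eq_class:
  assumes "permset X M"
  shows "conn M `` {x} = conn M `` {y} \<longleftrightarrow> (x, y) \<in> conn M"
proof
  assume "(x, y) \<in> conn M"
  then show "conn M `` {x} = conn M `` {y}"
    using conn_trans[of x y M] conn_trans[of y x M] conn_sym[OF assms, of x y] by blast
qed blast

text \<open>The transposition moves only \<open>i\<close> and \<open>j\<close>, so whatever becomes
  newly connected lies in the classes of these two points.\<close>

lemma conn_insert_transpose:
  assumes "permset X M" "i \<in> X" "j \<in> X"
  shows "(x, y) \<in> conn (insert (Transposition.transpose i j) M) \<longleftrightarrow>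
    (x, y) \<in> conn M \<or> ((x, i) \<in> conn M \<or> (x, j) \<in> conn M) \<and> ((y, i) \<in> conn M \<or> (y, j) \<in> conn M)"
    (is "?l \<longleftrightarrow> ?r y")
proof
  assume ?l
  then show "?r y"
  proof (induction rule: conn_induct)
    case (step y f)
    show ?case
    proof (cases "f y = y")
      case True
      then show ?thesis using step(3) by simp
    next
      case False
      show ?thesis
      proof (cases "f \<in> M")
        case True
        then have 1: "(y, f y) \<in> conn M" by (rule conn_step)
        then have 2: "(f y, y) \<in> conn M" by (rule conn_sym[OF assms(1)])
        show ?thesis using step(3) conn_trans[OF _ 1] conn_trans[OF 2] by blast
      next
        case no: False
        then have f: "f = Transposition.transpose i j" using step(2) by simp
        then consider "y = i" "f y = j" | "y = j" "f y = i"
          using False by (metis transpose_apply_first transpose_apply_other transpose_apply_second)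
        then show ?thesis using step(3) by cases auto
      qed
    qed
  qed simp
next
  let ?N = "insert (Transposition.transpose i j) M"
  have N: "permset X ?N" using assms permutes_swap_id by auto
  have ij: "(i, j) \<in> conn ?N" using conn_step[of "Transposition.transpose i j" ?N i] by simp
  have ji: "(j, i) \<in> conn ?N" by (rule conn_sym[OF N ij])
  have up: "(a, b) \<in> conn M \<Longrightarrow> (a, b) \<in> conn ?N" for a b
    using conn_mono[of M ?N] by blast
  have toi: "(z, i) \<in> conn ?N" if "(z, i) \<in> conn M \<or> (z, j) \<in> conn M" for z
    using that up conn_trans[OF up ji] by blast
  assume "?r y"
  then show ?l
    using up toi[of x] conn_sym[OF N toi[of y]] conn_trans[of x i ?N y] by blast
qed

lemma finite_comps [simp]: "finite X \<Longrightarrow> finite (comps X M)"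
  by (simp add: comps_def)

text \<open>Orbits behave like the components of a graph to which an edge between \<open>i\<close>
  and \<open>j\<close> is added.\<close>

lemma card_comps_transpose:
  assumes "permset X M" "i \<in> X" "j \<in> X"
  shows "card (comps X M) =
    card (comps X (insert (Transposition.transpose i j) M)) + (if (i, j) \<in> conn M then 0 else 1)"
proof -
  let ?N = "insert (Transposition.transpose i j) M"
  let ?c = "\<lambda>x. conn M `` {x}"
  note cit = conn_insert_transpose[OF assms]
  have fin: "finite X" using assms(1) permset_finite by blast
  show ?thesis
  proof (cases "(i, j) \<in> conn M")
    case True
    have toi: "(z, i) \<in> conn M" if "(z, i) \<in> conn M \<or> (z, j) \<in> conn M" for z
      using that conn_trans[OF _ conn_sym[OF assms(1) True], of z] by blast
    have "(x, y) \<in> conn M" if "(x, y) \<in> conn ?N" for x y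
      using that cit[of x y] conn_trans[OF toi[of x] conn_sym[OF assms(1) toi[of y]]] by blast
    then have "conn ?N = conn M"
      using conn_mono[of M ?N] by auto
    then show ?thesis using True by (simp add: comps_def)
  next
    case False
    have ne: "?c i \<noteq> ?c j" using False conn_eq_class[OF assms(1)] by blast
    let ?R = "comps X M - {?c i, ?c j}"
    have cx: "conn ?N `` {x} = (if (x,i) \<in> conn M \<or> (x,j) \<in> conn M then ?c i \<union> ?c j else ?c x)" for x
    proof (rule Set.set_eqI)
      fix y
      have s: "(a, b) \<in> conn M \<longleftrightarrow> (b, a) \<in> conn M" for a b
        using conn_sym[OF assms(1)] by blast
      have t: "(x, y) \<in> conn M \<Longrightarrow> (x, z) \<in> conn M \<Longrightarrow> (z, y) \<in> conn M" for z
        using conn_trans[of z x M y] s[of x z] by blast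
      show "y \<in> conn ?N `` {x} \<longleftrightarrow>
          y \<in> (if (x,i) \<in> conn M \<or> (x,j) \<in> conn M then ?c i \<union> ?c j else ?c x)"
        using cit[of x y] s[of y i] s[of y j] t[of i] t[of j] by auto
    qed
    have "comps X ?N = insert (?c i \<union> ?c j) ?R"
    proof
      show "comps X ?N \<subseteq> insert (?c i \<union> ?c j) ?R"
      proof
        fix C assume "C \<in> comps X ?N"
        then obtain x where x: "x \<in> X" "C = conn ?N `` {x}" by (auto simp: comps_def)
        show "C \<in> insert (?c i \<union> ?c j) ?R"
        proof (cases "(x,i) \<in> conn M \<or> (x,j) \<in> conn M")
          case True
          then show ?thesis using x cx by simp
        next
          case False
          then have "C = ?c x" "?c x \<noteq> ?c i" "?c x \<noteq> ?c j"
            using x cx conn_eq_class[OF assms(1)] by auto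
          then show ?thesis using x(1) by (auto simp: comps_def)
        qed
      qed
      show "insert (?c i \<union> ?c j) ?R \<subseteq> comps X ?N"
      proof
        fix C assume "C \<in> insert (?c i \<union> ?c j) ?R"
        then consider "C = ?c i \<union> ?c j" | "C \<in> ?R" by blast
        then show "C \<in> comps X ?N"
        proof cases
          case 1
          then have "C = conn ?N `` {i}" by (simp add: cx)
          then show ?thesis using assms(2) by (auto simp: comps_def)
        next
          case 2
          then obtain x where x: "x \<in> X" "C = ?c x" "?c x \<noteq> ?c i" "?c x \<noteq> ?c j"
            by (auto simp: comps_def)
          then have "C = conn ?N `` {x}" using cx conn_eq_class[OF assms(1)] by auto
          then show ?thesis using x(1) by (auto simp: comps_def)
        qed
      qed
    qed
    moreover have "?c i \<union> ?c j \<notin> ?R"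
    proof
      assume "?c i \<union> ?c j \<in> ?R"
      then obtain x where x: "?c i \<union> ?c j = ?c x" "?c x \<noteq> ?c i" by (auto simp: comps_def)
      then have "(x, i) \<in> conn M" by blast
      then show False using x(2) conn_eq_class[OF assms(1)] by blast
    qed
    moreover have "card ?R + 2 = card (comps X M)"
    proof -
      have "{?c i, ?c j} \<subseteq> comps X M" using assms by (auto simp: comps_def)
      then have "card ?R = card (comps X M) - card {?c i, ?c j}"
        "card {?c i, ?c j} \<le> card (comps X M)"
        by (auto intro!: card_Diff_subset card_mono simp: fin)
      then show ?thesis using ne by simp
    qed
    ultimately show ?thesis using False fin by simp
  qed
qed

text \<open>The transposition is an involution, so in its presence \<open>\<beta>\<close> and the
  product of \<open>\<beta>\<close> with it can be expressed through each other.\<close>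

lemma conn_comp_transpose:
  assumes "permset X M" "\<beta> permutes X" "i \<in> X" "j \<in> X"
  shows "conn (insert (Transposition.transpose i j) (insert (\<beta> \<circ> Transposition.transpose i j) M))
    = conn (insert (Transposition.transpose i j) (insert \<beta> M))" (is "conn ?A = conn ?B")
proof
  let ?t = "Transposition.transpose i j"
  have t: "?t permutes X" using assms by (simp add: permutes_swap_id)
  show "conn ?A \<subseteq> conn ?B"
  proof (rule conn_subset)
    fix f x assume "f \<in> ?A"
    then consider "f \<in> ?B" | "f = \<beta> \<circ> ?t" by blast
    then show "(x, f x) \<in> conn ?B"
    proof cases
      case 2
      have "(x, ?t x) \<in> conn ?B" "(?t x, \<beta> (?t x)) \<in> conn ?B" by (auto intro: conn_step)
      then show ?thesis unfolding 2 by (auto intro: conn_trans)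
    qed (rule conn_step)
  qed
  show "conn ?B \<subseteq> conn ?A"
  proof (rule conn_subset)
    fix f x assume "f \<in> ?B"
    then consider "f \<in> ?A" | "f = \<beta>" by blast
    then show "(x, f x) \<in> conn ?A"
    proof cases
      case 2
      have "(x, ?t x) \<in> conn ?A" "(?t x, (\<beta> \<circ> ?t) (?t x)) \<in> conn ?A"
        by (rule conn_step, blast)+
      then show ?thesis unfolding 2 by (auto intro: conn_trans)
    qed (rule conn_step)
  qed
qed

text \<open>The product with the transposition exchanges the images of \<open>i\<close> and
  \<open>j\<close>. Two different cycles through them are thereby spliced into one, and a single
  cycle through both is cut into two.\<close>

lemma conn_transpose_xor:
  assumes "finite X" "\<beta> permutes X" "i \<in> X" "j \<in> X" "i \<noteq> j"
  shows "(i, j) \<in> conn {\<beta> \<circ> Transposition.transpose i j} \<longleftrightarrow> (i, j) \<notin> conn {\<beta>}"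
proof -
  let ?t = "Transposition.transpose i j"
  define b where "b = \<beta> \<circ> ?t"
  have t: "?t permutes X" using assms by (simp add: permutes_swap_id)
  have pb: "b permutes X" unfolding b_def using assms(2) t by (simp add: permutes_compose)
  have bi: "b i = \<beta> j" and bj: "b j = \<beta> i" by (simp_all add: b_def)
  have bo: "b x = \<beta> x" if "x \<noteq> i" "x \<noteq> j" for x using that by (simp add: b_def transpose_def)
  note orb = conn_orbit[OF assms(1,2)] conn_orbit[OF assms(1) pb]
  have 1: "(i, j) \<in> conn {b}" if nc: "(i, j) \<notin> conn {\<beta>}"
  proof (rule ccontr)
    assume nb: "(i, j) \<notin> conn {b}"
    \<comment> \<open>Starting at \<open>b i = \<beta> j\<close>, the map \<open>b\<close> follows
      the \<open>\<beta>\<close>-cycle of \<open>j\<close>. The two maps differ only at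
      \<open>i\<close>, which is not on that cycle, and at \<open>j\<close>, which is the point to
      be reached.\<close>
    have "y \<in> orbit b i" if "y \<in> orbit \<beta> j" for y
      using that
    proof (induction rule: orbit.induct)
      case base
      then show ?case using orbit.base[of b i] bi by simp
    next
      case (step y)
      have "y \<noteq> i"
        using nc step(1) orb(1) conn_sym[of X "{\<beta>}" j i] assms(1,2) by auto
      moreover have "y \<noteq> j" using nb step(2) orb(2) by blast
      ultimately show ?case using orbit.step[OF step(2)] bo by metis
    qed
    then have "j \<in> orbit b i" using orbit_self[OF assms(1,2)] by blast
    then show False using nb orb(2) by blast
  qed
  have 2: "(i, j) \<notin> conn {b}" if c: "(i, j) \<in> conn {\<beta>}"
  proof
    assume "(i, j) \<in> conn {b}"
    then have ij: "(j, i) \<in> conn {b}" using conn_sym[of X "{b}"] pb assms(1) by simp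
    have "\<exists>n. 0 < n \<and> (\<beta> ^^ n) i = j"
      using c orb(1) by (auto simp: orbit_altdef)
    then obtain k where k: "0 < k" "(\<beta> ^^ k) i = j"
      and least: "\<And>m. m < k \<Longrightarrow> \<not> (0 < m \<and> (\<beta> ^^ m) i = j)"
      using exists_least_iff[of "\<lambda>n. 0 < n \<and> (\<beta> ^^ n) i = j"] by auto
    \<comment> \<open>The arc of the cycle from \<open>\<beta> i\<close> to the first visit of
      \<open>j\<close>. It is closed under \<open>b\<close> because \<open>b j = \<beta> i\<close>,
      and minimality of \<open>k\<close> keeps \<open>i\<close> out of it.\<close>
    let ?S = "{(\<beta> ^^ m) i | m. 1 \<le> m \<and> m \<le> k}"
    have ni: "(\<beta> ^^ m) i \<noteq> i" if "1 \<le> m" "m \<le> k" for m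
    proof
      assume e: "(\<beta> ^^ m) i = i"
      have "m \<noteq> k" using e k assms(5) by auto
      have "(\<beta> ^^ (k - m)) i = (\<beta> ^^ (k - m)) ((\<beta> ^^ m) i)" using e by simp
      also have "\<dots> = (\<beta> ^^ k) i" using that by (simp flip: funpow_add comp_apply[of "\<beta> ^^ (k - m)"])
      finally show False using least[of "k - m"] k that \<open>m \<noteq> k\<close> by simp
    qed
    have "i \<in> ?S"
    proof (rule conn_closed[OF ij])
      show "j \<in> ?S" using k by force
      fix f z assume f: "f \<in> {b}" and "z \<in> ?S"
      then obtain m where m: "z = (\<beta> ^^ m) i" "1 \<le> m" "m \<le> k" by blast
      show "f z \<in> ?S"
      proof (cases "m = k")
        case True
        then have "f z = (\<beta> ^^ 1) i" using m k bj f by simp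
        then show ?thesis using k by force
      next
        case False
        then have "z \<noteq> i" "z \<noteq> j" using ni[of m] least[of m] m by auto
        then have "f z = (\<beta> ^^ (Suc m)) i" using bo m f by simp
        moreover have "Suc m \<le> k" using False m by simp
        ultimately show ?thesis by (metis (mono_tags, lifting) One_nat_def Suc_le_mono le0 mem_Collect_eq)
      qed
    qed
    then show False using ni by force
  qed
  show ?thesis using 1 2 unfolding b_def by blast
qed

text \<open>Adding the transposition to \<open>{\<beta>}\<close> and to the singleton of the product
  gives families with the same orbits. By \<open>conn_transpose_xor\<close> exactly one of the two
  additions merges classes, so the two cycle counts differ by one.\<close>

lemma card_cyc_comp_transpose:
  assumes "finite X" "\<beta> permutes X" "i \<in> X" "j \<in> X" "i \<noteq> j"
  shows "(i, j) \<in> conn {\<beta>} \<Longrightarrow>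
      card (cyc X (\<beta> \<circ> Transposition.transpose i j)) = card (cyc X \<beta>) + 1"
    and "(i, j) \<notin> conn {\<beta>} \<Longrightarrow>
      card (cyc X (\<beta> \<circ> Transposition.transpose i j)) + 1 = card (cyc X \<beta>)"
proof -
  let ?t = "Transposition.transpose i j"
  let ?b = "\<beta> \<circ> ?t"
  have t: "?t permutes X" using assms by (simp add: permutes_swap_id)
  have pb: "?b permutes X" using assms(2) t by (simp add: permutes_compose)
  have e: "card (comps X {?t, ?b}) = card (comps X {?t, \<beta>})"
    unfolding comps_def using conn_comp_transpose[of X "{}" \<beta> i j] assms by simp
  note c = card_comps_transpose[of X "{?b}" i j] card_comps_transpose[of X "{\<beta>}" i j]
  note x = conn_transpose_xor[OF assms]
  show "(i, j) \<in> conn {\<beta>} \<Longrightarrow> card (cyc X ?b) = card (cyc X \<beta>) + 1"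
    "(i, j) \<notin> conn {\<beta>} \<Longrightarrow> card (cyc X ?b) + 1 = card (cyc X \<beta>)"
    using c x e assms pb by (auto simp: cyc_comps)
qed

subsection \<open>The genus inequality\<close>

lemma finite_cyc [simp]: "finite X \<Longrightarrow> finite (cyc X f)"
  by (simp add: cyc_def)

lemma card_cyc_le: "finite X \<Longrightarrow> card (cyc X f) \<le> card X"
  unfolding cyc_def by (rule card_image_le)

lemma cyc_id: "cyc X id = (\<lambda>x. {x}) ` X"
proof -
  have "orbit id x = {x}" for x :: 'a by (simp add: orbit_eq_singleton_iff)
  then show ?thesis by (simp add: cyc_def)
qed

lemma card_cyc_id: "card (cyc X id) = card X"
  unfolding cyc_id by (rule card_image) simp

text \<open>Splitting a cycle of \<open>\<beta>\<close> by a transposition changes the number of cycles of the product by one; if it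
  also splits an orbit of the pair, then the product must gain a cycle.\<close>

lemma genus_bound:
  assumes "finite X" "\<alpha> permutes X" "\<beta> permutes X"
  shows "card (cyc X \<alpha>) + card (cyc X \<beta>) + card (cyc X (\<alpha> \<circ> \<beta>)) \<le> card X + 2 * card (comps X {\<alpha>, \<beta>})
    \<and> even (card (cyc X \<alpha>) + card (cyc X \<beta>) + card (cyc X (\<alpha> \<circ> \<beta>)) + card X)"
  using assms(3)
\<comment> \<open>The measure is the least number of transpositions with product
  \<open>\<beta>\<close>.\<close>
proof (induction "card X - card (cyc X \<beta>)" arbitrary: \<beta> rule: less_induct)
  case less
  show ?case
  proof (cases "\<beta> = id")
    case True
    have "conn {\<alpha>, id} = conn {\<alpha>}"
      by (rule equalityI; rule conn_subset) (auto intro: conn_step)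
    then have "card (comps X {\<alpha>, id}) = card (cyc X \<alpha>)"
      using assms by (simp add: cyc_comps comps_def)
    then show ?thesis unfolding True comp_id card_cyc_id by presburger
  next
    case False
    then obtain i where i: "\<beta> i \<noteq> i" by (auto simp: fun_eq_iff)
    define j where "j = \<beta> i"
    have X: "i \<in> X" "j \<in> X" and ne: "i \<noteq> j"
      using i less.prems permutes_not_in[OF less.prems] permutes_in_image[OF less.prems]
      by (auto simp: j_def)
    let ?t = "Transposition.transpose i j"
    define b where "b = \<beta> \<circ> ?t"
    have b: "b permutes X"
      unfolding b_def using permutes_swap_id[OF X] less.prems by (rule permutes_compose)
    have beta: "\<beta> = b \<circ> ?t" by (simp add: b_def fun_eq_iff)
    have ij: "(i, j) \<in> conn {\<beta>}" unfolding j_def by (rule conn_step) simp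
    have cb: "card (cyc X b) = card (cyc X \<beta>) + 1"
      unfolding b_def using card_cyc_comp_transpose(1)[OF assms(1) less.prems X ne ij] .
    have nb: "(i, j) \<notin> conn {b}"
      using conn_transpose_xor[OF assms(1) less.prems X ne] ij by (simp add: b_def)
    have ab: "\<alpha> \<circ> b permutes X" using b assms(2) by (rule permutes_compose)
    have aeq: "\<alpha> \<circ> \<beta> = (\<alpha> \<circ> b) \<circ> ?t" by (simp add: beta comp_assoc)
    have cle: "card (cyc X b) \<le> card X" by (rule card_cyc_le[OF assms(1)])
    have IH: "card (cyc X \<alpha>) + card (cyc X b) + card (cyc X (\<alpha> \<circ> b)) \<le> card X + 2 * card (comps X {\<alpha>, b})"
      "even (card (cyc X \<alpha>) + card (cyc X b) + card (cyc X (\<alpha> \<circ> b)) + card X)"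
      using less.hyps[OF _ b] cb cle by auto
    have "card (comps X {\<alpha>, \<beta>}) = card (comps X {?t, \<alpha>, \<beta>})"
    proof -
      have "(i, j) \<in> conn {\<alpha>, \<beta>}"
        using ij conn_mono[of "{\<beta>}" "{\<alpha>, \<beta>}"] by blast
      then show ?thesis
        using card_comps_transpose[of X "{\<alpha>, \<beta>}" i j] X assms less.prems by simp
    qed
    also have "{?t, \<alpha>, \<beta>} = {?t, \<beta>, \<alpha>}" by blast
    also have "card (comps X {?t, \<beta>, \<alpha>}) = card (comps X {?t, b, \<alpha>})"
      using conn_comp_transpose[of X "{\<alpha>}" \<beta> i j] X assms less.prems
      by (simp add: comps_def b_def)
    also have "{?t, b, \<alpha>} = {?t, \<alpha>, b}" by blast
    finally have cc: "card (comps X {\<alpha>, b}) =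
        card (comps X {\<alpha>, \<beta>}) + (if (i, j) \<in> conn {\<alpha>, b} then 0 else 1)"
      using card_comps_transpose[of X "{\<alpha>, b}" i j] X assms b by simp
    have sub: "(i, j) \<in> conn {\<alpha>, b}" if c: "(i, j) \<in> conn {\<alpha> \<circ> b}"
    proof -
      have "(x, (\<alpha> \<circ> b) x) \<in> conn {\<alpha>, b}" for x
        using conn_step[of b "{\<alpha>, b}" x] conn_step[of \<alpha> "{\<alpha>, b}" "b x"]
        by (auto intro: conn_trans)
      then show ?thesis using conn_subset[of "{\<alpha> \<circ> b}" "{\<alpha>, b}"] c by blast
    qed
    show ?thesis
    proof (cases "(i, j) \<in> conn {\<alpha> \<circ> b}")
      case True
      then have "card (cyc X (\<alpha> \<circ> \<beta>)) = card (cyc X (\<alpha> \<circ> b)) + 1"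
        unfolding aeq using card_cyc_comp_transpose(1)[OF assms(1) ab X ne] by simp
      moreover have "card (comps X {\<alpha>, b}) = card (comps X {\<alpha>, \<beta>})" using cc sub[OF True] by simp
      moreover have eq: "card (cyc X \<alpha>) + card (cyc X b) + card (cyc X (\<alpha> \<circ> b))
          = card (cyc X \<alpha>) + card (cyc X \<beta>) + card (cyc X (\<alpha> \<circ> \<beta>))"
        using calculation(1) cb by linarith
      ultimately show ?thesis using IH unfolding eq by (simp only: simp_thms)
    next
      case False
      then have e: "card (cyc X (\<alpha> \<circ> \<beta>)) + 1 = card (cyc X (\<alpha> \<circ> b))"
        unfolding aeq using card_cyc_comp_transpose(2)[OF assms(1) ab X ne] by simp
      \<comment> \<open>Passing from \<open>b\<close> to \<open>\<beta>\<close> costs one cycle of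
        the factor and one of the product. This drop of two pays for the single orbit that the pair
        may lose, since orbits count twice in the bound.\<close>
      have eq: "card (cyc X \<alpha>) + card (cyc X b) + card (cyc X (\<alpha> \<circ> b))
          = card (cyc X \<alpha>) + card (cyc X \<beta>) + card (cyc X (\<alpha> \<circ> \<beta>)) + 2" using e cb by simp
      moreover have "card (comps X {\<alpha>, b}) \<le> card (comps X {\<alpha>, \<beta>}) + 1" using cc by simp
      moreover have "even (card (cyc X \<alpha>) + card (cyc X \<beta>) + card (cyc X (\<alpha> \<circ> \<beta>)) + card X)"
      proof -
        have "even (card (cyc X \<alpha>) + card (cyc X \<beta>) + card (cyc X (\<alpha> \<circ> \<beta>)) + card X + 2)"
          using IH(2) unfolding eq by (simp only: ac_simps)
        then show ?thesis by (simp only: even_add even_numeral)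
      qed
      ultimately show ?thesis using IH(1) by linarith
    qed
  qed
qed

definition transitive_on :: "'a set \<Rightarrow> ('a \<Rightarrow> 'a) set \<Rightarrow> bool" where
  "transitive_on X M \<longleftrightarrow> (\<forall>x\<in>X. \<forall>y\<in>X. (x, y) \<in> conn M)"

text \<open>The empty set is vacuously transitive but has no class, hence the condition
  \<open>X \<noteq> {}\<close>.\<close>

lemma card_comps_transitive:
  assumes "permset X M" "X \<noteq> {}"
  shows "transitive_on X M \<longleftrightarrow> card (comps X M) = 1"
proof
  assume t: "transitive_on X M"
  obtain x where x: "x \<in> X" using assms by blast
  have "conn M `` {y} = conn M `` {x}" if "y \<in> X" for y
    unfolding conn_eq_class[OF assms(1)] using t x that by (simp add: transitive_on_def)
  then have "comps X M = {conn M `` {x}}" using x unfolding comps_def by blast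
  then show "card (comps X M) = 1" by simp
next
  assume "card (comps X M) = 1"
  then obtain C where C: "comps X M = {C}" by (auto simp: card_1_singleton_iff)
  have "conn M `` {x} \<in> comps X M" if "x \<in> X" for x
    unfolding comps_def using that by (rule imageI)
  then have "conn M `` {x} = C" if "x \<in> X" for x
    unfolding C using that by simp
  then have "conn M `` {x} = conn M `` {y}" if "x \<in> X" "y \<in> X" for x y
    using that by metis
  then show "transitive_on X M"
    using conn_eq_class[OF assms(1)] by (auto simp: transitive_on_def)
qed

text \<open>\<open>card X - card (cyc X \<alpha>)\<close> is the length of \<open>\<alpha>\<close> with respect to transpositions.\<close>

lemma card_cyc_triangle:
  assumes "finite X" "\<alpha> permutes X" "\<beta> permutes X"
  shows "card (cyc X \<alpha>) + card (cyc X \<beta>) \<le> card X + card (cyc X (\<alpha> \<circ> \<beta>))"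
proof -
  have ab: "\<alpha> \<circ> \<beta> permutes X" using assms(3,2) by (rule permutes_compose)
  have sub: "conn {\<alpha> \<circ> \<beta>} \<subseteq> conn {\<alpha>, \<beta>}"
  proof (rule conn_subset)
    fix f x assume "f \<in> {\<alpha> \<circ> \<beta>}"
    then show "(x, f x) \<in> conn {\<alpha>, \<beta>}"
      using conn_step[of \<beta> "{\<alpha>, \<beta>}" x] conn_step[of \<alpha> "{\<alpha>, \<beta>}" "\<beta> x"]
      by (auto intro: conn_trans)
  qed
  \<comment> \<open>Each orbit of the pair is the saturation of a cycle of the product, so the pair
    has at most as many orbits as the product has cycles. With this bound on the orbits,
    \<open>genus_bound\<close> becomes the triangle inequality.\<close>
  have "comps X {\<alpha>, \<beta>} \<subseteq> (\<lambda>C. conn {\<alpha>, \<beta>} `` C) ` comps X {\<alpha> \<circ> \<beta>}"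
  proof
    fix D assume "D \<in> comps X {\<alpha>, \<beta>}"
    then obtain x where x: "x \<in> X" "D = conn {\<alpha>, \<beta>} `` {x}" by (auto simp: comps_def)
    have "D = conn {\<alpha>, \<beta>} `` (conn {\<alpha> \<circ> \<beta>} `` {x})"
    proof
      show "D \<subseteq> conn {\<alpha>, \<beta>} `` (conn {\<alpha> \<circ> \<beta>} `` {x})" unfolding x by auto
      show "conn {\<alpha>, \<beta>} `` (conn {\<alpha> \<circ> \<beta>} `` {x}) \<subseteq> D"
        unfolding x using sub conn_trans[of x _ "{\<alpha>, \<beta>}"] by blast
    qed
    then show "D \<in> (\<lambda>C. conn {\<alpha>, \<beta>} `` C) ` comps X {\<alpha> \<circ> \<beta>}"
      using x(1) by (auto simp: comps_def)
  qed
  then have "card (comps X {\<alpha>, \<beta>}) \<le> card (comps X {\<alpha> \<circ> \<beta>})"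
    using assms(1) by (meson card_image_le card_mono finite_comps finite_imageI le_trans)
  then show ?thesis
    using genus_bound[OF assms] cyc_comps[OF assms(1) ab] by simp
qed

subsection \<open>Splitting a permutation along an invariant set\<close>

lemma permutes_Un_eq:
  assumes "f permutes A" "g permutes B" "A \<inter> B = {}"
  shows "x \<in> A \<Longrightarrow> (f \<circ> g) x = f x" "x \<in> B \<Longrightarrow> (f \<circ> g) x = g x"
proof -
  show "(f \<circ> g) x = f x" if "x \<in> A"
    using that assms(3) permutes_not_in[OF assms(2), of x] by (metis comp_apply disjoint_iff)
  show "(f \<circ> g) x = g x" if "x \<in> B"
    using that assms(3) permutes_not_in[OF assms(1), of "g x"] permutes_in_image[OF assms(2), of x] by auto
qed

lemma permutes_Un_comp:
  assumes "f permutes A" "g permutes B"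
  shows "f \<circ> g permutes A \<union> B"
  using permutes_compose[OF permutes_subset[OF assms(2)] permutes_subset[OF assms(1)], of "A \<union> B"] by simp

lemma perm_restrict_permutes_inv:
  assumes "\<alpha> permutes X" "\<alpha> ` A = A" "A \<subseteq> X"
  shows "perm_restrict \<alpha> A permutes A"
  using assms by (intro bij_imp_permutes)
    (auto simp: perm_restrict_def bij_betw_def inj_on_def dest: permutes_inj[THEN injD])

text \<open>A permutation that preserves \<open>A\<close> also preserves \<open>X - A\<close> and is
  the product of its two restrictions, each extended by the identity.\<close>

lemma sum_permutes_invariant:
  assumes "finite X" "A \<subseteq> X"
  shows "(\<Sum>\<alpha> | \<alpha> permutes X \<and> \<alpha> ` A = A. h \<alpha>) =
    (\<Sum>f | f permutes A. \<Sum>g | g permutes X - A. h (f \<circ> g))"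
proof -
  have dis: "A \<inter> (X - A) = {}" by blast
  have un: "A \<union> (X - A) = X" using assms(2) by blast
  note eqs = permutes_Un_eq[OF _ _ dis]
  have "(\<Sum>f | f permutes A. \<Sum>g | g permutes X - A. h (f \<circ> g)) =
    (\<Sum>(f, g)\<in>{f. f permutes A} \<times> {g. g permutes X - A}. h (f \<circ> g))"
    using assms by (subst sum.cartesian_product) simp
  also have "\<dots> = (\<Sum>\<alpha> | \<alpha> permutes X \<and> \<alpha> ` A = A. h \<alpha>)"
  proof (rule sum.reindex_bij_witness[where j = "\<lambda>(f, g). f \<circ> g"
        and i = "\<lambda>\<alpha>. (perm_restrict \<alpha> A, perm_restrict \<alpha> (X - A))"]; clarsimp?)
    fix f g assume fg: "f permutes A" "g permutes X - A"
    show "perm_restrict (f \<circ> g) A = f \<and> perm_restrict (f \<circ> g) (X - A) = g"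
      using eqs[OF fg] permutes_not_in[OF fg(1)] permutes_not_in[OF fg(2)]
      by (auto simp: perm_restrict_def fun_eq_iff)
    show "f \<circ> g permutes X \<and> (\<lambda>x. f (g x)) ` A = A"
    proof
      show "f \<circ> g permutes X" using permutes_Un_comp[OF fg] un by simp
      have "(\<lambda>x. f (g x)) ` A = f ` A"
        by (rule image_cong) (use eqs(1)[OF fg] in auto)
      then show "(\<lambda>x. f (g x)) ` A = A" using permutes_image[OF fg(1)] by simp
    qed
  next
    fix \<alpha> assume a: "\<alpha> permutes X" "\<alpha> ` A = A"
    have b: "\<alpha> ` (X - A) = X - A"
      using a permutes_image[OF a(1)] permutes_inj[OF a(1)] by (simp add: image_set_diff)
    have r: "perm_restrict \<alpha> A permutes A" "perm_restrict \<alpha> (X - A) permutes X - A"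
      using perm_restrict_permutes_inv[OF a assms(2)] perm_restrict_permutes_inv[OF a(1) b] by auto
    show "perm_restrict \<alpha> A permutes A \<and> perm_restrict \<alpha> (X - A) permutes X - A"
      using r by blast
    show "perm_restrict \<alpha> A \<circ> perm_restrict \<alpha> (X - A) = \<alpha>"
    proof
      fix x
      consider "x \<in> A" | "x \<in> X - A" | "x \<notin> X" by blast
      then show "(perm_restrict \<alpha> A \<circ> perm_restrict \<alpha> (X - A)) x = \<alpha> x"
      proof cases
        case 1 then show ?thesis using eqs(1)[OF r] by (simp add: perm_restrict_def)
      next
        case 2 then show ?thesis using eqs(2)[OF r] by (simp add: perm_restrict_def)
      next
        case 3 then show ?thesis using permutes_not_in[OF a(1)] assms(2) by (auto simp: perm_restrict_def)
      qed
    qed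
  qed
  finally show ?thesis by simp
qed

lemma orbit_comp_disjoint:
  assumes "f permutes A" "g permutes B" "A \<inter> B = {}"
  shows "x \<in> A \<Longrightarrow> orbit (f \<circ> g) x = orbit f x" "x \<in> B \<Longrightarrow> orbit (f \<circ> g) x = orbit g x"
proof -
  have 1: "orbit h x = orbit k x \<and> orbit k x \<subseteq> C"
    if k: "k permutes C" and e: "\<And>y. y \<in> C \<Longrightarrow> h y = k y" and x: "x \<in> C" for h k :: "'a \<Rightarrow> 'a" and C x
  proof -
    have "y \<in> C \<and> y \<in> orbit k x" if "y \<in> orbit h x" for y
      using that
    proof induction
      case base then show ?case using e[OF x] permutes_in_image[OF k] x by (simp add: orbit.base)
    next
      case (step y) then show ?case using e[of y] permutes_in_image[OF k] by (simp add: orbit.step)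
    qed
    moreover have "y \<in> C \<and> y \<in> orbit h x" if "y \<in> orbit k x" for y
      using that
    proof induction
      case base then show ?case using orbit.base[of h x] e[OF x] permutes_in_image[OF k] x by simp
    next
      case (step y) then show ?case using orbit.step[of y h x] e[of y] permutes_in_image[OF k] by simp
    qed
    ultimately show ?thesis by blast
  qed
  note eqs = permutes_Un_eq[OF assms]
  show "orbit (f \<circ> g) x = orbit f x" if "x \<in> A" using 1[OF assms(1) eqs(1) that] by blast
  show "orbit (f \<circ> g) x = orbit g x" if "x \<in> B" using 1[OF assms(2) eqs(2) that] by blast
qed

lemma orbit_subset_perm:
  assumes "f permutes A" "x \<in> A"
  shows "orbit f x \<subseteq> A"
proof
  fix y assume "y \<in> orbit f x"
  then show "y \<in> A" by induction (use assms permutes_in_image in fastforce)+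
qed

lemma cyc_comp_disjoint:
  assumes "f permutes A" "g permutes B" "A \<inter> B = {}"
  shows "cyc (A \<union> B) (f \<circ> g) = cyc A f \<union> cyc B g" "cyc A f \<inter> cyc B g = {}"
proof -
  have "(\<lambda>x. orbit (f \<circ> g) x) ` A = orbit f ` A" "(\<lambda>x. orbit (f \<circ> g) x) ` B = orbit g ` B"
    by (rule image_cong, simp, rule orbit_comp_disjoint[OF assms], assumption)+
  then show "cyc (A \<union> B) (f \<circ> g) = cyc A f \<union> cyc B g"
    by (simp add: cyc_def image_Un)
  show "cyc A f \<inter> cyc B g = {}"
  proof (rule ccontr)
    assume "cyc A f \<inter> cyc B g \<noteq> {}"
    then obtain x y where "x \<in> A" "y \<in> B" "orbit f x = orbit g y" by (auto simp: cyc_def)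
    then show False
      using orbit_subset_perm[OF assms(1)] orbit_subset_perm[OF assms(2)] assms(3) orbit_nonempty[of f x]
      by blast
  qed
qed

text \<open>One weight covers all the sums below: cumulants give \<open>ff_cumulant_perm\<close>, a
  constant \<open>c\<close> gives \<open>c\<close> to the number of cycles, and
  \<open>delta1\<close> gives the indicator of the identity.\<close>

definition wt :: "(nat \<Rightarrow> 'b::comm_monoid_mult) \<Rightarrow> 'a set \<Rightarrow> ('a \<Rightarrow> 'a) \<Rightarrow> 'b" where
  "wt u X f = (\<Prod>V\<in>cyc X f. u (card V))"

lemma wt_comp_disjoint:
  assumes "f permutes A" "g permutes B" "A \<inter> B = {}" "finite A" "finite B"
  shows "wt u (A \<union> B) (f \<circ> g) = wt u A f * wt u B g"
  unfolding wt_def cyc_comp_disjoint(1)[OF assms(1-3)]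
  by (rule prod.union_disjoint) (use assms cyc_comp_disjoint(2)[OF assms(1-3)] in \<open>auto simp: cyc_def\<close>)

lemma conn_comp_disjoint:
  assumes "f permutes A" "g permutes B" "f' permutes A" "g' permutes B" "A \<inter> B = {}" "x \<in> A"
  shows "(x, y) \<in> conn {f \<circ> g, f' \<circ> g'} \<longleftrightarrow> (x, y) \<in> conn {f, f'}"
proof
  note e = permutes_Un_eq[OF assms(1,2,5)] permutes_Un_eq[OF assms(3,4,5)]
  assume "(x, y) \<in> conn {f \<circ> g, f' \<circ> g'}"
  then have "y \<in> A \<and> (x, y) \<in> conn {f, f'}"
  proof (induction rule: conn_induct)
    case (step y h)
    then have "h y = f y \<or> h y = f' y" using e(1)[of y] e(3)[of y] by auto
    then show ?case
      using step(3) permutes_in_image[OF assms(1), of y] permutes_in_image[OF assms(3), of y]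
        conn_step[of f "{f, f'}" y] conn_step[of f' "{f, f'}" y] conn_trans[of x y "{f, f'}"] by auto
  qed (simp add: assms(6))
  then show "(x, y) \<in> conn {f, f'}" ..
next
  note e = permutes_Un_eq[OF assms(1,2,5)] permutes_Un_eq[OF assms(3,4,5)]
  let ?M = "{f \<circ> g, f' \<circ> g'}"
  assume "(x, y) \<in> conn {f, f'}"
  then have "y \<in> A \<and> (x, y) \<in> conn ?M"
  proof (induction rule: conn_induct)
    case (step y h)
    then have h: "h y = (f \<circ> g) y \<or> h y = (f' \<circ> g') y" "h y \<in> A"
      using e(1)[of y] e(3)[of y] permutes_in_image[OF assms(1), of y] permutes_in_image[OF assms(3), of y] by auto
    have "(y, (f \<circ> g) y) \<in> conn ?M" "(y, (f' \<circ> g') y) \<in> conn ?M"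
      by (rule conn_step, blast)+
    then have "(y, h y) \<in> conn ?M" using h(1) by metis
    then show ?case using step(3) h(2) conn_trans[of x y ?M] by blast
  qed (simp add: assms(6))
  then show "(x, y) \<in> conn ?M" ..
qed

section \<open>Exponential formula for pairs of permutations\<close>

definition pair_total :: "(nat \<Rightarrow> 'b::comm_semiring_1) \<Rightarrow> (nat \<Rightarrow> 'b) \<Rightarrow> 'a set \<Rightarrow> 'b" where
  "pair_total u v X = (\<Sum>f | f permutes X. \<Sum>g | g permutes X. wt u X f * wt v X g)"

definition pair_conn :: "(nat \<Rightarrow> 'b::comm_semiring_1) \<Rightarrow> (nat \<Rightarrow> 'b) \<Rightarrow> 'a set \<Rightarrow> 'b" where
  "pair_conn u v X = (\<Sum>f | f permutes X. \<Sum>g | g permutes X.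
     if transitive_on X {f, g} then wt u X f * wt v X g else 0)"

text \<open>The block \<open>A\<close> is the orbit of \<open>x\<close> under the group generated by the pair.\<close>

lemma pair_total_rec:
  assumes "finite X" "x \<in> X"
  shows "pair_total u v X = (\<Sum>A | x \<in> A \<and> A \<subseteq> X. pair_conn u v A * pair_total u v (X - A))"
proof -
  let ?P = "\<lambda>X. {f. f permutes X}"
  let ?F = "\<lambda>X f g. wt u X f * wt v X g"
  have fin: "finite (?P A)" if "A \<subseteq> X" for A
    using finite_permutations finite_subset[OF that assms(1)] by blast
  have part: "?F X f g = (\<Sum>A | x \<in> A \<and> A \<subseteq> X. if conn {f, g} `` {x} = A then ?F X f g else 0)"
    if "f permutes X" "g permutes X" for f g
  proof -
    have "conn {f, g} `` {x} \<subseteq> X"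
      using conn_in[of X "{f, g}" x] that assms by auto
    then have "conn {f, g} `` {x} \<in> {A. x \<in> A \<and> A \<subseteq> X}" by simp
    then show ?thesis using assms(1) by (subst sum.delta') auto
  qed
  have "pair_total u v X = (\<Sum>f\<in>?P X. \<Sum>g\<in>?P X. \<Sum>A | x \<in> A \<and> A \<subseteq> X. if conn {f, g} `` {x} = A then ?F X f g else 0)"
    unfolding pair_total_def by (intro sum.cong refl) (use part in auto)
  also have "\<dots> = (\<Sum>A | x \<in> A \<and> A \<subseteq> X. \<Sum>f\<in>?P X. \<Sum>g\<in>?P X. if conn {f, g} `` {x} = A then ?F X f g else 0)"
    by (simp only: sum.swap[of _ "{A. x \<in> A \<and> A \<subseteq> X}"])
  also have "\<dots> = (\<Sum>A | x \<in> A \<and> A \<subseteq> X. pair_conn u v A * pair_total u v (X - A))"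
  proof (rule sum.cong[OF refl])
    fix A assume "A \<in> {A. x \<in> A \<and> A \<subseteq> X}"
    then have A: "x \<in> A" "A \<subseteq> X" by auto
    have fA: "finite A" "finite (X - A)" using A assms finite_subset by auto
    have dis: "A \<inter> (X - A) = {}" and un: "A \<union> (X - A) = X" using A by auto
    let ?Q = "{f. f permutes X \<and> f ` A = A}"
    \<comment> \<open>Only permutations preserving \<open>A\<close> survive: an orbit of the pair is
      mapped into itself, and an injection of a finite set into itself is onto. This allows the sums
      over \<open>f\<close> and \<open>g\<close> to be restricted one after the other and then
      factored.\<close>
    have inv: "h ` A = A" if e: "conn {f, g} `` {x} = A" and p: "f permutes X" "g permutes X" and h: "h \<in> {f, g}" for f g h
    proof (rule card_subset_eq[OF fA(1)])
      show "h ` A \<subseteq> A" using e conn_step[OF h] conn_trans by fastforce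
      have "inj h" using p h permutes_inj by auto
      then show "card (h ` A) = card A" by (meson card_image inj_on_subset subset_UNIV)
    qed
    have "(\<Sum>f\<in>?P X. \<Sum>g\<in>?P X. if conn {f, g} `` {x} = A then ?F X f g else 0)
      = (\<Sum>f\<in>?P X. \<Sum>g\<in>?Q. if conn {f, g} `` {x} = A then ?F X f g else 0)"
    proof (rule sum.cong[OF refl], rule sum.mono_neutral_right)
      fix f assume "f \<in> ?P X"
      then show "\<forall>g\<in>?P X - ?Q. (if conn {f, g} `` {x} = A then ?F X f g else 0) = 0"
        using inv[of f _ _] by (metis (mono_tags, lifting) DiffE insertI1 insertI2 mem_Collect_eq)
    qed (use fin[of X] in auto)
    also have "\<dots> = (\<Sum>f\<in>?Q. \<Sum>g\<in>?Q. if conn {f, g} `` {x} = A then ?F X f g else 0)"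
    proof (rule sum.mono_neutral_right)
      show "\<forall>f\<in>?P X - ?Q. (\<Sum>g\<in>?Q. if conn {f, g} `` {x} = A then ?F X f g else 0) = 0"
      proof (intro ballI sum.neutral)
        fix f g assume "f \<in> ?P X - ?Q" "g \<in> ?Q"
        then show "(if conn {f, g} `` {x} = A then ?F X f g else 0) = 0"
          using inv[of f g f] by (cases "conn {f, g} `` {x} = A") simp_all
      qed
    qed (use fin[of X] in auto)
    also have "\<dots> = (\<Sum>f\<in>?P A. \<Sum>f'\<in>?P (X - A). \<Sum>g\<in>?P A. \<Sum>g'\<in>?P (X - A).
        if conn {f \<circ> f', g \<circ> g'} `` {x} = A then ?F X (f \<circ> f') (g \<circ> g') else 0)"
      unfolding sum_permutes_invariant[OF assms(1) A(2)] ..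
    also have "\<dots> = (\<Sum>f\<in>?P A. \<Sum>f'\<in>?P (X - A). \<Sum>g\<in>?P A. \<Sum>g'\<in>?P (X - A).
        (if transitive_on A {f, g} then ?F A f g else 0) * ?F (X - A) f' g')"
    proof (intro sum.cong refl)
      fix f f' g g' assume p: "f \<in> ?P A" "f' \<in> ?P (X - A)" "g \<in> ?P A" "g' \<in> ?P (X - A)"
      then have "conn {f \<circ> f', g \<circ> g'} `` {x} = conn {f, g} `` {x}"
        using conn_comp_disjoint[of f A f' "X - A" g g' x] dis A by auto
      moreover have "conn {f, g} `` {x} \<subseteq> A"
        using conn_in[of A "{f, g}" x] p fA A by auto
      moreover have "A \<subseteq> conn {f, g} `` {x} \<longleftrightarrow> transitive_on A {f, g}"
      proof -
        have pp: "permset A {f, g}" using p fA by simp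
        have "transitive_on A {f, g}" if "A \<subseteq> conn {f, g} `` {x}"
          unfolding transitive_on_def
        proof (intro ballI)
          fix a b assume "a \<in> A" "b \<in> A"
          then have "(x, a) \<in> conn {f, g}" "(x, b) \<in> conn {f, g}" using that by auto
          then show "(a, b) \<in> conn {f, g}" using conn_trans[OF conn_sym[OF pp]] by blast
        qed
        then show ?thesis using A(1) by (auto simp: transitive_on_def)
      qed
      moreover have "?F X (f \<circ> f') (g \<circ> g') = ?F A f g * ?F (X - A) f' g'"
        using wt_comp_disjoint[of f A f' "X - A" u] wt_comp_disjoint[of g A g' "X - A" v] p dis un fA
        by (simp add: algebra_simps)
      ultimately show "(if conn {f \<circ> f', g \<circ> g'} `` {x} = A then ?F X (f \<circ> f') (g \<circ> g') else 0) =
        (if transitive_on A {f, g} then ?F A f g else 0) * ?F (X - A) f' g'"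
        by auto
    qed
    also have "\<dots> = (\<Sum>f\<in>?P A. \<Sum>g\<in>?P A. \<Sum>f'\<in>?P (X - A). \<Sum>g'\<in>?P (X - A).
        (if transitive_on A {f, g} then ?F A f g else 0) * ?F (X - A) f' g')"
      by (rule sum.cong[OF refl], rule sum.swap)
    also have "\<dots> = pair_conn u v A * pair_total u v (X - A)"
      unfolding pair_conn_def pair_total_def
      by (simp only: sum_distrib_right) (simp only: sum_distrib_left)
    finally show "(\<Sum>f\<in>?P X. \<Sum>g\<in>?P X. if conn {f, g} `` {x} = A then ?F X f g else 0)
      = pair_conn u v A * pair_total u v (X - A)" .
  qed
  finally show ?thesis .
qed

subsection \<open>Connected and total weights\<close>

lemma sum_Pow_card:
  fixes h :: "nat \<Rightarrow> 'b::comm_semiring_1"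
  assumes "finite Y"
  shows "(\<Sum>B\<in>Pow Y. h (card B)) = (\<Sum>j\<le>card Y. of_nat (card Y choose j) * h j)"
proof -
  have "(\<Sum>B\<in>Pow Y. h (card B)) = (\<Sum>j\<le>card Y. \<Sum>B | B \<in> Pow Y \<and> card B = j. h (card B))"
    by (rule sum.group[symmetric]) (use assms card_mono in auto)
  also have "\<dots> = (\<Sum>j\<le>card Y. of_nat (card Y choose j) * h j)"
    by (rule sum.cong[OF refl]) (simp add: n_subsets[OF assms])
  finally show ?thesis .
qed

text \<open>With \<open>k = card X\<close>, there are \<open>(k - 1) choose (j - 1)\<close> subsets
  of size \<open>j\<close> through \<open>x\<close>, and multiplied by
  \<open>(j - 1)! (k - j)!\<close> this is \<open>(k - 1)!\<close> for every
  \<open>j\<close>.\<close>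

lemma sum_subsets_containing:
  fixes \<chi> \<tau> :: "nat \<Rightarrow> complex"
  assumes "finite X" "x \<in> X"
  shows "(\<Sum>A | x \<in> A \<and> A \<subseteq> X. fact (card A - 1) * \<chi> (card A) * (fact (card (X - A)) * \<tau> (card (X - A))))
    = fact (card X - 1) * (\<Sum>j=1..card X. \<chi> j * \<tau> (card X - j))"
proof -
  define Y where "Y = X - {x}"
  have Y: "finite Y" "x \<notin> Y" "X = insert x Y" using assms by (auto simp: Y_def)
  then have cX: "card X = Suc (card Y)" by simp
  define h where "h j = fact j * \<chi> (Suc j) * (fact (card Y - j) * \<tau> (card Y - j))" for j
  have "(\<Sum>A | x \<in> A \<and> A \<subseteq> X. fact (card A - 1) * \<chi> (card A) * (fact (card (X - A)) * \<tau> (card (X - A))))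
    = (\<Sum>B\<in>Pow Y. h (card B))"
  proof (rule sum.reindex_bij_witness[where i = "insert x" and j = "\<lambda>A. A - {x}"])
    fix A assume "A \<in> {A. x \<in> A \<and> A \<subseteq> X}"
    then have A: "x \<in> A" "A \<subseteq> X" "finite A" using assms finite_subset by auto
    define m where "m = card (A - {x})"
    have c: "card A = Suc m" unfolding m_def using card_Suc_Diff1[OF A(3,1)] by (rule sym)
    have "card (X - A) = card X - card A" using A by (simp add: card_Diff_subset)
    then have "card (X - A) = card Y - m" using cX c by linarith
    then show "h (card (A - {x})) = fact (card A - 1) * \<chi> (card A) * (fact (card (X - A)) * \<tau> (card (X - A)))"
      unfolding h_def c m_def[symmetric] by simp
  qed (use Y in auto)
  also have "\<dots> = (\<Sum>j\<le>card Y. of_nat (card Y choose j) * h j)"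
    by (rule sum_Pow_card[OF Y(1)])
  also have "\<dots> = (\<Sum>j\<le>card Y. fact (card Y) * (\<chi> (Suc j) * \<tau> (card Y - j)))"
  proof (rule sum.cong[OF refl])
    fix j assume "j \<in> {..card Y}"
    then have "(of_nat (fact j * fact (card Y - j) * (card Y choose j)) :: complex) = fact (card Y)"
      by (subst binomial_fact_lemma) auto
    moreover have "of_nat (card Y choose j) * h j =
        (of_nat (fact j * fact (card Y - j) * (card Y choose j)) :: complex) * (\<chi> (Suc j) * \<tau> (card Y - j))"
      unfolding h_def of_nat_mult of_nat_fact by (simp only: ac_simps)
    ultimately show "of_nat (card Y choose j) * h j = fact (card Y) * (\<chi> (Suc j) * \<tau> (card Y - j))"
      by simp
  qed
  also have "\<dots> = fact (card X - 1) * (\<Sum>j=1..card X. \<chi> j * \<tau> (card X - j))"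
    unfolding cX sum_distrib_left
    by (rule sum.reindex_bij_witness[where i = "\<lambda>j. j - 1" and j = Suc]) auto
  finally show ?thesis .
qed

text \<open>The logarithm in recursive form: the hypothesis on \<open>\<tau>\<close> says that
  \<open>\<chi>\<close> consists of the coefficients of \<open>x \<tau>'(x) / \<tau>(x)\<close>. In
  the recursion the term \<open>A = X\<close> isolates \<open>C X\<close>, because
  \<open>T {}\<close> is 1, and all other terms involve smaller sets. The bound \<open>N\<close> is
  present because for polynomials the two hypotheses are known only up to the degree.\<close>

lemma connected_from_total:
  fixes \<chi> \<tau> :: "nat \<Rightarrow> complex"
  assumes rec: "\<And>X x. finite X \<Longrightarrow> x \<in> X \<Longrightarrow> card X \<le> N \<Longrightarrow>
      T X = (\<Sum>A | x \<in> A \<and> A \<subseteq> X. C A * T (X - A))"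
    and T: "\<And>X. finite X \<Longrightarrow> card X \<le> N \<Longrightarrow> T X = fact (card X) * \<tau> (card X)"
    and \<tau>0: "\<tau> 0 = 1"
    and \<tau>: "\<And>k. 1 \<le> k \<Longrightarrow> k \<le> N \<Longrightarrow> of_nat k * \<tau> k = (\<Sum>j=1..k. \<chi> j * \<tau> (k - j))"
    and X: "finite X" "X \<noteq> {}" "card X \<le> N"
  shows "C X = fact (card X - 1) * \<chi> (card X)"
  using X
proof (induction "card X" arbitrary: X rule: less_induct)
  case less
  obtain x where x: "x \<in> X" using less.prems by blast
  let ?S = "{A. x \<in> A \<and> A \<subseteq> X}"
  let ?c = "\<lambda>A. fact (card A - 1) * \<chi> (card A)"
  have S: "finite ?S" "X \<in> ?S" using less.prems x by auto
  have TA: "T (X - A) = fact (card (X - A)) * \<tau> (card (X - A))" for A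
    using T less.prems by (metis card_mono Diff_subset finite_Diff le_trans)
  have k: "1 \<le> card X" using less.prems by (simp add: Suc_le_eq card_gt_0_iff)
  have "T X = fact (card X - 1) * (of_nat (card X) * \<tau> (card X))"
    using T[OF less.prems(1,3)] k by (simp add: fact_reduce)
  also have "\<dots> = (\<Sum>A\<in>?S. ?c A * T (X - A))"
    unfolding \<tau>[OF k less.prems(3)] TA sum_subsets_containing[OF less.prems(1) x] ..
  finally have "(\<Sum>A\<in>?S. C A * T (X - A)) = (\<Sum>A\<in>?S. ?c A * T (X - A))"
    using rec[OF less.prems(1) x less.prems(3)] by simp
  moreover have "(\<Sum>A\<in>?S - {X}. C A * T (X - A)) = (\<Sum>A\<in>?S - {X}. ?c A * T (X - A))"
  proof (rule sum.cong[OF refl])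
    fix A assume "A \<in> ?S - {X}"
    then have A: "A \<subset> X" "A \<noteq> {}" by auto
    then have "finite A" "card A < card X" using less.prems finite_subset psubset_card_mono by auto
    then show "C A * T (X - A) = ?c A * T (X - A)" using less.hyps[of A] A less.prems by simp
  qed
  ultimately have "C X * T (X - X) = ?c X * T (X - X)"
    unfolding sum.remove[OF S] by simp
  then show ?case using TA[of X] \<tau>0 by simp
qed

text \<open>The converse direction, the exponential: the remainder \<open>X - A\<close> is a proper
  subset of \<open>X\<close>, so the recursion determines the totals.\<close>

lemma total_from_connected:
  fixes \<chi> \<tau> :: "nat \<Rightarrow> complex"
  assumes rec: "\<And>X x. finite X \<Longrightarrow> x \<in> X \<Longrightarrow>
      T X = (\<Sum>A | x \<in> A \<and> A \<subseteq> X. C A * T (X - A))"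
    and C: "\<And>X. finite X \<Longrightarrow> X \<noteq> {} \<Longrightarrow> C X = fact (card X - 1) * \<chi> (card X)"
    and T0: "T {} = 1" and \<tau>0: "\<tau> 0 = 1"
    and \<tau>: "\<And>k. 1 \<le> k \<Longrightarrow> of_nat k * \<tau> k = (\<Sum>j=1..k. \<chi> j * \<tau> (k - j))"
    and X: "finite X"
  shows "T X = fact (card X) * \<tau> (card X)"
  using X
proof (induction "card X" arbitrary: X rule: less_induct)
  case less
  show ?case
  proof (cases "X = {}")
    case False
    then obtain x where x: "x \<in> X" by blast
    have k: "1 \<le> card X" using less.prems False by (simp add: Suc_le_eq card_gt_0_iff)
    have "T X = (\<Sum>A | x \<in> A \<and> A \<subseteq> X.
        fact (card A - 1) * \<chi> (card A) * (fact (card (X - A)) * \<tau> (card (X - A))))"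
      unfolding rec[OF less.prems x]
    proof (rule sum.cong[OF refl])
      fix A assume "A \<in> {A. x \<in> A \<and> A \<subseteq> X}"
      then have A: "A \<subseteq> X" "A \<noteq> {}" "finite A" "X - A \<subset> X" using less.prems finite_subset by auto
      then have "card (X - A) < card X" using less.prems psubset_card_mono by blast
      then show "C A * T (X - A) = fact (card A - 1) * \<chi> (card A) * (fact (card (X - A)) * \<tau> (card (X - A)))"
        using less.hyps[of "X - A"] C[OF A(3,2)] less.prems by simp
    qed
    also have "\<dots> = fact (card X - 1) * (of_nat (card X) * \<tau> (card X))"
      unfolding sum_subsets_containing[OF less.prems x] \<tau>[OF k] ..
    also have "\<dots> = fact (card X) * \<tau> (card X)" using k by (simp add: fact_reduce)
    finally show ?thesis .
  qed (simp add: T0 \<tau>0)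
qed

section \<open>Weighted sums over single permutations and over set partitions\<close>

definition perm_total :: "(nat \<Rightarrow> complex) \<Rightarrow> 'a set \<Rightarrow> complex" where
  "perm_total u X = (\<Sum>f | f permutes X. wt u X f)"

definition cyclic_perms :: "'a set \<Rightarrow> ('a \<Rightarrow> 'a) set" where
  "cyclic_perms X = {f. f permutes X \<and> transitive_on X {f}}"

text \<open>Weighting the cycles of the second permutation of a pair by \<open>delta1\<close> forces it to be the identity, so
  that sums over single permutations are an instance of sums over pairs.\<close>

definition delta1 :: "nat \<Rightarrow> complex" where
  "delta1 k = (if k = 1 then 1 else 0)"

lemma wt_delta1:
  assumes "finite X" "g permutes X"
  shows "wt delta1 X g = (if g = id then 1 else 0)"
proof (cases "g = id")
  case True
  have "delta1 (card V) = 1" if "V \<in> cyc X id" for V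
    using that by (auto simp: cyc_id delta1_def)
  then show ?thesis using True by (simp add: wt_def)
next
  case False
  then obtain x where x: "g x \<noteq> x" by (auto simp: fun_eq_iff)
  then have "x \<in> X" using assms permutes_not_in by metis
  have "{x, g x} \<subseteq> orbit g x" using orbit_self[OF assms] orbit.base by auto
  then have "card (orbit g x) \<noteq> 1" using x by (auto simp: card_1_singleton_iff)
  then have "\<exists>V\<in>cyc X g. delta1 (card V) = 0" using \<open>x \<in> X\<close> by (auto simp: cyc_def delta1_def)
  then show ?thesis using False assms by (simp add: wt_def prod_zero)
qed

lemma perm_total_pair:
  assumes "finite X"
  shows "pair_total u delta1 X = perm_total u X"
  unfolding pair_total_def perm_total_def
proof (rule sum.cong[OF refl])
  fix f :: "'a \<Rightarrow> 'a"
  have "(\<Sum>g | g permutes X. wt u X f * wt delta1 X g) = (\<Sum>g | g permutes X. if g = id then wt u X f else 0)"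
    by (rule sum.cong[OF refl]) (simp add: wt_delta1[OF assms])
  then show "(\<Sum>g | g permutes X. wt u X f * wt delta1 X g) = wt u X f"
    using finite_permutations[OF assms] by simp
qed

lemma cyc_transitive:
  assumes "finite X" "X \<noteq> {}" "f permutes X" "transitive_on X {f}"
  shows "cyc X f = {X}"
proof -
  have "orbit f x = X" if "x \<in> X" for x
    using orbit_subset_perm[OF assms(3) that] assms(4) that conn_orbit[OF assms(1,3)]
    by (auto simp: transitive_on_def)
  then show ?thesis using assms(2) by (auto simp: cyc_def)
qed

lemma conn_insert_id: "conn {f, id} = conn {f}"
  by (rule equalityI; rule conn_subset) (auto intro: conn_step)

text \<open>The identity contributes nothing to connectedness, so the first permutation must be one
  cycle through all of \<open>X\<close>.\<close>

lemma pair_conn_delta1: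
  assumes "finite X" "X \<noteq> {}"
  shows "pair_conn u delta1 X = of_nat (card (cyclic_perms X)) * u (card X)"
proof -
  have fin: "finite {f. f permutes X}" using assms finite_permutations by blast
  have "pair_conn u delta1 X = (\<Sum>f | f permutes X. \<Sum>g | g permutes X.
      if g = id then (if transitive_on X {f} then u (card X) else 0) else 0)"
    unfolding pair_conn_def
  proof (intro sum.cong refl)
    fix f g assume p: "f \<in> {f. f permutes X}" "g \<in> {g. g permutes X}"
    have "wt u X f = u (card X)" if "transitive_on X {f}"
      using cyc_transitive[OF assms _ that] p by (simp add: wt_def)
    moreover have "transitive_on X {f, id} = transitive_on X {f}"
      by (simp add: transitive_on_def conn_insert_id)
    ultimately show "(if transitive_on X {f, g} then wt u X f * wt delta1 X g else 0) =
      (if g = id then (if transitive_on X {f} then u (card X) else 0) else 0)"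
      using wt_delta1[OF assms(1)] p by auto
  qed
  also have "\<dots> = (\<Sum>f | f permutes X. if transitive_on X {f} then u (card X) else 0)"
    using fin by (intro sum.cong refl) (simp add: sum.delta')
  also have "\<dots> = (\<Sum>f\<in>cyclic_perms X. u (card X))"
    unfolding cyclic_perms_def using fin by (simp add: sum.If_cases Int_def)
  finally show ?thesis by simp
qed

lemma perm_total_rec:
  assumes "finite X" "x \<in> X"
  shows "perm_total u X = (\<Sum>A | x \<in> A \<and> A \<subseteq> X.
    (of_nat (card (cyclic_perms A)) * u (card A)) * perm_total u (X - A))"
  unfolding perm_total_pair[OF assms(1), symmetric] pair_total_rec[OF assms]
proof (rule sum.cong[OF refl])
  fix A assume "A \<in> {A. x \<in> A \<and> A \<subseteq> X}"
  then have "finite A" "A \<noteq> {}" "finite (X - A)" using assms finite_subset by auto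
  then show "pair_conn u delta1 A * pair_total u delta1 (X - A) =
    (of_nat (card (cyclic_perms A)) * u (card A)) * perm_total u (X - A)"
    by (simp add: pair_conn_delta1 perm_total_pair)
qed

text \<open>With all weights 1 the total is \<open>k!\<close>, that is \<open>\<tau> = 1\<close>;
  the recursion \<open>k = \<Sum>j=1..k. \<chi> j\<close> then holds with
  \<open>\<chi> = 1\<close>.\<close>

lemma card_cyclic_perms:
  assumes "finite X" "X \<noteq> {}"
  shows "card (cyclic_perms X) = fact (card X - 1)"
proof -
  have "(of_nat (card (cyclic_perms X)) * 1 :: complex) = fact (card X - 1) * 1"
  proof (rule connected_from_total[where T = "perm_total (\<lambda>_. 1)" and \<tau> = "\<lambda>_. 1" and N = "card X"
        and C = "\<lambda>X. of_nat (card (cyclic_perms X)) * 1" and \<chi> = "\<lambda>_. 1"])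
    show "perm_total (\<lambda>_. 1) Y = fact (card Y) * 1" if "finite Y" for Y :: "'a set"
      using that by (simp add: perm_total_def wt_def card_permutations)
    show "perm_total (\<lambda>_. 1) Y = (\<Sum>A | y \<in> A \<and> A \<subseteq> Y. (of_nat (card (cyclic_perms A)) * 1) * perm_total (\<lambda>_. 1) (Y - A))"
      if "finite Y" "y \<in> Y" for Y and y :: 'a
      by (rule perm_total_rec[OF that])
  qed (use assms in auto)
  then show ?thesis by (metis mult_1_right of_nat_eq_iff of_nat_fact)
qed

lemma perm_total_exp:
  assumes "finite X" "\<tau> 0 = 1" "\<And>k. 1 \<le> k \<Longrightarrow> of_nat k * \<tau> k = (\<Sum>j=1..k. u j * \<tau> (k - j))"
  shows "perm_total u X = fact (card X) * \<tau> (card X)"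
proof (rule total_from_connected[where T = "perm_total u" and \<tau> = \<tau> and \<chi> = u
      and C = "\<lambda>X. of_nat (card (cyclic_perms X)) * u (card X)"])
  show "perm_total u {} = 1" by (simp add: perm_total_def wt_def cyc_def)
qed (use assms in \<open>auto simp: card_cyclic_perms intro: perm_total_rec\<close>)

text \<open>The numbers \<open>pochhammer c k / k!\<close> are the coefficients of
  \<open>(1 - x)^(-c)\<close>, whose logarithmic derivative is \<open>c / (1 - x)\<close>.\<close>

lemma perm_total_const:
  assumes "finite X"
  shows "perm_total (\<lambda>_. c) X = pochhammer c (card X)"
proof -
  define \<tau> where "\<tau> k = pochhammer c k / fact k" for k
  have "of_nat k * \<tau> k = (\<Sum>i<k. c * \<tau> i)" for k
  proof (induction k)
    case (Suc k)
    have "of_nat (Suc k) * \<tau> (Suc k) = (c + of_nat k) * \<tau> k"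
      by (simp add: \<tau>_def pochhammer_Suc del: of_nat_Suc)
    then show ?case using Suc by (simp add: algebra_simps)
  qed (simp add: \<tau>_def)
  moreover have "(\<Sum>i<k. c * \<tau> i) = (\<Sum>j=1..k. c * \<tau> (k - j))" for k
    by (rule sum.reindex_bij_witness[where i = "\<lambda>j. k - j" and j = "\<lambda>j. k - j"]) auto
  ultimately have "perm_total (\<lambda>_. c) X = fact (card X) * \<tau> (card X)"
    by (intro perm_total_exp) (simp_all add: assms \<tau>_def)
  then show ?thesis by (simp add: \<tau>_def)
qed

text \<open>The alternating sum over partitions is the logarithm of the exponential generating function:
  marking a block \<open>B\<close> without \<open>x\<close> of a partition of \<open>X\<close> turns the recursion into a cancellation.\<close>

definition part_log :: "(nat \<Rightarrow> complex) \<Rightarrow> 'a set \<Rightarrow> complex" where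
  "part_log f X = (\<Sum>\<pi> | partition_on X \<pi>. (-1) ^ (card \<pi> + 1) * fact (card \<pi> - 1) * (\<Prod>V\<in>\<pi>. f (card V)))"

lemma part_log_rec:
  fixes f :: "nat \<Rightarrow> complex"
  assumes "finite X" "x \<in> X" "f 0 = 1"
  shows "f (card X) = (\<Sum>A | x \<in> A \<and> A \<subseteq> X. part_log f A * f (card (X - A)))"
proof -
  define s :: "nat \<Rightarrow> complex" where "s m = (-1) ^ (m + 1) * fact (m - 1)" for m
  define F where "F \<pi> = (\<Prod>V\<in>\<pi>. f (card V))" for \<pi> :: "'a set set"
  let ?S = "{A. x \<in> A \<and> A \<subseteq> X}"
  let ?P = "\<lambda>A. {\<pi>. partition_on A \<pi>}"
  have finP: "finite (?P A)" if "A \<subseteq> X" for A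
    using finitely_many_partition_on finite_subset[OF that assms(1)] by blast
  have finp: "finite \<pi>" if "partition_on A \<pi>" "A \<subseteq> X" for A \<pi>
    using finite_elements[OF finite_subset[OF that(2) assms(1)] that(1)] .
  have pl: "part_log f A = (\<Sum>\<pi>\<in>?P A. s (card \<pi>) * F \<pi>)" for A :: "'a set"
    by (simp add: part_log_def s_def F_def)
  have S: "finite ?S" "X \<in> ?S" using assms by auto
  have "(\<Sum>A\<in>?S - {X}. part_log f A * f (card (X - A)))
      = (\<Sum>(A, \<pi>)\<in>Sigma (?S - {X}) ?P. s (card \<pi>) * F \<pi> * f (card (X - A)))"
    unfolding pl sum_distrib_right
    by (rule sum.Sigma) (use S(1) finP in auto)
  \<comment> \<open>Adding the block \<open>X - A\<close> to a partition of the proper subset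
    \<open>A\<close> gives a partition of \<open>X\<close> with a marked block avoiding
    \<open>x\<close>. The sign and factorial still belong to the partition of \<open>A\<close>,
    which has one block fewer.\<close>
  also have "\<dots> = (\<Sum>(\<pi>, B)\<in>Sigma (?P X) (\<lambda>\<pi>. {B\<in>\<pi>. x \<notin> B}). s (card \<pi> - 1) * F \<pi>)"
  proof (rule sum.reindex_bij_witness[where j = "\<lambda>(A, \<pi>). (insert (X - A) \<pi>, X - A)"
        and i = "\<lambda>(\<pi>, B). (X - B, \<pi> - {B})"])
    fix a assume "a \<in> Sigma (?S - {X}) ?P"
    then obtain A \<pi> where a: "a = (A, \<pi>)" "x \<in> A" "A \<subseteq> X" "A \<noteq> X" "partition_on A \<pi>" by auto
    have dis: "X - A \<noteq> {}" "X - A \<notin> \<pi>"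
      using a partition_onD1[OF a(5)] by blast+
    show "(case case a of (A, \<pi>) \<Rightarrow> (insert (X - A) \<pi>, X - A) of (\<pi>, B) \<Rightarrow> (X - B, \<pi> - {B})) = a"
      using a dis by auto
    have "\<Union>\<pi> = A" using partition_onD1[OF a(5)] by simp
    then have "partition_on X (insert (X - A) \<pi>)"
      using a dis partition_on_insert[of "X - A" \<pi> X] by (auto simp: disjnt_def double_diff)
    then show "(case a of (A, \<pi>) \<Rightarrow> (insert (X - A) \<pi>, X - A)) \<in> Sigma (?P X) (\<lambda>\<pi>. {B\<in>\<pi>. x \<notin> B})"
      using a by auto
    have "finite \<pi>" using finp a by blast
    then show "(case case a of (A, \<pi>) \<Rightarrow> (insert (X - A) \<pi>, X - A) of (\<pi>, B) \<Rightarrow> s (card \<pi> - 1) * F \<pi>)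
        = (case a of (A, \<pi>) \<Rightarrow> s (card \<pi>) * F \<pi> * f (card (X - A)))"
      using a dis by (simp add: F_def)
  next
    fix b assume "b \<in> Sigma (?P X) (\<lambda>\<pi>. {B\<in>\<pi>. x \<notin> B})"
    then obtain \<pi> B where b: "b = (\<pi>, B)" "partition_on X \<pi>" "B \<in> \<pi>" "x \<notin> B" by auto
    have BX: "B \<subseteq> X" "B \<noteq> {}" using b partition_onD1[OF b(2)] partition_onD3[OF b(2)] by auto
    then show "(case case b of (\<pi>, B) \<Rightarrow> (X - B, \<pi> - {B}) of (A, \<pi>) \<Rightarrow> (insert (X - A) \<pi>, X - A)) = b"
      using b by (auto simp: double_diff)
    have "partition_on (X - B) (\<pi> - {B})"
    proof (rule partition_onI)
      show "\<Union> (\<pi> - {B}) = X - B"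
        using b(3) partition_onD1[OF b(2)] disjointD[OF partition_onD2[OF b(2)], of _ B] by blast
    qed (use disjointD[OF partition_onD2[OF b(2)]] partition_onD3[OF b(2)] in \<open>auto simp: disjnt_def\<close>)
    then show "(case b of (\<pi>, B) \<Rightarrow> (X - B, \<pi> - {B})) \<in> Sigma (?S - {X}) ?P"
      using b assms BX by auto
  qed
  also have "\<dots> = (\<Sum>\<pi>\<in>?P X. \<Sum>B | B \<in> \<pi> \<and> x \<notin> B. s (card \<pi> - 1) * F \<pi>)"
    by (rule sum.Sigma[symmetric]) (use finP[of X] finp[of X] in auto)
  finally have proper: "(\<Sum>A\<in>?S - {X}. part_log f A * f (card (X - A)))
    = (\<Sum>\<pi>\<in>?P X. \<Sum>B | B \<in> \<pi> \<and> x \<notin> B. s (card \<pi> - 1) * F \<pi>)" .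
  have count: "card {B. B \<in> \<pi> \<and> x \<notin> B} = card \<pi> - 1 \<and> card \<pi> \<ge> 1" if p: "partition_on X \<pi>" for \<pi>
  proof -
    obtain V where V: "V \<in> \<pi>" "x \<in> V" using assms(2) partition_onD1[OF p] by blast
    have "{B. B \<in> \<pi> \<and> x \<notin> B} = \<pi> - {V}"
      using V partition_onD2[OF p] by (auto dest: disjointD)
    then have "card {B. B \<in> \<pi> \<and> x \<notin> B} = card \<pi> - 1"
      using V(1) finp[OF p] by simp
    moreover have "card \<pi> \<noteq> 0" using V(1) finp[OF p] by auto
    ultimately show ?thesis by simp
  qed
  have "(\<Sum>A\<in>?S. part_log f A * f (card (X - A))) =
      (\<Sum>\<pi>\<in>?P X. s (card \<pi>) * F \<pi>) + (\<Sum>\<pi>\<in>?P X. \<Sum>B | B \<in> \<pi> \<and> x \<notin> B. s (card \<pi> - 1) * F \<pi>)"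
    unfolding sum.remove[OF S] proper[symmetric] using assms(3) by (simp add: pl)
  \<comment> \<open>Exactly one block contains \<open>x\<close>, so a partition with
    \<open>m\<close> blocks is marked in \<open>m - 1\<close> ways, and
    \<open>s m + (m - 1) s (m - 1) = 0\<close> for \<open>m \<ge> 2\<close>. Only the one-block
    partition remains.\<close>
  also have "\<dots> = (\<Sum>\<pi>\<in>?P X. if \<pi> = {X} then f (card X) else 0)"
    unfolding sum.distrib[symmetric]
  proof (rule sum.cong[OF refl])
    fix \<pi> assume "\<pi> \<in> ?P X"
    then have p: "partition_on X \<pi>" by simp
    obtain m where m: "card \<pi> = Suc m" "card {B. B \<in> \<pi> \<and> x \<notin> B} = m"
      using count[OF p] by (cases "card \<pi>") auto
    have pX: "\<pi> = {X} \<longleftrightarrow> m = 0"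
    proof
      assume "m = 0"
      then obtain V where "\<pi> = {V}" using m(1) by (auto simp: card_1_singleton_iff)
      then show "\<pi> = {X}" using partition_onD1[OF p] by simp
    qed (use m(1) in simp)
    then show "s (card \<pi>) * F \<pi> + (\<Sum>B | B \<in> \<pi> \<and> x \<notin> B. s (card \<pi> - 1) * F \<pi>) =
        (if \<pi> = {X} then f (card X) else 0)"
    proof (cases m)
      case 0
      then have "\<pi> = {X}" using pX by simp
      moreover from this have e: "{B. B \<in> \<pi> \<and> x \<notin> B} = {}" using assms(2) by auto
      ultimately show ?thesis unfolding e by (simp add: s_def F_def)
    next
      case (Suc l)
      then have "\<pi> \<noteq> {X}" using pX by simp
      then show ?thesis unfolding sum_constant m using Suc by (simp add: s_def algebra_simps)
    qed
  qed
  also have "\<dots> = f (card X)"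
    using assms finP[of X] partition_on_space[of X] by (subst sum.delta) auto
  finally show ?thesis by simp
qed

subsection \<open>Newton identities and finite free cumulants\<close>

lemma reflect_prod_linear:
  "reflect_poly (\<Prod>x\<in>#M. [:- x, 1:]) = (\<Prod>x\<in>#M. [:1, - x:])" for M :: "'a::idom multiset"
proof (induction M)
  case (add x M)
  have "reflect_poly [:- x, 1:] = [:1, - x:]"
    \<comment> \<open>For \<open>x = 0\<close> reflection lowers the degree, and both sides are the
      constant 1.\<close>
    by (cases "x = 0") (auto simp: reflect_poly_pCons pCons_eq_0_iff reflect_poly_pCons')
  then show ?case using add
    by (simp only: image_mset_add_mset prod_mset.add_mset reflect_poly_mult)
qed simp

text \<open>The logarithmic derivative of a product is a sum, and the factor \<open>1 - x X\<close>
  contributes minus the geometric series \<open>x / (1 - x X)\<close>.\<close>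

lemma newton_identity_fps:
  "fps_deriv (fps_of_poly (\<Prod>x\<in>#M. [:1, - x:])) =
    - (fps_of_poly (\<Prod>x\<in>#M. [:1, - x:]) * Abs_fps (\<lambda>n. \<Sum>x\<in>#M. x ^ Suc n))"
  for M :: "complex multiset"
proof (induction M)
  case empty
  have "Abs_fps (\<lambda>n. 0) = (0 :: complex fps)" by (simp add: fps_eq_iff)
  then show ?case by simp
next
  case (add x M)
  let ?E = "fps_of_poly (\<Prod>x\<in>#M. [:1, - x:])"
  let ?S = "Abs_fps (\<lambda>n. \<Sum>x\<in>#M. x ^ Suc n)"
  let ?G = "Abs_fps (\<lambda>n. x ^ Suc n)"
  have L: "fps_of_poly [:1, - x:] = 1 - fps_const x * fps_X"
    by (simp add: fps_of_poly_linear')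
  have G: "(1 - fps_const x * fps_X) * ?G = fps_const x"
  proof (rule fps_ext)
    fix n
    show "((1 - fps_const x * fps_X) * ?G) $ n = fps_const x $ n"
      unfolding left_diff_distrib mult.assoc by (cases n) simp_all
  qed
  have ring: "- (a * G) * E - a * (E * S) = - (a * E * (S + G))" for a G E S :: "complex fps"
    by (simp add: algebra_simps)
  have E: "fps_of_poly (\<Prod>x\<in>#add_mset x M. [:1, - x:]) = (1 - fps_const x * fps_X) * ?E"
    by (simp add: fps_of_poly_mult L)
  have S: "Abs_fps (\<lambda>n. \<Sum>x\<in>#add_mset x M. x ^ Suc n) = ?S + ?G"
    by (simp add: fps_eq_iff add.commute)
  have "fps_deriv ((1 - fps_const x * fps_X) * ?E) = - fps_const x * ?E + (1 - fps_const x * fps_X) * fps_deriv ?E"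
    by simp
  also have "\<dots> = - ((1 - fps_const x * fps_X) * ?G) * ?E - (1 - fps_const x * fps_X) * (?E * ?S)"
    unfolding G add.IH by simp
  also have "\<dots> = - ((1 - fps_const x * fps_X) * ?E * (?S + ?G))"
    by (rule ring)
  finally show ?case unfolding E S .
qed

text \<open>The coefficients of the reversed polynomial are the signed \<open>acoeff p i\<close>.
  The bound \<open>k \<le> degree p\<close> matters: beyond the degree the truncated subtraction in
  \<open>acoeff\<close> returns the constant coefficient up to sign instead of 0.\<close>

lemma newton_identity:
  fixes p :: "complex poly"
  assumes "lead_coeff p = 1" "k \<le> degree p"
  shows "of_nat k * acoeff p k =
    (\<Sum>j=1..k. (-1) ^ (j - 1) * (\<Sum>x\<in>#proots p. x ^ j) * acoeff p (k - j))"
proof (cases k)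
  case (Suc m)
  let ?E = "fps_of_poly (\<Prod>x\<in>#proots p. [:1, - x:])"
  define P where "P j = (\<Sum>x\<in>#proots p. x ^ j)" for j
  define b where "b i = ?E $ i" for i
  have sq: "(-1) ^ i * ((-1) ^ i * y) = y" for i and y :: complex
    by (simp flip: mult.assoc power_mult_distrib)
  have "reflect_poly p = (\<Prod>x\<in>#proots p. [:1, - x:])"
    using complex_poly_decompose_multiset[of p] assms(1) reflect_prod_linear[of "proots p"] by simp
  then have "b i = coeff (reflect_poly p) i" for i by (simp add: b_def)
  then have b: "b i = (-1) ^ i * acoeff p i" if "i \<le> degree p" for i
    using that by (simp add: coeff_reflect_poly acoeff_def sq)
  have "fps_deriv ?E $ m = - (\<Sum>i=0..m. b i * P (Suc (m - i)))"
    unfolding newton_identity_fps by (simp add: fps_mult_nth b_def P_def)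
  then have "of_nat k * b k = - (\<Sum>i=0..m. b i * P (Suc (m - i)))"
    by (simp add: Suc b_def)
  also have "(\<Sum>i=0..m. b i * P (Suc (m - i))) = (\<Sum>j=1..k. b (k - j) * P j)"
    by (rule sum.reindex_bij_witness[where i = "\<lambda>j. k - j" and j = "\<lambda>i. k - i"])
      (auto simp: Suc Suc_diff_le)
  finally have main: "of_nat k * b k = - (\<Sum>j=1..k. b (k - j) * P j)" .
  have "of_nat k * acoeff p k = (-1) ^ k * (of_nat k * b k)"
    using b[OF assms(2)] sq[of k "acoeff p k"] by (simp add: mult.left_commute)
  also have "\<dots> = (\<Sum>j=1..k. (-1) ^ (j - 1) * P j * acoeff p (k - j))"
    unfolding main sum_negf[symmetric] sum_distrib_left
  proof (rule sum.cong[OF refl])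
    fix j assume j: "j \<in> {1..k}"
    then obtain l where l: "j = Suc l" by (cases j) auto
    have "(-1) ^ k = ((-1) ^ j * (-1) ^ (k - j) :: complex)" using j by (simp flip: power_add)
    then have "(-1) ^ k * - (b (k - j) * P j) = - ((-1) ^ j) * P j * ((-1) ^ (k - j) * b (k - j))"
      by simp
    also have "(-1) ^ (k - j) * b (k - j) = acoeff p (k - j)"
      using b[of "k - j"] assms(2) by (simp add: sq)
    finally show "(-1) ^ k * - (b (k - j) * P j) = (-1) ^ (j - 1) * P j * acoeff p (k - j)"
      by (simp add: l)
  qed
  finally show ?thesis by (simp add: P_def)
qed simp

lemma pochhammer_minus_of_nat:
  "pochhammer (- of_nat d :: complex) k = (-1) ^ k * falling d k"
proof -
  have "pochhammer (- of_nat d) k = (\<Prod>i<k. (-1) * (of_nat d - of_nat i :: complex))"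
    unfolding pochhammer_prod by (simp add: atLeast0LessThan)
  then show ?thesis unfolding prod.distrib falling_def by simp
qed

lemma falling_nonzero: "k \<le> d \<Longrightarrow> falling d k \<noteq> 0"
  by (simp add: falling_def)

text \<open>The total over all pairs is \<open>k! d^k a_k\<close>, and Newton's identities identify
  its connected part with a signed power sum of the roots. That power sum is \<open>d\<close> times
  the moment, hence the exponent \<open>card X + 1\<close>.\<close>

lemma pair_conn_cumulant:
  fixes p :: "complex poly" and X :: "'a set"
  assumes p: "degree p = d" "lead_coeff p = 1" and X: "finite X" "X \<noteq> {}" "card X \<le> d"
  shows "pair_conn (\<lambda>k. - of_nat d * ff_cumulant p k) (\<lambda>_. - of_nat d) X =
    (-1) ^ (card X - 1) * fact (card X - 1) * of_nat d ^ (card X + 1) * root_moment p (card X)"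
proof -
  define D :: complex where "D = of_nat d"
  have D: "D \<noteq> 0" using X by (auto simp: D_def)
  \<comment> \<open>For \<open>k > d\<close> the denominator vanishes and \<open>\<tau> k = 0\<close>; \<open>log\<close> and \<open>u\<close> below hold for every such extension.\<close>
  define \<tau> where "\<tau> k = acoeff p k / falling d k" for k
  have \<tau>0: "\<tau> 0 = 1" using p by (simp add: \<tau>_def acoeff_def falling_def)
  \<comment> \<open>The coefficient of \<open>x^j\<close> in
    \<open>x \<tau>'(x) / \<tau>(x)\<close>; multiplication by \<open>x\<close> accounts for the
    shift by one.\<close>
  define \<chi> where "\<chi> j = (fps_deriv (Abs_fps \<tau>) * inverse (Abs_fps \<tau>)) $ (j - 1)" for j
  have rec: "of_nat k * \<tau> k = (\<Sum>j=1..k. \<chi> j * \<tau> (k - j))" if "1 \<le> k" for k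
  proof -
    have "fps_deriv (Abs_fps \<tau>) = (fps_deriv (Abs_fps \<tau>) * inverse (Abs_fps \<tau>)) * Abs_fps \<tau>"
      using \<tau>0 inverse_mult_eq_1[of "Abs_fps \<tau>"] by (simp add: mult.assoc)
    then have "fps_deriv (Abs_fps \<tau>) $ (k - 1) =
        (\<Sum>i=0..k - 1. (fps_deriv (Abs_fps \<tau>) * inverse (Abs_fps \<tau>)) $ i * \<tau> (k - 1 - i))"
      by (metis (no_types, lifting) fps_mult_nth sum.cong fps_nth_Abs_fps)
    also have "\<dots> = (\<Sum>j=1..k. \<chi> j * \<tau> (k - j))"
      by (rule sum.reindex_bij_witness[where i = "\<lambda>j. j - 1" and j = Suc])
        (use that in \<open>auto simp: \<chi>_def\<close>)
    finally show ?thesis using that by simp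
  qed
  have log: "part_log (\<lambda>k. fact k * \<tau> k) A = fact (card A - 1) * \<chi> (card A)"
    if "finite A" "A \<noteq> {}" for A :: "nat set"
  proof (rule connected_from_total[where T = "\<lambda>X. fact (card X) * \<tau> (card X)" and \<tau> = \<tau> and N = "card A"])
    show "fact (card X) * \<tau> (card X) =
      (\<Sum>A | x \<in> A \<and> A \<subseteq> X. part_log (\<lambda>k. fact k * \<tau> k) A * (fact (card (X - A)) * \<tau> (card (X - A))))"
      if "finite X" "x \<in> X" for X and x :: nat
      by (rule part_log_rec[OF that]) (simp add: \<tau>0)
  qed (use that \<tau>0 rec in auto)
  \<comment> \<open>The \<open>(k - 1)!\<close> in the prefactor of the cumulant cancels against the
    one from \<open>log\<close>. The minus sign arises because the definition uses
    \<open>(-1)^m\<close> where \<open>part_log\<close> uses \<open>(-1)^(m + 1)\<close>, with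
    \<open>m\<close> the number of blocks.\<close>
  have cumul: "- D * ff_cumulant p k = (- D) ^ k * \<chi> k" if "1 \<le> k" for k
  proof -
    have "(\<Sum>\<pi>\<in>set_partitions k. (-1) ^ card \<pi> * (fact_part \<pi> * acoeff_part p \<pi> * fact (card \<pi> - 1)) / falling_part d \<pi>)
      = - part_log (\<lambda>k. fact k * \<tau> k) {1..k}"
      unfolding part_log_def set_partitions_def sum_negf[symmetric]
      by (intro sum.cong refl)
        (simp add: fact_part_def acoeff_part_def falling_part_def \<tau>_def prod_dividef prod.distrib)
    also have "\<dots> = - (fact (k - 1) * \<chi> k)" using log[of "{1..k}"] that by simp
    finally show ?thesis using D p
      unfolding ff_cumulant_def Let_def by (simp add: D_def)
  qed
  have u: "perm_total (\<lambda>k. - D * ff_cumulant p k) Y = fact (card Y) * ((- D) ^ card Y * \<tau> (card Y))"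
    if "finite Y" for Y :: "'a set"
  proof (rule perm_total_exp[OF that, where \<tau> = "\<lambda>k. (- D) ^ k * \<tau> k"])
    fix k :: nat assume k: "1 \<le> k"
    have "of_nat k * ((- D) ^ k * \<tau> k) = (\<Sum>j=1..k. (- D) ^ k * (\<chi> j * \<tau> (k - j)))"
      unfolding sum_distrib_left[symmetric] rec[OF k, symmetric] by (simp only: ac_simps)
    also have "\<dots> = (\<Sum>j=1..k. - D * ff_cumulant p j * ((- D) ^ (k - j) * \<tau> (k - j)))"
    proof (rule sum.cong[OF refl])
      fix j assume j: "j \<in> {1..k}"
      then have "(- D) ^ k = (- D) ^ j * (- D) ^ (k - j)" by (simp flip: power_add)
      then show "(- D) ^ k * (\<chi> j * \<tau> (k - j)) = - D * ff_cumulant p j * ((- D) ^ (k - j) * \<tau> (k - j))"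
        using cumul[of j] j by (simp add: algebra_simps)
    qed
    finally show "of_nat k * ((- D) ^ k * \<tau> k) =
      (\<Sum>j=1..k. - D * ff_cumulant p j * ((- D) ^ (k - j) * \<tau> (k - j)))" .
  qed (simp add: \<tau>0)
  let ?u = "\<lambda>k. - D * ff_cumulant p k"
  \<comment> \<open>The falling factorial divides the first total and multiplies the second. It may
    be cancelled because it is nonzero for \<open>card Y \<le> d\<close>.\<close>
  have tot: "pair_total ?u (\<lambda>_. - D) Y = fact (card Y) * (D ^ card Y * acoeff p (card Y))"
    if "finite Y" "card Y \<le> d" for Y :: "'a set"
  proof -
    have "pair_total ?u (\<lambda>_. - D) Y = perm_total ?u Y * perm_total (\<lambda>_. - D) Y"
      by (simp add: pair_total_def perm_total_def sum_product)
    also have "\<dots> = fact (card Y) * ((- D) ^ card Y * \<tau> (card Y)) * ((-1) ^ card Y * falling d (card Y))"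
      using u[OF that(1)] perm_total_const[OF that(1), of "- D"] pochhammer_minus_of_nat[of d]
      by (simp add: D_def)
    also have "\<dots> = fact (card Y) * (((- D) ^ card Y * (-1) ^ card Y) * acoeff p (card Y))"
      using falling_nonzero[OF that(2)] by (simp add: \<tau>_def)
    also have "(- D) ^ card Y * (-1) ^ card Y = D ^ card Y"
      by (simp flip: power_mult_distrib)
    finally show ?thesis .
  qed
  have "pair_conn ?u (\<lambda>_. - D) X = fact (card X - 1) *
      ((-1) ^ (card X - 1) * D ^ card X * (\<Sum>x\<in>#proots p. x ^ card X))"
  proof (rule connected_from_total[where T = "pair_total ?u (\<lambda>_. - D)" and N = d
        and \<tau> = "\<lambda>k. D ^ k * acoeff p k"
        and \<chi> = "\<lambda>k. (-1) ^ (k - 1) * D ^ k * (\<Sum>x\<in>#proots p. x ^ k)"])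
    fix k :: nat assume k: "1 \<le> k" "k \<le> d"
    have "of_nat k * (D ^ k * acoeff p k) =
        D ^ k * (\<Sum>j=1..k. (-1) ^ (j - 1) * (\<Sum>x\<in>#proots p. x ^ j) * acoeff p (k - j))"
      using newton_identity[OF p(2), of k] k p by (simp add: algebra_simps)
    also have "\<dots> = (\<Sum>j=1..k. (-1) ^ (j - 1) * D ^ j * (\<Sum>x\<in>#proots p. x ^ j) * (D ^ (k - j) * acoeff p (k - j)))"
      unfolding sum_distrib_left
    proof (rule sum.cong[OF refl])
      fix j assume "j \<in> {1..k}"
      then have "D ^ k = D ^ j * D ^ (k - j)" by (simp flip: power_add)
      then show "D ^ k * ((-1) ^ (j - 1) * (\<Sum>x\<in>#proots p. x ^ j) * acoeff p (k - j)) =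
        (-1) ^ (j - 1) * D ^ j * (\<Sum>x\<in>#proots p. x ^ j) * (D ^ (k - j) * acoeff p (k - j))"
        by (simp only: ac_simps)
    qed
    finally show "of_nat k * (D ^ k * acoeff p k) =
      (\<Sum>j=1..k. (-1) ^ (j - 1) * D ^ j * (\<Sum>x\<in>#proots p. x ^ j) * (D ^ (k - j) * acoeff p (k - j)))" .
  next
    show "pair_total ?u (\<lambda>_. - D) Y =
        (\<Sum>A | y \<in> A \<and> A \<subseteq> Y. pair_conn ?u (\<lambda>_. - D) A * pair_total ?u (\<lambda>_. - D) (Y - A))"
      if "finite Y" "y \<in> Y" for Y and y :: 'a
      by (rule pair_total_rec[OF that])
  qed (use X p tot in \<open>auto simp: acoeff_def\<close>)
  then show ?thesis using p D by (simp add: D_def root_moment_def)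
qed

subsection \<open>Geodesic permutations and non-crossing partitions\<close>

definition long_cycle :: "nat \<Rightarrow> nat \<Rightarrow> nat" where
  "long_cycle n x = (if 1 \<le> x \<and> x < n then x + 1 else if x = n \<and> 1 \<le> n then 1 else x)"

lemma long_cycle_permutes: "long_cycle n permutes {1..n}"
proof (rule bij_imp_permutes)
  have "inj_on (long_cycle n) {1..n}" by (auto simp: inj_on_def long_cycle_def split: if_splits)
  moreover have "long_cycle n ` {1..n} \<subseteq> {1..n}" by (auto simp: long_cycle_def)
  ultimately show "bij_betw (long_cycle n) {1..n} {1..n}"
    by (simp add: bij_betw_def endo_inj_surj)
qed (auto simp: long_cycle_def)

lemma long_cycle_conn:
  assumes "1 \<le> x" "x \<le> n"
  shows "(1, x) \<in> conn {long_cycle n}"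
  using assms
proof (induction x rule: dec_induct)
  case (step m)
  then have "long_cycle n m = Suc m" by (simp add: long_cycle_def)
  then have "(m, Suc m) \<in> conn {long_cycle n}" using conn_step[of "long_cycle n" "{long_cycle n}" m] by simp
  then show ?case using step conn_trans by auto
qed simp

lemma transitive_long_cycle: "transitive_on {1..n} {long_cycle n}"
  unfolding transitive_on_def
proof (intro ballI)
  fix x y assume "x \<in> {1..n}" "y \<in> {1..n}"
  then have "(1, x) \<in> conn {long_cycle n}" "(1, y) \<in> conn {long_cycle n}"
    using long_cycle_conn by auto
  then show "(x, y) \<in> conn {long_cycle n}"
    using conn_sym[of "{1..n}" "{long_cycle n}" 1 x] long_cycle_permutes conn_trans by fastforce
qed

lemma cyc_conj:
  assumes "finite X" "\<tau> permutes X" "\<alpha> permutes X"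
  shows "cyc X (\<tau> \<circ> \<alpha> \<circ> inv' \<tau>) = (\<lambda>V. \<tau> ` V) ` cyc X \<alpha>"
proof -
  have o: "orbit (\<tau> \<circ> \<alpha> \<circ> inv' \<tau>) (\<tau> x) = \<tau> ` orbit \<alpha> x" for x
    by (rule orbit_inverse[symmetric])
      (simp_all add: orbit_self[OF assms(1,3)] permutes_inverses[OF assms(2)])
  have "cyc X (\<tau> \<circ> \<alpha> \<circ> inv' \<tau>) = orbit (\<tau> \<circ> \<alpha> \<circ> inv' \<tau>) ` \<tau> ` X"
    by (simp add: cyc_def permutes_image[OF assms(2)])
  then show ?thesis by (simp add: cyc_def o image_image)
qed

lemma card_cyc_conj:
  assumes "finite X" "\<tau> permutes X" "\<alpha> permutes X"
  shows "card (cyc X (\<tau> \<circ> \<alpha> \<circ> inv' \<tau>)) = card (cyc X \<alpha>)"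
  unfolding cyc_conj[OF assms]
  by (rule card_image) (use inj_image_eq_iff[OF permutes_inj[OF assms(2)]] in \<open>auto simp: inj_on_def\<close>)

text \<open>With length \<open>n\<close> minus the number of cycles, the equation says that the
  lengths of \<open>\<alpha>\<close> and \<open>inv' \<alpha> \<circ> long_cycle n\<close> add up to
  \<open>n - 1\<close>, the length of the long cycle. Such \<open>\<alpha>\<close> lie on geodesics
  from the identity in the Cayley graph of transpositions.\<close>

definition geodesic :: "nat \<Rightarrow> (nat \<Rightarrow> nat) \<Rightarrow> bool" where
  "geodesic n \<alpha> \<longleftrightarrow> \<alpha> permutes {1..n} \<and>
     card (cyc {1..n} \<alpha>) + card (cyc {1..n} (inv' \<alpha> \<circ> long_cycle n)) = n + 1"

text \<open>The triangle inequality for the product of \<open>\<gamma> \<circ> \<alpha>\<inverse>\<close> and \<open>\<alpha> \<circ> \<rho>\<close>, where \<open>\<gamma>\<close> is the long cycle.\<close>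

lemma geodesic_mult:
  assumes "geodesic n \<alpha>" "\<rho> permutes {1..n}"
  shows "card (cyc {1..n} (\<alpha> \<circ> \<rho>)) + 1 \<le> card (cyc {1..n} \<alpha>) + card (cyc {1..n} (long_cycle n \<circ> \<rho>))"
proof -
  let ?X = "{1..n}" and ?g = "long_cycle n"
  have a: "\<alpha> permutes ?X" and e: "card (cyc ?X \<alpha>) + card (cyc ?X (inv' \<alpha> \<circ> ?g)) = n + 1"
    using assms(1) by (auto simp: geodesic_def)
  note g = long_cycle_permutes[of n]
  let ?d = "?g \<circ> inv' \<alpha>"
  have d: "?d permutes ?X" using permutes_inv[OF a] g by (rule permutes_compose)
  have ig: "inv' \<alpha> \<circ> ?g permutes ?X" using g permutes_inv[OF a] by (rule permutes_compose)
  have "\<alpha> \<circ> (inv' \<alpha> \<circ> ?g) \<circ> inv' \<alpha> = ?d"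
    using permutes_inv_o[OF a] by (simp flip: comp_assoc)
  then have "card (cyc ?X ?d) = card (cyc ?X (inv' \<alpha> \<circ> ?g))"
    using card_cyc_conj[OF _ a ig] by simp
  moreover have "card (cyc ?X ?d) + card (cyc ?X (\<alpha> \<circ> \<rho>)) \<le> card ?X + card (cyc ?X (?d \<circ> (\<alpha> \<circ> \<rho>)))"
    by (rule card_cyc_triangle) (use d permutes_compose[OF assms(2) a] in auto)
  moreover have "?d \<circ> (\<alpha> \<circ> \<rho>) = ?g \<circ> \<rho>"
    using permutes_inv_o[OF a] by (simp add: comp_assoc) (simp flip: comp_assoc)
  ultimately show ?thesis using e by simp
qed

text \<open>Cutting the long cycle at \<open>i\<close> and \<open>k\<close> closes up the arc
  \<open>i + 1..k\<close>: the transposition sends \<open>k\<close> to \<open>i\<close>, which the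
  long cycle sends to \<open>i + 1\<close>.\<close>

lemma long_cycle_split_invariant:
  assumes "1 \<le> i" "i < k" "k \<le> n" "x \<in> {i<..k}"
  shows "(long_cycle n \<circ> Transposition.transpose i k) x \<in> {i<..k}"
  using assms by (auto simp: long_cycle_def transpose_def)

lemma long_cycle_split_conn:
  assumes "1 \<le> i" "i < k" "k \<le> n" "(x, y) \<in> conn {long_cycle n \<circ> Transposition.transpose i k}"
  shows "x \<in> {i<..k} \<longleftrightarrow> y \<in> {i<..k}"
proof -
  have p: "permset {1..n} {long_cycle n \<circ> Transposition.transpose i k}"
    using permutes_compose[OF permutes_swap_id[of i "{1..n}" k] long_cycle_permutes] assms by simp
  have *: "y \<in> {i<..k}" if "x \<in> {i<..k}" "(x, y) \<in> conn {long_cycle n \<circ> Transposition.transpose i k}" for x y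
    using conn_closed[OF that(2,1)] long_cycle_split_invariant[OF assms(1-3)] by auto
  show ?thesis using *[of x y] *[of y x] assms(4) conn_sym[OF p assms(4)] by blast
qed

text \<open>Otherwise the second transposition would merge the two arcs of the long cycle again, although it
  splits \<open>\<alpha>\<close> further.\<close>

lemma geodesic_double_split:
  assumes g: "geodesic n \<alpha>" and i: "i \<in> {1..n}" "k \<in> {1..n}" "i \<noteq> k" and j: "j \<in> {1..n}" "l \<in> {1..n}" "j \<noteq> l"
    and c: "(i, k) \<in> conn {\<alpha>}" "(j, l) \<in> conn {\<alpha> \<circ> Transposition.transpose i k}"
  shows "(j, l) \<in> conn {long_cycle n \<circ> Transposition.transpose i k}"
proof (rule ccontr)
  let ?X = "{1..n}" and ?g = "long_cycle n"
  let ?s = "Transposition.transpose i k" and ?t = "Transposition.transpose j l"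
  assume n: "(j, l) \<notin> conn {?g \<circ> ?s}"
  have a: "\<alpha> permutes ?X" using g by (simp add: geodesic_def)
  have s: "?s permutes ?X" and t: "?t permutes ?X" using i j by (auto intro: permutes_swap_id)
  have as: "\<alpha> \<circ> ?s permutes ?X" and gs: "?g \<circ> ?s permutes ?X"
    using permutes_compose[OF s a] permutes_compose[OF s long_cycle_permutes] by auto
  have "card (cyc ?X (\<alpha> \<circ> ?s \<circ> ?t)) = card (cyc ?X \<alpha>) + 2"
    using card_cyc_comp_transpose(1)[OF _ a i c(1)] card_cyc_comp_transpose(1)[OF _ as j c(2)] by simp
  moreover have "card (cyc ?X (?g \<circ> ?s \<circ> ?t)) = card (cyc ?X ?g)"
  proof -
    have "(i, k) \<in> conn {?g}" using transitive_long_cycle[of n] i by (auto simp: transitive_on_def)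
    then show ?thesis
      using card_cyc_comp_transpose(1)[OF _ long_cycle_permutes i] card_cyc_comp_transpose(2)[OF _ gs j n]
      by simp
  qed
  moreover have "card (cyc ?X ?g) = 1"
    using card_comps_transitive[of ?X "{?g}"] transitive_long_cycle[of n] i long_cycle_permutes[of n]
      cyc_comps[of ?X ?g] by auto
  moreover have "card (cyc ?X (\<alpha> \<circ> (?s \<circ> ?t))) + 1 \<le> card (cyc ?X \<alpha>) + card (cyc ?X (?g \<circ> (?s \<circ> ?t)))"
    by (rule geodesic_mult[OF g permutes_compose[OF t s]])
  ultimately show False by (simp add: comp_assoc)
qed

text \<open>If \<open>i\<close> and \<open>j\<close> were in different cycles, transposing
  \<open>i\<close> and \<open>k\<close> would leave the cycle of \<open>j\<close> and
  \<open>l\<close> intact. These two would then lie in one arc of the cut long cycle, but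
  \<open>j\<close> is inside \<open>i + 1..k\<close> and \<open>l\<close> is outside.\<close>

lemma geodesic_noncrossing:
  assumes g: "geodesic n \<alpha>" and o: "1 \<le> i" "i < j" "j < k" "k < l" "l \<le> n"
    and c: "(i, k) \<in> conn {\<alpha>}" "(j, l) \<in> conn {\<alpha>}"
  shows "(i, j) \<in> conn {\<alpha>}"
proof (rule ccontr)
  assume n: "(i, j) \<notin> conn {\<alpha>}"
  let ?s = "Transposition.transpose i k"
  have a: "\<alpha> permutes {1..n}" using g by (simp add: geodesic_def)
  have p: "permset {1..n} {\<alpha>}" using a by simp
  have avoid: "y \<noteq> i \<and> y \<noteq> k" if "(j, y) \<in> conn {\<alpha>}" for y
    using that n c(1) conn_sym[OF p] conn_trans by metis
  have "(j, y) \<in> conn {\<alpha>} \<Longrightarrow> (j, y) \<in> conn {\<alpha> \<circ> ?s}" for y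
  proof (induction rule: conn_induct)
    case (step y f)
    then have "f y = (\<alpha> \<circ> ?s) y" using avoid[of y] by (simp add: transpose_def)
    then have "(y, f y) \<in> conn {\<alpha> \<circ> ?s}" using conn_step[of "\<alpha> \<circ> ?s" "{\<alpha> \<circ> ?s}" y] by simp
    then show ?case using step conn_trans by metis
  qed simp
  then have "(j, l) \<in> conn {\<alpha> \<circ> ?s}" using c(2) by blast
  then have "(j, l) \<in> conn {long_cycle n \<circ> ?s}"
    using geodesic_double_split[OF g _ _ _ _ _ _ c(1)] o by auto
  then have "j \<in> {i<..k} \<longleftrightarrow> l \<in> {i<..k}" using long_cycle_split_conn[of i k n j l] o by simp
  then show False using o by simp
qed

text \<open>Going upwards from \<open>x\<close> around the circle, \<open>z\<close> is met strictly
  before \<open>y\<close>; the three points are distinct.\<close>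

definition cyclic_between :: "nat \<Rightarrow> nat \<Rightarrow> nat \<Rightarrow> bool" where
  "cyclic_between x z y \<longleftrightarrow> x < z \<and> z < y \<or> y < x \<and> x < z \<or> z < y \<and> y < x"

text \<open>The transposition of \<open>x\<close> and \<open>z\<close> leaves \<open>z\<close> and \<open>\<alpha> x\<close> in a common cycle, so they belong to the same arc of
  the long cycle cut at \<open>x\<close> and \<open>z\<close>.\<close>

lemma geodesic_next:
  assumes g: "geodesic n \<alpha>" and x: "x \<in> {1..n}" and z: "(x, z) \<in> conn {\<alpha>}"
  shows "\<not> cyclic_between x z (\<alpha> x)"
proof
  let ?y = "\<alpha> x" and ?s = "Transposition.transpose x z"
  assume b: "cyclic_between x z ?y"
  have a: "\<alpha> permutes {1..n}" using g by (simp add: geodesic_def)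
  have p: "permset {1..n} {\<alpha>}" using a by simp
  have X: "z \<in> {1..n}" "?y \<in> {1..n}" using conn_in[OF p z] x permutes_in_image[OF a] by auto
  have ne: "x \<noteq> z" "?y \<noteq> z" using b by (auto simp: cyclic_between_def)
  have "(\<alpha> \<circ> ?s) z = ?y" by simp
  then have zy: "(z, ?y) \<in> conn {\<alpha> \<circ> ?s}" using conn_step[of "\<alpha> \<circ> ?s" "{\<alpha> \<circ> ?s}" z] by simp
  have "(z, ?y) \<in> conn {long_cycle n \<circ> ?s}"
    using geodesic_double_split[OF g x X(1) ne(1) X(1) X(2) _ z zy] ne by simp
  \<comment> \<open>For \<open>x < z\<close> the arc \<open>x + 1..z\<close> contains
    \<open>z\<close> but not \<open>\<alpha> x\<close>; for \<open>z < x\<close> the arc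
    \<open>z + 1..x\<close> contains \<open>\<alpha> x\<close> but not \<open>z\<close>.\<close>
  then show False
    using b long_cycle_split_conn[of x z n z ?y] long_cycle_split_conn[of z x n z ?y] X x ne
    by (cases "x < z") (auto simp: cyclic_between_def transpose_commute)
qed

lemma cycle_eq_conn:
  assumes "finite X" "\<alpha> permutes X" "\<beta> permutes X" "cyc X \<alpha> = cyc X \<beta>" "x \<in> X"
  shows "orbit \<alpha> x = orbit \<beta> x"
proof -
  have "orbit \<alpha> x \<in> cyc X \<beta>" using assms(4,5) by (auto simp: cyc_def)
  then obtain y where y: "orbit \<alpha> x = orbit \<beta> y" by (auto simp: cyc_def)
  then have "x \<in> orbit \<beta> y" using orbit_self[OF assms(1,2), of x] by simp
  then show ?thesis unfolding y
    using conn_eq_class[of X "{\<beta>}" y x] conn_orbit[OF assms(1,3)] assms(1,3)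
    by (auto simp: set_eq_iff)
qed

text \<open>By \<open>geodesic_next\<close>, \<open>\<alpha> x\<close> is the cyclic successor of
  \<open>x\<close> within its cycle, and this depends only on the cycle as a set.\<close>

lemma geodesic_determined:
  assumes "geodesic n \<alpha>" "geodesic n \<beta>" "cyc {1..n} \<alpha> = cyc {1..n} \<beta>"
  shows "\<alpha> = \<beta>"
proof
  fix x
  have a: "\<alpha> permutes {1..n}" and b: "\<beta> permutes {1..n}" using assms by (auto simp: geodesic_def)
  show "\<alpha> x = \<beta> x"
  proof (cases "x \<in> {1..n}")
    case True
    have o: "orbit \<alpha> x = orbit \<beta> x"
      using cycle_eq_conn[OF _ a b assms(3) True] by simp
    have ca: "(x, y) \<in> conn {\<alpha>} \<longleftrightarrow> y \<in> orbit \<alpha> x" and cb: "(x, y) \<in> conn {\<beta>} \<longleftrightarrow> y \<in> orbit \<beta> x" for y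
      using conn_orbit[OF _ a] conn_orbit[OF _ b] by auto
    have ay: "\<alpha> x \<in> orbit \<alpha> x" "\<beta> x \<in> orbit \<beta> x" by (rule orbit.base)+
    have fixa: "\<alpha> x = x \<longleftrightarrow> \<beta> x = x"
      using o orbit_eq_singleton_iff[of \<alpha> x] orbit_eq_singleton_iff[of \<beta> x] by simp
    have "\<not> cyclic_between x (\<beta> x) (\<alpha> x)" "\<not> cyclic_between x (\<alpha> x) (\<beta> x)"
      using geodesic_next[OF assms(1) True, of "\<beta> x"] geodesic_next[OF assms(2) True, of "\<alpha> x"] ca cb o ay
      by auto
    then show ?thesis using fixa by (auto simp: cyclic_between_def)
  next
    case False
    then show ?thesis using permutes_not_in[OF a] permutes_not_in[OF b] by simp
  qed
qed

lemma cyc_partition: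
  assumes "finite X" "\<alpha> permutes X"
  shows "partition_on X (cyc X \<alpha>)"
proof (rule partition_onI)
  note o = conn_orbit[OF assms]
  show "\<Union> (cyc X \<alpha>) = X"
  proof
    show "\<Union> (cyc X \<alpha>) \<subseteq> X"
      using o conn_in[of X "{\<alpha>}"] assms by (auto simp: cyc_def)
    show "X \<subseteq> \<Union> (cyc X \<alpha>)" using orbit_self[OF assms] by (auto simp: cyc_def)
  qed
  show "{} \<notin> cyc X \<alpha>" unfolding cyc_def by (metis imageE orbit_nonempty)
  fix p q assume pq: "p \<in> cyc X \<alpha>" "q \<in> cyc X \<alpha>" "p \<noteq> q"
  have ps: "permset X {\<alpha>}" using assms by simp
  obtain a b where ab: "p = conn {\<alpha>} `` {a}" "q = conn {\<alpha>} `` {b}"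
    using pq unfolding cyc_comps[OF assms] comps_def by auto
  show "disjnt p q"
  proof (rule ccontr)
    assume "\<not> disjnt p q"
    then obtain y where "(a, y) \<in> conn {\<alpha>}" "(b, y) \<in> conn {\<alpha>}"
      using ab by (auto simp: disjnt_def)
    then have "(a, b) \<in> conn {\<alpha>}" using conn_sym[OF ps] conn_trans by metis
    then show False using pq(3) ab conn_eq_class[OF ps, of a b] by simp
  qed
qed

lemma cyc_blockD:
  assumes "finite X" "\<alpha> permutes X" "B \<in> cyc X \<alpha>" "x \<in> B"
  shows "orbit \<alpha> x = B" "\<alpha> x \<in> B"
proof -
  obtain y where y: "B = orbit \<alpha> y" using assms(3) by (auto simp: cyc_def)
  then have "(y, x) \<in> conn {\<alpha>}" using assms(4) conn_orbit[OF assms(1,2)] by simp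
  then have "conn {\<alpha>} `` {y} = conn {\<alpha>} `` {x}"
    using conn_eq_class[of X "{\<alpha>}" y x] assms(1,2) by simp
  then show "orbit \<alpha> x = B" unfolding y using conn_orbit[OF assms(1,2)] by (auto simp: set_eq_iff)
  then show "\<alpha> x \<in> B" using orbit.base[of \<alpha> x] by simp
qed

lemma geodesic_NC:
  assumes "geodesic n \<alpha>"
  shows "cyc {1..n} \<alpha> \<in> NC n"
proof -
  have a: "\<alpha> permutes {1..n}" using assms by (simp add: geodesic_def)
  have p: "permset {1..n} {\<alpha>}" using a by simp
  have part: "partition_on {1..n} (cyc {1..n} \<alpha>)" using cyc_partition[OF _ a] by simp
  have "V = W" if VW: "V \<in> cyc {1..n} \<alpha>" "W \<in> cyc {1..n} \<alpha>"
    and o: "i < j" "j < k" "k < l" "i \<in> V" "k \<in> V" "j \<in> W" "l \<in> W" for V W i j k l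
  proof -
    note orb = conn_orbit[OF finite_atLeastAtMost a]
    have cc: "(x, y) \<in> conn {\<alpha>}" if "V \<in> cyc {1..n} \<alpha>" "x \<in> V" "y \<in> V" for V x y
      using cyc_blockD(1)[OF _ a that(1,2)] that(3) orb by simp
    have "1 \<le> i" "l \<le> n" using partition_onD1[OF part] VW o by auto
    then have ij: "(i, j) \<in> conn {\<alpha>}"
      using geodesic_noncrossing[OF assms _ o(1-3)] cc[OF VW(1) o(4,5)] cc[OF VW(2) o(6,7)] by simp
    then have "j \<in> V" using cyc_blockD(1)[OF _ a VW(1) o(4)] orb by simp
    then show ?thesis using partition_onD2[OF part] VW o(6) by (auto dest: disjointD)
  qed
  then show ?thesis
    unfolding NC_def noncrossing_def set_partitions_def using part by blast
qed


section \<open>Realising every non-crossing partition by a geodesic permutation\<close>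

lemma cyc_inv:
  assumes "finite X" "\<alpha> permutes X"
  shows "cyc X (inv' \<alpha>) = cyc X \<alpha>"
  unfolding cyc_def using orbit_inv_eq[OF permutes_imp_permutation[OF assms]] by simp

text \<open>Inclusion of blocks defines a map from \<open>P\<close> onto \<open>Q\<close>. Equal
  cardinalities make it injective, so each block of \<open>Q\<close> is filled by a single block of
  \<open>P\<close>.\<close>

lemma refining_partition_eq:
  assumes fin: "finite P" "finite Q" and P: "partition_on X P" and Q: "partition_on X Q"
    and ref: "\<And>p. p \<in> P \<Longrightarrow> \<exists>q\<in>Q. p \<subseteq> q" and c: "card P = card Q"
  shows "P = Q"
proof -
  obtain f where f: "\<And>p. p \<in> P \<Longrightarrow> f p \<in> Q \<and> p \<subseteq> f p" using ref by metis
  have un: "\<Union>P = X" "\<Union>Q = X" using partition_onD1[OF P] partition_onD1[OF Q] by auto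
  have same: "q = q'" if "q \<in> Q" "q' \<in> Q" "x \<in> q" "x \<in> q'" for q q' x
    using disjointD[OF partition_onD2[OF Q] that(1,2)] that(3,4) by blast
  have surj: "f ` P = Q"
  proof
    show "Q \<subseteq> f ` P"
    proof
      fix q assume q: "q \<in> Q"
      then obtain x where x: "x \<in> q" using partition_onD3[OF Q] by (metis all_not_in_conv)
      then obtain p where "p \<in> P" "x \<in> p" using un q by blast
      then show "q \<in> f ` P" using f same[OF q _ x] by blast
    qed
  qed (use f in auto)
  then have inj: "inj_on f P" using c fin by (simp add: eq_card_imp_inj_on)
  have "f p = p" if p: "p \<in> P" for p
  proof
    show "f p \<subseteq> p"
    proof
      fix x assume x: "x \<in> f p"
      then obtain p' where p': "p' \<in> P" "x \<in> p'" using un f[OF p] by blast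
      then have "f p' = f p" using f same[of "f p'" "f p" x] p x by blast
      then show "x \<in> p" using inj p p' by (auto dest: inj_onD)
    qed
  qed (use f[OF p] in simp)
  then show ?thesis using surj by force
qed

text \<open>As \<open>w\<close> and \<open>v\<close> are neighbours, no other block can separate \<open>W\<close> from \<open>V\<close>.\<close>

lemma noncrossing_merge:
  assumes nc: "noncrossing \<pi>" and d: "disjoint \<pi>"
    and V: "V \<in> \<pi>" "v \<in> V" "\<And>x. x \<in> V \<Longrightarrow> v \<le> x"
    and W: "W \<in> \<pi>" "w \<in> W" "v = Suc w"
  shows "noncrossing (insert (V \<union> W) (\<pi> - {V, W}))"
proof -
  have ncD: "A = B" if "A \<in> \<pi>" "B \<in> \<pi>" "i < j" "j < k" "k < l" "i \<in> A" "k \<in> A" "j \<in> B" "l \<in> B"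
    for A B i j k l
    using nc that unfolding noncrossing_def by blast
  have dis: "x \<noteq> y" if "A \<in> \<pi>" "B \<in> \<pi>" "A \<noteq> B" "x \<in> A" "y \<in> B" for A B x y
    using disjointD[OF d that(1-3)] that(4,5) by blast
  have VW: "V \<noteq> W" using V(3)[of w] W by auto
  \<comment> \<open>When the merged block takes part in a crossing with one point in
    \<open>V\<close> and one in \<open>W\<close>, one of them can be replaced by \<open>v\<close> or
    \<open>w\<close> to give a crossing inside \<open>\<pi>\<close>. No point of a third block fits
    between the neighbours \<open>w\<close> and \<open>v\<close>.\<close>
  have merge1: False if B: "B \<in> \<pi>" "B \<noteq> V" "B \<noteq> W"
    and o: "i < j" "j < k" "k < l" and m: "i \<in> V \<union> W" "k \<in> V \<union> W" "j \<in> B" "l \<in> B" for B i j k l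
  proof -
    have j: "j \<noteq> v" "j \<noteq> w" using dis[OF B(1) V(1) B(2) m(3) V(2)] dis[OF B(1) W(1) B(3) m(3) W(2)] by auto
    consider "i \<in> V" "k \<in> V" | "i \<in> W" "k \<in> W" | "i \<in> V" "k \<in> W" | "i \<in> W" "k \<in> V" using m by blast
    then show False
    proof cases
      case 1 then show False using ncD[OF V(1) B(1) o _ _ m(3,4)] B by blast
    next
      case 2 then show False using ncD[OF W(1) B(1) o _ _ m(3,4)] B by blast
    next
      case 3
      then have "w < j" using V(3)[of i] W(3) o by simp
      then show False using ncD[OF W(1) B(1) _ o(2,3) W(2) _ m(3,4)] 3 B by blast
    next
      case 4
      then have k: "v \<le> k" using V(3) by blast
      show False
      proof (cases "j < w")
        case True
        have "w < l" using k W(3) o by simp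
        then show False using ncD[OF W(1) B(1) o(1) True _ _ W(2) m(3,4)] 4 B by blast
      next
        case False
        then have "v < j" using j W(3) by simp
        then show False using ncD[OF V(1) B(1) _ o(2,3) V(2) _ m(3,4)] 4 B by blast
      qed
    qed
  qed
  have merge2: False if B: "B \<in> \<pi>" "B \<noteq> V" "B \<noteq> W"
    and o: "i < j" "j < k" "k < l" and m: "j \<in> V \<union> W" "l \<in> V \<union> W" "i \<in> B" "k \<in> B" for B i j k l
  proof -
    have ne: "i \<noteq> v" "i \<noteq> w" "k \<noteq> v" "k \<noteq> w"
      using dis[OF B(1) V(1) B(2) m(3) V(2)] dis[OF B(1) W(1) B(3) m(3) W(2)]
        dis[OF B(1) V(1) B(2) m(4) V(2)] dis[OF B(1) W(1) B(3) m(4) W(2)] by auto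
    consider "j \<in> V" "l \<in> V" | "j \<in> W" "l \<in> W" | "j \<in> V" "l \<in> W" | "j \<in> W" "l \<in> V" using m by blast
    then show False
    proof cases
      case 1 then show False using ncD[OF B(1) V(1) o m(3,4)] B by blast
    next
      case 2 then show False using ncD[OF B(1) W(1) o m(3,4)] B by blast
    next
      case 3
      then have j: "v \<le> j" using V(3) by blast
      show False
      proof (cases "i < w")
        case True
        have "w < k" using j W(3) o by simp
        then show False using ncD[OF B(1) W(1) True _ o(3) m(3,4) W(2)] 3 B by blast
      next
        case False
        then have "v < i" using ne W(3) by simp
        then show False using ncD[OF V(1) B(1) _ o(1,2) V(2) _ m(3,4)] 3 B by blast
      qed
    next
      case 4
      then have l: "v \<le> l" using V(3) by blast
      have "j \<noteq> v" using dis[OF W(1) V(1) _ 4(1) V(2)] VW by blast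
      show False
      proof (cases "v < j")
        case True
        have "w < v" "j < l" using W(3) o by auto
        then show False using ncD[OF W(1) V(1) _ True _ W(2) 4(1) V(2) 4(2)] VW by blast
      next
        case False
        then have jw: "j \<le> w" using W(3) \<open>j \<noteq> v\<close> by simp
        show False
        proof (cases "k < w")
          case True
          then show False using ncD[OF B(1) W(1) o(1,2) True m(3,4) 4(1) W(2)] B by blast
        next
          case False
          then have "v < k" "i < v" using ne W(3) o jw by auto
          then show False using ncD[OF B(1) V(1) _ _ o(3) m(3,4) V(2) 4(2)] B by blast
        qed
      qed
    qed
  qed
  show ?thesis
    unfolding noncrossing_def
  proof (intro ballI allI impI)
    fix A B i j k l
    assume A: "A \<in> insert (V \<union> W) (\<pi> - {V, W})" and B: "B \<in> insert (V \<union> W) (\<pi> - {V, W})"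
      and h: "i < j \<and> j < k \<and> k < l \<and> i \<in> A \<and> k \<in> A \<and> j \<in> B \<and> l \<in> B"
    show "A = B"
    proof (rule ccontr)
      assume ne: "A \<noteq> B"
      consider "A = V \<union> W" "B \<in> \<pi>" "B \<noteq> V" "B \<noteq> W" | "B = V \<union> W" "A \<in> \<pi>" "A \<noteq> V" "A \<noteq> W"
        | "A \<in> \<pi>" "B \<in> \<pi>"
        using A B ne by blast
      then show False
      proof cases
        case 1
        show False by (rule merge1[OF 1(2-4)]) (use h 1 in auto)
      next
        case 2
        show False by (rule merge2[OF 2(2-4)]) (use h 2 in auto)
      next
        case 3
        show False using ncD[OF 3] h ne by blast
      qed
    qed
  qed
qed

lemma cyc_long_cycle: "1 \<le> n \<Longrightarrow> cyc {1..n} (long_cycle n) = {{1..n}}"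
  using transitive_long_cycle long_cycle_permutes by (intro cyc_transitive) auto

text \<open>Invariance of the blocks makes the cycles refine \<open>\<pi>\<close>. The transposition
  creates exactly one cycle, so the counts agree and the refinement is an equality.\<close>

lemma transpose_invariant_splits:
  fixes \<alpha> :: "'a \<Rightarrow> 'a"
  assumes X: "finite X" "\<alpha> permutes X" and V: "m \<in> V" "V \<subseteq> X" and w: "w \<in> X" "w \<notin> V"
    and c: "(w, m) \<in> conn {\<alpha>}" and P: "partition_on X \<pi>" "card \<pi> = card (cyc X \<alpha>) + 1"
    and inv: "\<And>B x. B \<in> \<pi> \<Longrightarrow> x \<in> B \<Longrightarrow> (\<alpha> \<circ> Transposition.transpose w m) x \<in> B"
  shows "cyc X (\<alpha> \<circ> Transposition.transpose w m) = \<pi>"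
proof -
  let ?t = "Transposition.transpose w m"
  have m: "m \<in> X" "w \<noteq> m" using V w by auto
  have p: "\<alpha> \<circ> ?t permutes X" using permutes_compose[OF permutes_swap_id[OF w(1) m(1)] X(2)] .
  show ?thesis
  proof (rule refining_partition_eq[OF _ _ cyc_partition[OF X(1) p] P(1)])
    show "finite \<pi>" using finite_elements[OF X(1) P(1)] .
    show "card (cyc X (\<alpha> \<circ> ?t)) = card \<pi>"
      using card_cyc_comp_transpose(1)[OF X w(1) m c] P(2) by simp
    fix C assume "C \<in> cyc X (\<alpha> \<circ> ?t)"
    then obtain x where x: "x \<in> X" "C = orbit (\<alpha> \<circ> ?t) x" by (auto simp: cyc_def)
    then obtain B where B: "B \<in> \<pi>" "x \<in> B" using partition_onD1[OF P(1)] by auto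
    have "y \<in> B" if "y \<in> orbit (\<alpha> \<circ> ?t) x" for y
      using that by induction (use inv[OF B(1)] B(2) in auto)
    then show "\<exists>q\<in>\<pi>. C \<subseteq> q" using B(1) x(2) by blast
  qed (use X in simp)
qed

text \<open>Splitting a cycle adds one to the count of \<open>\<alpha>\<close>, while the
  complementary factor loses at most one cycle; the triangle inequality leaves no slack beyond that.
  The complementary factor is counted through its inverse
  \<open>inv' (long_cycle n) \<circ> \<alpha>\<close>, where the transposition again acts on the
  right.\<close>

lemma geodesic_transpose:
  assumes g: "geodesic n \<alpha>" and i: "i \<in> {1..n}" "j \<in> {1..n}" "i \<noteq> j" and c: "(i, j) \<in> conn {\<alpha>}"
  shows "geodesic n (\<alpha> \<circ> Transposition.transpose i j)"
proof -
  let ?X = "{1..n}" and ?t = "Transposition.transpose i j" and ?g = "long_cycle n"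
  have n: "1 \<le> n" using i by auto
  have a: "\<alpha> permutes ?X" and e: "card (cyc ?X \<alpha>) + card (cyc ?X (inv' \<alpha> \<circ> ?g)) = n + 1"
    using g by (auto simp: geodesic_def)
  have gp: "?g permutes ?X" by (rule long_cycle_permutes)
  define b where "b = \<alpha> \<circ> ?t"
  have b: "b permutes ?X"
    unfolding b_def using permutes_compose[OF permutes_swap_id[OF i(1,2)] a] .
  have inv_comp: "inv' (inv' h \<circ> ?g) = inv' ?g \<circ> h" if "h permutes ?X" for h
    using permutes_inv_inv[OF that] permutes_bij[OF gp] permutes_bij[OF permutes_inv[OF that]]
    by (simp add: o_inv_distrib)
  have ip: "inv' h \<circ> ?g permutes ?X" if "h permutes ?X" for h
    using permutes_compose[OF gp permutes_inv[OF that]] .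
  have ci: "card (cyc ?X (inv' h \<circ> ?g)) = card (cyc ?X (inv' ?g \<circ> h))" if "h permutes ?X" for h
    using cyc_inv[OF _ ip[OF that]] inv_comp[OF that] by simp
  have "inv' ?g \<circ> b = (inv' ?g \<circ> \<alpha>) \<circ> ?t" by (simp add: b_def comp_assoc)
  moreover have "inv' ?g \<circ> \<alpha> permutes ?X" using permutes_compose[OF a permutes_inv[OF gp]] .
  ultimately have "card (cyc ?X (inv' ?g \<circ> \<alpha>)) \<le> card (cyc ?X (inv' ?g \<circ> b)) + 1"
    using card_cyc_comp_transpose[of ?X "inv' ?g \<circ> \<alpha>" i j] i
    by (cases "(i, j) \<in> conn {inv' ?g \<circ> \<alpha>}") auto
  moreover have "card (cyc ?X b) = card (cyc ?X \<alpha>) + 1"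
    unfolding b_def using card_cyc_comp_transpose(1)[OF _ a i c] by simp
  moreover have "card (cyc ?X b) + card (cyc ?X (inv' b \<circ> ?g)) \<le> n + 1"
  proof -
    have "b \<circ> (inv' b \<circ> ?g) = ?g" using permutes_inv_o[OF b] by (simp flip: comp_assoc)
    then show ?thesis
      using card_cyc_triangle[OF _ b ip[OF b]] cyc_long_cycle[OF n] by simp
  qed
  ultimately have "card (cyc ?X b) + card (cyc ?X (inv' b \<circ> ?g)) = n + 1"
    using e ci[OF a] ci[OF b] by linarith
  then show ?thesis using b by (simp add: geodesic_def b_def)
qed

text \<open>A block \<open>V\<close> without 1 is merged with the block containing the predecessor
  of its minimum. The permutation of the coarser partition, known by induction, is then cut by one
  transposition. If every block contains 1, there is only one block and the long cycle
  serves.\<close>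

lemma NC_geodesic:
  assumes "1 \<le> n" "\<pi> \<in> NC n"
  shows "\<exists>\<alpha>. geodesic n \<alpha> \<and> cyc {1..n} \<alpha> = \<pi>"
  using assms(2)
proof (induction "card \<pi>" arbitrary: \<pi> rule: less_induct)
  case less
  let ?X = "{1..n}"
  have part: "partition_on ?X \<pi>" and nc: "noncrossing \<pi>"
    using less.prems by (auto simp: NC_def set_partitions_def)
  have fin: "finite \<pi>" using finite_elements[OF _ part] by simp
  have un: "\<Union>\<pi> = ?X" using partition_onD1[OF part] by simp
  have dis: "A = B" if "A \<in> \<pi>" "B \<in> \<pi>" "x \<in> A" "x \<in> B" for A B x
    using disjointD[OF partition_onD2[OF part] that(1,2)] that(3,4) by blast
  have one: "1 \<in> ?X" using assms(1) by simp
  show ?case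
  proof (cases "\<exists>V\<in>\<pi>. 1 \<notin> V")
    case False
    have "\<pi> = {?X}"
    proof -
      have "A = B" if "A \<in> \<pi>" "B \<in> \<pi>" for A B using dis[OF that, of 1] False that by blast
      moreover obtain A where A: "A \<in> \<pi>" using un one by blast
      ultimately have "\<pi> = {A}" by blast
      then show ?thesis using un by simp
    qed
    moreover have "geodesic n (long_cycle n)"
      using long_cycle_permutes[of n] permutes_inv_o(2)[OF long_cycle_permutes[of n]]
      by (simp add: geodesic_def cyc_long_cycle[OF assms(1), simplified] card_cyc_id)
    ultimately show ?thesis using cyc_long_cycle[OF assms(1)] by metis
  next
    case True
    then obtain V where V: "V \<in> \<pi>" "1 \<notin> V" by blast
    have Vn: "V \<noteq> {}" "finite V" "V \<subseteq> ?X"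
      using partition_onD3[OF part] V(1) un finite_subset[of V ?X] by auto
    \<comment> \<open>The predecessor \<open>w\<close> stays in \<open>{1..n}\<close> because
      \<open>1 \<notin> V\<close>. Transposing \<open>w\<close> with the maximum \<open>m\<close>
      sends \<open>m\<close> to the former image of \<open>w\<close>, which closes \<open>V\<close>
      into a cycle.\<close>
    define v m w where "v = Min V" and "m = Max V" and "w = v - 1"
    have v: "v \<in> V" "\<And>x. x \<in> V \<Longrightarrow> v \<le> x" and m: "m \<in> V" "\<And>x. x \<in> V \<Longrightarrow> x \<le> m"
      using Vn by (auto simp: v_def m_def)
    have "v \<in> ?X" "v \<noteq> 1" using v(1) Vn(3) V(2) by auto
    then have w: "v = Suc w" "w \<in> ?X" by (auto simp: w_def)
    then obtain W where W: "W \<in> \<pi>" "w \<in> W" using un by blast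
    have wV: "w \<notin> V" using v(2)[of w] w by auto
    then have VW: "V \<noteq> W" using W by blast
    have wm: "w < m" using m(2)[OF v(1)] w by simp
    let ?U = "V \<union> W"
    define \<pi>' where "\<pi>' = insert ?U (\<pi> - {V, W})"
    have Unot: "?U \<notin> \<pi>" using dis[OF V(1) _ v(1), of ?U] wV W(2) v(1) by blast
    have card: "card \<pi> = card \<pi>' + 1"
    proof -
      have "card \<pi>' = Suc (card (\<pi> - {V, W}))" using Unot fin by (simp add: \<pi>'_def)
      moreover have "card (\<pi> - {V, W}) = card \<pi> - 2" using V(1) W(1) VW fin by (simp add: card_Diff_subset)
      moreover have "2 \<le> card \<pi>" using V(1) W(1) VW fin card_mono[of \<pi> "{V, W}"] by simp
      ultimately show ?thesis by simp
    qed
    have "partition_on ?X \<pi>'"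
    proof (rule partition_onI)
      show "\<Union>\<pi>' = ?X" using un V(1) W(1) by (auto simp: \<pi>'_def)
      show "{} \<notin> \<pi>'" using partition_onD3[OF part] v(1) by (auto simp: \<pi>'_def)
      show "disjnt p q" if "p \<in> \<pi>'" "q \<in> \<pi>'" "p \<noteq> q" for p q
        using that dis V(1) W(1) unfolding \<pi>'_def disjnt_def by blast
    qed
    moreover have "noncrossing \<pi>'"
      unfolding \<pi>'_def by (rule noncrossing_merge[OF nc partition_onD2[OF part] V(1) v W w(1)])
    ultimately have "\<pi>' \<in> NC n" by (simp add: NC_def set_partitions_def)
    then obtain \<alpha> where g: "geodesic n \<alpha>" and c: "cyc ?X \<alpha> = \<pi>'"
      using less.hyps[of \<pi>'] card by auto
    have a: "\<alpha> permutes ?X" using g by (simp add: geodesic_def)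
    note blk = cyc_blockD[OF finite_atLeastAtMost a, unfolded c]
    note co = conn_orbit[OF finite_atLeastAtMost a]
    have U: "?U \<in> \<pi>'" by (simp add: \<pi>'_def)
    have cU: "(x, z) \<in> conn {\<alpha>}" if "x \<in> ?U" "z \<in> ?U" for x z
      using blk(1)[OF U that(1)] that(2) co by simp
    have UX: "?U \<subseteq> ?X" using V W un by blast
    have nb: "\<not> cyclic_between x z (\<alpha> x)" if "x \<in> ?U" "z \<in> ?U" for x z
      using geodesic_next[OF g _ cU[OF that]] that UX by blast
    have VWnc: False if "i < j" "j < k" "k < l" "i \<in> W" "k \<in> W" "j \<in> V" "l \<in> V" for i j k l
      using nc that V(1) W(1) VW unfolding noncrossing_def by blast
    let ?t = "Transposition.transpose w m"
    define b where "b = \<alpha> \<circ> ?t"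
    have mX: "m \<in> ?X" using m(1) Vn(3) by blast
    have bp: "b permutes ?X" unfolding b_def using permutes_compose[OF permutes_swap_id[OF w(2) mX] a] .
    have nVW: "x \<noteq> y" if "x \<in> V" "y \<in> W" for x y using dis[OF V(1) W(1)] VW that by blast
    have bU: "b x \<in> ?U" if "x \<in> ?U" for x
    proof -
      have "?t x \<in> ?U" using that W(2) m(1) by (auto simp: transpose_def)
      then show ?thesis using blk(2)[OF U] by (simp add: b_def)
    qed
    \<comment> \<open>In \<open>V \<union> W\<close> the map \<open>\<alpha>\<close> passes to the
      cyclic successor. For \<open>x = m\<close> this gives \<open>b m = \<alpha> w = v\<close>. For
      \<open>x < m\<close> the successor is at most \<open>m\<close>; if it were in
      \<open>W\<close>, then \<open>w < x < \<alpha> x < m\<close> would be a crossing of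
      \<open>W\<close> and \<open>V\<close>.\<close>
    have bV: "b x \<in> V" if x: "x \<in> V" for x
    proof (rule ccontr)
      assume n: "b x \<notin> V"
      then have y: "b x \<in> W" using bU x by blast
      show False
      proof (cases "x = m")
        case True
        then have e: "b x = \<alpha> w" by (simp add: b_def)
        have "\<alpha> w \<noteq> w"
        proof
          assume "\<alpha> w = w"
          then have "orbit \<alpha> w = {w}" by (simp add: orbit_eq_singleton_iff)
          then have "?U = {w}" using blk(1)[OF U, of w] W(2) by simp
          moreover have "v \<in> ?U" using v(1) by simp
          ultimately have "v = w" by simp
          then show False using w(1) by simp
        qed
        moreover have "\<not> cyclic_between w v (\<alpha> w)" using nb W(2) v(1) by blast
        moreover have "\<alpha> w \<noteq> v" using n e v(1) by metis
        ultimately show False using w(1) by (auto simp: cyclic_between_def)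
      next
        case False
        then have xm: "x < m" using m(2)[OF x] by simp
        have "x \<noteq> w" using x wV by blast
        then have e: "b x = \<alpha> x" using False by (simp add: b_def transpose_def)
        have "\<not> cyclic_between x m (\<alpha> x)" using nb x m(1) by blast
        then have "\<not> (m < \<alpha> x)" "\<not> (\<alpha> x < x)" using xm by (auto simp: cyclic_between_def)
        moreover have "\<alpha> x \<noteq> x" "\<alpha> x \<noteq> m" using n e x m(1) by metis+
        ultimately have o: "x < \<alpha> x" "\<alpha> x < m" by auto
        have "w < x" using v(2)[OF x] w(1) by simp
        then show False using VWnc[OF _ o W(2) _ x m(1)] y e by simp
      qed
    qed
    have bV': "b ` V = V"
    proof (rule card_subset_eq[OF Vn(2)])
      show "card (b ` V) = card V"
        by (rule card_image) (use permutes_inj[OF bp] in \<open>auto simp: inj_on_def dest: injD\<close>)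
    qed (use bV in blast)
    have inv: "b x \<in> B" if B: "B \<in> \<pi>" "x \<in> B" for B x
    proof -
      consider "B = V" | "B = W" | "B \<noteq> V" "B \<noteq> W" by blast
      then show ?thesis
      proof cases
        case 1 then show ?thesis using bV B by blast
      next
        case 2
        have "b x \<notin> V"
        proof
          assume "b x \<in> V"
          then obtain x' where "x' \<in> V" "b x = b x'" using bV' by (metis imageE)
          then have "x \<in> V" using permutes_inj[OF bp] by (metis injD)
          then show False using nVW B 2 by blast
        qed
        then show ?thesis using bU[of x] B 2 by blast
      next
        case 3
        then have "B \<in> \<pi>'" using B by (simp add: \<pi>'_def)
        moreover have "x \<noteq> w" "x \<noteq> m" using dis[OF B(1) W(1)] dis[OF B(1) V(1)] 3 W(2) m(1) B(2) by blast+
        ultimately show ?thesis using blk(2)[of B x] B(2) by (simp add: b_def transpose_def)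
      qed
    qed
    have wmc: "(w, m) \<in> conn {\<alpha>}" using cU W(2) m(1) by blast
    have "cyc ?X b = \<pi>"
      unfolding b_def
      by (rule transpose_invariant_splits[OF _ a m(1) Vn(3) w(2) wV wmc part])
        (use card c inv in \<open>auto simp: b_def\<close>)
    moreover have "geodesic n b"
      unfolding b_def using geodesic_transpose[OF g w(2) mX _ wmc] wm by simp
    ultimately show ?thesis by blast
  qed
qed

lemma bij_betw_geodesic_NC:
  assumes "1 \<le> n"
  shows "bij_betw (cyc {1..n}) {\<alpha>. geodesic n \<alpha>} (NC n)"
  unfolding bij_betw_def
proof
  show "inj_on (cyc {1..n}) {\<alpha>. geodesic n \<alpha>}"
    by (rule inj_onI) (use geodesic_determined in auto)
  show "cyc {1..n} ` {\<alpha>. geodesic n \<alpha>} = NC n"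
  proof
    show "NC n \<subseteq> cyc {1..n} ` {\<alpha>. geodesic n \<alpha>}"
      using NC_geodesic[OF assms] by (metis (mono_tags, lifting) image_iff mem_Collect_eq subsetI)
  qed (use geodesic_NC in blast)
qed

subsection \<open>Permutations with at most two cycles\<close>

lemma cyclic_perms_enum:
  assumes "finite A" "\<gamma> \<in> cyclic_perms A" "x \<in> A"
  shows "bij_betw (\<lambda>i. (\<gamma> ^^ i) x) {..<card A} A" "(\<gamma> ^^ card A) x = x"
proof -
  have p: "\<gamma> permutes A" and t: "transitive_on A {\<gamma>}" using assms(2) by (auto simp: cyclic_perms_def)
  have self: "x \<in> orbit \<gamma> x" by (rule orbit_self[OF assms(1) p])
  have o: "orbit \<gamma> x = A"
    using cyc_transitive[OF assms(1) _ p t] assms(3) by (auto simp: cyc_def)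
  let ?k = "funpow_dist1 \<gamma> x x"
  have e: "A = (\<lambda>i. (\<gamma> ^^ i) x) ` {0..<?k}"
    using orbit_conv_funpow_dist1[OF self] o by simp
  have inj: "inj_on (\<lambda>i. (\<gamma> ^^ i) x) {0..<?k}" by (rule inj_on_funpow_dist1[OF self])
  have k: "card A = ?k" by (subst e) (simp only: card_image[OF inj] card_atLeastLessThan diff_zero)
  show "bij_betw (\<lambda>i. (\<gamma> ^^ i) x) {..<card A} A"
    unfolding bij_betw_def k using inj e by (simp add: atLeast0LessThan)
  show "(\<gamma> ^^ card A) x = x" unfolding k by (rule funpow_dist1_prop[OF self])
qed

text \<open>The powers of the two cycles applied to base points enumerate the two sets. Matching
  equal exponents intertwines the cycles, and the wrap-around fits because the cardinalities
  agree.\<close>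

lemma cyclic_perms_conj:
  assumes "finite A" "finite A'" "card A = card A'" "\<gamma> \<in> cyclic_perms A" "\<gamma>' \<in> cyclic_perms A'"
  shows "\<exists>h. bij_betw h A A' \<and> (\<forall>x\<in>A. h (\<gamma> x) = \<gamma>' (h x))"
proof (cases "A = {}")
  case True
  then show ?thesis using assms by (auto simp: bij_betw_def)
next
  case False
  then obtain x where x: "x \<in> A" by blast
  have "A' \<noteq> {}" using False assms(1-3) by auto
  then obtain x' where x': "x' \<in> A'" by blast
  let ?e = "\<lambda>i. (\<gamma> ^^ i) x" and ?e' = "\<lambda>i. (\<gamma>' ^^ i) x'"
  note e = cyclic_perms_enum[OF assms(1,4) x]
  note e' = cyclic_perms_enum[OF assms(2,5) x', folded assms(3)]
  define h where "h = ?e' \<circ> inv_into {..<card A} ?e"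
  have hb: "bij_betw h A A'"
    unfolding h_def by (rule bij_betw_trans[OF bij_betw_inv_into[OF e(1)] e'(1)])
  have he: "h (?e i) = ?e' i" if "i < card A" for i
    using bij_betw_inv_into_left[OF e(1), of i] that by (simp add: h_def)
  have "h (\<gamma> y) = \<gamma>' (h y)" if "y \<in> A" for y
  proof -
    have "y \<in> ?e ` {..<card A}" unfolding bij_betw_imp_surj_on[OF e(1)] by (rule that)
    then obtain i where i: "i < card A" "y = ?e i" by (elim imageE) simp
    have "\<gamma> y = ?e (Suc i)" using i by simp
    moreover have "h (?e (Suc i)) = ?e' (Suc i)"
    proof (cases "Suc i = card A")
      case True
      have "h (?e 0) = ?e' 0" using he[of 0] i by (metis gr_implies_not0 neq0_conv)
      then show ?thesis unfolding True e(2) e'(2) by simp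
    qed (use he[of "Suc i"] i in simp)
    ultimately show ?thesis using he[OF i(1)] i(2) by simp
  qed
  then show ?thesis using hb by blast
qed

text \<open>With \<open>B = {}\<close> this also covers conjugacy of single cycles.\<close>

lemma two_cycles_conj:
  assumes "finite X" "A \<union> B = X" "A \<inter> B = {}" "A' \<union> B' = X" "A' \<inter> B' = {}" "card A = card A'"
    and f: "f \<in> cyclic_perms A" "g \<in> cyclic_perms B" and f': "f' \<in> cyclic_perms A'" "g' \<in> cyclic_perms B'"
  shows "\<exists>\<tau>. \<tau> permutes X \<and> f' \<circ> g' = \<tau> \<circ> (f \<circ> g) \<circ> inv' \<tau>"
proof -
  have fin: "finite A" "finite B" "finite A'" "finite B'"
    using assms(1,2,4) by (metis finite_Un)+
  have cB: "card B = card B'"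
    using card_Un_disjoint[OF fin(1,2) assms(3)] card_Un_disjoint[OF fin(3,4) assms(5)] assms(2,4,6) by simp
  have p: "f permutes A" "g permutes B" "f' permutes A'" "g' permutes B'"
    using f f' by (auto simp: cyclic_perms_def)
  obtain h where h: "bij_betw h A A'" "\<And>x. x \<in> A \<Longrightarrow> h (f x) = f' (h x)"
    using cyclic_perms_conj[OF fin(1,3) assms(6) f(1) f'(1)] by blast
  obtain k where k: "bij_betw k B B'" "\<And>x. x \<in> B \<Longrightarrow> k (g x) = g' (k x)"
    using cyclic_perms_conj[OF fin(2,4) cB f(2) f'(2)] by blast
  define \<tau> where "\<tau> x = (if x \<in> A then h x else if x \<in> B then k x else x)" for x
  have \<tau>A: "bij_betw \<tau> A A'" using h(1) by (rule bij_betw_cong[THEN iffD1, rotated]) (simp add: \<tau>_def)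
  have \<tau>B: "bij_betw \<tau> B B'" using k(1)
    by (rule bij_betw_cong[THEN iffD1, rotated]) (use assms(3) in \<open>auto simp: \<tau>_def\<close>)
  have \<tau>: "\<tau> permutes X"
  proof (rule bij_imp_permutes)
    show "bij_betw \<tau> X X"
      using bij_betw_combine[OF \<tau>A \<tau>B assms(5)] assms(2,4) by simp
  qed (use assms(2) in \<open>auto simp: \<tau>_def\<close>)
  have "(f' \<circ> g') (\<tau> x) = \<tau> ((f \<circ> g) x)" for x
  proof -
    consider "x \<in> A" | "x \<in> B" | "x \<notin> X" using assms(2) by blast
    then show ?thesis
    proof cases
      case 1
      then have "\<tau> x \<in> A'" "\<tau> x = h x" "f x \<in> A" using \<tau>A permutes_in_image[OF p(1)] by (auto simp: bij_betw_def \<tau>_def)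
      then show ?thesis
        using permutes_Un_eq(1)[OF p(1,2) assms(3) 1] permutes_Un_eq(1)[OF p(3,4) assms(5), of "\<tau> x"] h(2)[OF 1]
        by (simp add: \<tau>_def)
    next
      case 2
      then have nA: "x \<notin> A" "g x \<in> B" "g x \<notin> A" using assms(3) permutes_in_image[OF p(2)] by auto
      then have "\<tau> x \<in> B'" "\<tau> x = k x" using \<tau>B 2 by (auto simp: bij_betw_def \<tau>_def)
      then show ?thesis
        using permutes_Un_eq(2)[OF p(1,2) assms(3) 2] permutes_Un_eq(2)[OF p(3,4) assms(5), of "\<tau> x"] k(2)[OF 2] nA
        by (simp add: \<tau>_def)
    next
      case 3
      then have "x \<notin> A" "x \<notin> B" "x \<notin> A'" "x \<notin> B'" using assms(2,4) by auto
      then have "f x = x" "g x = x" "f' x = x" "g' x = x" "\<tau> x = x"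
        using permutes_not_in[OF p(1)] permutes_not_in[OF p(2)] permutes_not_in[OF p(3)]
          permutes_not_in[OF p(4)] by (simp_all add: \<tau>_def)
      then show ?thesis by simp
    qed
  qed
  then have "f' \<circ> g' = \<tau> \<circ> (f \<circ> g) \<circ> inv' \<tau>"
    using permutes_inverses(1)[OF \<tau>] by (simp add: fun_eq_iff) metis
  then show ?thesis using \<tau> by blast
qed

section \<open>The annulus permutation and generated subgroups\<close>

lemma cycle_of_list_cyclic:
  assumes "distinct cs"
  shows "cycle_of_list cs \<in> cyclic_perms (set cs)"
proof -
  let ?f = "cycle_of_list cs"
  have p: "?f permutes set cs" by (rule cycle_permutes)
  have r: "(hd cs, x) \<in> conn {?f}" if x: "x \<in> set cs" for x
  proof -
    obtain i where i: "i < length cs" "x = cs ! i" using x by (auto simp: in_set_conv_nth)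
    have ne: "cs \<noteq> []" using x by auto
    have "(?f ^^ i) (hd cs) = hd (map (?f ^^ i) cs)" using ne by (simp add: hd_map)
    also have "\<dots> = hd (rotate i cs)" using cyclic_rotation[OF assms] by simp
    also have "\<dots> = x" using hd_rotate_conv_nth[OF ne, of i] i by simp
    finally have "x = (?f ^^ i) (hd cs)" by simp
    moreover have "(y, (?f ^^ i) y) \<in> conn {?f}" for y
      by (induction i) (auto intro: conn_trans conn_step)
    ultimately show ?thesis by simp
  qed
  have "(x, y) \<in> conn {?f}" if "x \<in> set cs" "y \<in> set cs" for x y
    using conn_trans[OF conn_sym[of "set cs" "{?f}" "hd cs" x] r[OF that(2)]] r[OF that(1)] p by simp
  then show ?thesis using p by (simp add: cyclic_perms_def transitive_on_def)
qed

lemma annulus_perm_cycles: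
  "cycle_of_list [1..<r + 1] \<in> cyclic_perms {1..r}"
  "cycle_of_list [r + 1..<r + s + 1] \<in> cyclic_perms {r + 1..r + s}"
proof -
  have "set [1..<r + 1] = {1..r}" "set [r + 1..<r + s + 1] = {r + 1..r + s}" by auto
  then show "cycle_of_list [1..<r + 1] \<in> cyclic_perms {1..r}"
    "cycle_of_list [r + 1..<r + s + 1] \<in> cyclic_perms {r + 1..r + s}"
    using cycle_of_list_cyclic[of "[1..<r + 1]"] cycle_of_list_cyclic[of "[r + 1..<r + s + 1]"]
    by (simp_all del: upt_Suc set_upt)
qed

lemma annulus_perm_permutes: "annulus_perm r s permutes {1..r + s}"
proof -
  have "{1..r} \<union> {r + 1..r + s} = {1..r + s}" by auto
  then show ?thesis
    using permutes_Un_comp[of "cycle_of_list [1..<r + 1]" "{1..r}" "cycle_of_list [r + 1..<r + s + 1]" "{r + 1..r + s}"]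
      annulus_perm_cycles[of r] annulus_perm_cycles(2)[of r s]
    unfolding annulus_perm_def cyclic_perms_def by simp
qed

lemma annulus_perm_conj:
  assumes "finite A" "A \<subseteq> {1..n}" "f \<in> cyclic_perms A" "g \<in> cyclic_perms ({1..n} - A)"
  shows "\<exists>\<tau>. \<tau> permutes {1..n} \<and> annulus_perm (card A) (n - card A) = \<tau> \<circ> (f \<circ> g) \<circ> inv' \<tau>"
proof -
  have c: "card A \<le> n" using card_mono[OF _ assms(2)] by simp
  show ?thesis
    unfolding annulus_perm_def
    by (rule two_cycles_conj[OF _ _ _ _ _ _ assms(3,4) annulus_perm_cycles]) (use assms(2) c in auto)
qed

text \<open>Both permutations have one cycle of length \<open>r\<close> and one of length
  \<open>s\<close>. This symmetry permits the averaging over \<open>r\<close> and \<open>s\<close>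
  that produces the factor one half.\<close>

lemma annulus_perm_swap_conj:
  "\<exists>\<tau>. \<tau> permutes {1..r + s} \<and> annulus_perm s r = \<tau> \<circ> annulus_perm r s \<circ> inv' \<tau>"
proof -
  let ?f = "cycle_of_list [1..<r + 1]" and ?g = "cycle_of_list [r + 1..<r + s + 1]"
  note c = annulus_perm_cycles[of r] annulus_perm_cycles(2)[of r s]
  have p: "?f permutes {1..r}" "?g permutes {r + 1..r + s}" using c by (auto simp: cyclic_perms_def)
  have "?f \<circ> ?g = ?g \<circ> ?f"
  proof
    fix x
    have d: "{1..r} \<inter> {r + 1..r + s} = {}" "{r + 1..r + s} \<inter> {1..r} = {}" by auto
    consider "x \<in> {1..r}" | "x \<in> {r + 1..r + s}" | "x \<notin> {1..r}" "x \<notin> {r + 1..r + s}" by blast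
    then show "(?f \<circ> ?g) x = (?g \<circ> ?f) x"
    proof cases
      case 1
      then show ?thesis using permutes_Un_eq(1)[OF p d(1) 1] permutes_Un_eq(2)[OF p(2,1) d(2) 1] by simp
    next
      case 2
      then show ?thesis using permutes_Un_eq(2)[OF p d(1) 2] permutes_Un_eq(1)[OF p(2,1) d(2) 2] by simp
    next
      case 3
      then show ?thesis using permutes_not_in[OF p(1) 3(1)] permutes_not_in[OF p(2) 3(2)] by simp
    qed
  qed
  moreover have "{1..r + s} - {r + 1..r + s} = {1..r}" by auto
  ultimately show ?thesis
    using annulus_perm_conj[of "{r + 1..r + s}" "r + s" ?g ?f] c
    by (auto simp: annulus_perm_def)
qed

text \<open>The generated subgroup also contains inverses, whereas \<open>conn\<close> takes forward
  steps only; on a finite set \<open>conn_inv_step\<close> closes this gap.\<close>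

lemma transitive_generate:
  assumes "\<alpha> permutes {1..n}" "\<gamma> permutes {1..n}"
  shows "(\<forall>i\<in>{1..n}. \<forall>j\<in>{1..n}. \<exists>g \<in> generate (sym_group n) {\<alpha>, \<gamma>}. g i = j)
    \<longleftrightarrow> transitive_on {1..n} {\<alpha>, \<gamma>}"
proof -
  let ?G = "generate (sym_group n) {\<alpha>, \<gamma>}" and ?C = "conn {\<alpha>, \<gamma>}"
  have ps: "permset {1..n} {\<alpha>, \<gamma>}" using assms by simp
  have 1: "(i, g i) \<in> ?C" if "g \<in> ?G" for g i
    using that
  proof (induction arbitrary: i)
    case one then show ?case by (simp add: sym_group_one)
  next
    case (incl h) then show ?case by (rule conn_step)
  next
    case (inv h)
    then have "h \<in> carrier (sym_group n)" using assms by (auto simp: sym_group_carrier)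
    then show ?case using conn_inv_step[OF ps inv] by simp
  next
    case (eng h1 h2)
    then show ?case using conn_trans[of i "h2 i" _ "h1 (h2 i)"] by (simp add: sym_group_mult)
  qed
  have 2: "\<exists>g\<in>?G. g i = j" if "(i, j) \<in> ?C" for i j
    using that
  proof (induction rule: conn_induct)
    case refl
    show ?case
      by (rule bexI[of _ id]) (use generate.one[of "sym_group n" "{\<alpha>, \<gamma>}"] in \<open>simp_all add: sym_group_one\<close>)
  next
    case (step y f)
    obtain g where g: "g \<in> ?G" "g i = y" using step(3) by blast
    have "f \<circ> g \<in> ?G"
      using generate.eng[OF generate.incl[OF step(2)] g(1)] by (simp add: sym_group_mult)
    then show ?case by (rule bexI[rotated]) (simp add: g(2))
  qed
  show ?thesis unfolding transitive_on_def using 1 2 by metis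
qed

subsection \<open>Factorizations of a permutation\<close>

definition transitive_pairs :: "nat \<Rightarrow> nat \<Rightarrow> ((nat \<Rightarrow> nat) \<times> (nat \<Rightarrow> nat)) set" where
  "transitive_pairs n k = {(f, g). f permutes {1..n} \<and> g permutes {1..n} \<and> transitive_on {1..n} {f, g} \<and>
     card (cyc {1..n} f) + card (cyc {1..n} g) = k}"

text \<open>A pair is recorded by its product \<open>\<gamma>\<close> and its first factor, the
  second being \<open>inv' f \<circ> \<gamma>\<close>. The long cycle with \<open>k = n + 1\<close>
  gives the geodesic permutations, \<open>annulus_perm r s\<close> with \<open>n = k = r + s\<close>
  gives \<open>S_NC r s\<close>.\<close>

definition factorizations :: "nat \<Rightarrow> nat \<Rightarrow> (nat \<Rightarrow> nat) \<Rightarrow> (nat \<Rightarrow> nat) set" where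
  "factorizations n k \<gamma> = {f. f permutes {1..n} \<and> transitive_on {1..n} {f, \<gamma>} \<and>
     card (cyc {1..n} f) + card (cyc {1..n} (inv' f \<circ> \<gamma>)) = k}"

lemma finite_transitive_pairs: "finite (transitive_pairs n k)"
  by (rule finite_subset[of _ "{f. f permutes {1..n}} \<times> {f. f permutes {1..n}}"])
    (auto simp: transitive_pairs_def finite_permutations)

lemma finite_factorizations: "finite (factorizations n k \<gamma>)"
  by (rule finite_subset[of _ "{f. f permutes {1..n}}"]) (auto simp: factorizations_def finite_permutations)

text \<open>Either of \<open>g\<close> and \<open>f \<circ> g\<close> is recovered from the other
  with the help of \<open>f\<close>, so the two families have the same orbits.\<close>

lemma transitive_pair_product:
  fixes f g :: "nat \<Rightarrow> nat"
  assumes "f permutes {1..n}" "g permutes {1..n}"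
  shows "transitive_on {1..n} {f, f \<circ> g} \<longleftrightarrow> transitive_on {1..n} {f, g}"
proof -
  have fg: "f \<circ> g permutes {1..n}" using permutes_compose[OF assms(2,1)] .
  have ps: "permset {1..n} {f, f \<circ> g}" using assms fg by simp
  have "conn {f, f \<circ> g} = conn {f, g}"
  proof
    show "conn {f, f \<circ> g} \<subseteq> conn {f, g}"
    proof (rule conn_subset)
      fix h x assume h: "h \<in> {f, f \<circ> g}"
      have "(x, (f \<circ> g) x) \<in> conn {f, g}"
        using conn_trans[OF conn_step[of g "{f, g}" x] conn_step[of f "{f, g}" "g x"]] by simp
      then show "(x, h x) \<in> conn {f, g}" using h conn_step[of f "{f, g}" x] by auto
    qed
    show "conn {f, g} \<subseteq> conn {f, f \<circ> g}"
    proof (rule conn_subset)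
      fix h x assume h: "h \<in> {f, g}"
      have "inv' f ((f \<circ> g) x) = g x" using permutes_inverses(2)[OF assms(1)] by simp
      then have "((f \<circ> g) x, g x) \<in> conn {f, f \<circ> g}"
        using conn_inv_step[OF ps, of f "(f \<circ> g) x"] by simp
      then have "(x, g x) \<in> conn {f, f \<circ> g}"
        using conn_trans[OF conn_step[of "f \<circ> g" "{f, f \<circ> g}" x]] by simp
      then show "(x, h x) \<in> conn {f, f \<circ> g}" using h conn_step[of f "{f, f \<circ> g}" x] by auto
    qed
  qed
  then show ?thesis by (simp add: transitive_on_def)
qed

lemma sum_pairs_factorizations:
  "(\<Sum>(f, g)\<in>transitive_pairs n k. F f) =
    (\<Sum>\<gamma> | \<gamma> permutes {1..n}. \<Sum>f\<in>factorizations n k \<gamma>. F f)"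
proof -
  have "(\<Sum>\<gamma> | \<gamma> permutes {1..n}. \<Sum>f\<in>factorizations n k \<gamma>. F f) =
    (\<Sum>(\<gamma>, f)\<in>Sigma {\<gamma>. \<gamma> permutes {1..n}} (factorizations n k). F f)"
    by (rule sum.Sigma) (auto simp: finite_factorizations finite_permutations)
  also have "\<dots> = (\<Sum>(f, g)\<in>transitive_pairs n k. F f)"
  proof (rule sum.reindex_bij_witness[where i = "\<lambda>(f, g). (f \<circ> g, f)" and j = "\<lambda>(\<gamma>, f). (f, inv' f \<circ> \<gamma>)"])
    fix a assume "a \<in> Sigma {\<gamma>. \<gamma> permutes {1..n}} (factorizations n k)"
    then obtain \<gamma> f where a: "a = (\<gamma>, f)" "\<gamma> permutes {1..n}" "f permutes {1..n}"
      "transitive_on {1..n} {f, \<gamma>}" "card (cyc {1..n} f) + card (cyc {1..n} (inv' f \<circ> \<gamma>)) = k"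
      by (auto simp: factorizations_def)
    have e: "f \<circ> (inv' f \<circ> \<gamma>) = \<gamma>" using permutes_inv_o(1)[OF a(3)] by (simp flip: comp_assoc)
    have p: "inv' f \<circ> \<gamma> permutes {1..n}" using permutes_compose[OF a(2) permutes_inv[OF a(3)]] .
    show "(case case a of (\<gamma>, f) \<Rightarrow> (f, inv' f \<circ> \<gamma>) of (f, g) \<Rightarrow> (f \<circ> g, f)) = a"
      using a(1) e by simp
    show "(case a of (\<gamma>, f) \<Rightarrow> (f, inv' f \<circ> \<gamma>)) \<in> transitive_pairs n k"
      using a p transitive_pair_product[OF a(3) p] e by (simp add: transitive_pairs_def)
    show "(case case a of (\<gamma>, f) \<Rightarrow> (f, inv' f \<circ> \<gamma>) of (f, g) \<Rightarrow> F f) = (case a of (\<gamma>, f) \<Rightarrow> F f)"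
      using a(1) by simp
  next
    fix b assume "b \<in> transitive_pairs n k"
    then obtain f g where b: "b = (f, g)" "f permutes {1..n}" "g permutes {1..n}"
      "transitive_on {1..n} {f, g}" "card (cyc {1..n} f) + card (cyc {1..n} g) = k"
      by (auto simp: transitive_pairs_def)
    have e: "inv' f \<circ> (f \<circ> g) = g" using permutes_inv_o(2)[OF b(2)] by (simp flip: comp_assoc)
    show "(case case b of (f, g) \<Rightarrow> (f \<circ> g, f) of (\<gamma>, f) \<Rightarrow> (f, inv' f \<circ> \<gamma>)) = b"
      using b(1) e by simp
    show "(case b of (f, g) \<Rightarrow> (f \<circ> g, f)) \<in> Sigma {\<gamma>. \<gamma> permutes {1..n}} (factorizations n k)"
      using b e permutes_compose[OF b(3,2)] transitive_pair_product[OF b(2,3)]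
      by (simp add: factorizations_def)
  qed
  finally show ?thesis by simp
qed

text \<open>The genus inequality for a single orbit. For \<open>k = n + 1\<close> it leaves one
  cycle for \<open>\<gamma>\<close>; for \<open>k = n\<close> it leaves at most two, and parity then
  demands exactly two.\<close>

lemma factorization_cycles:
  assumes "1 \<le> n" "f \<in> factorizations n k \<gamma>" "\<gamma> permutes {1..n}"
  shows "k + card (cyc {1..n} \<gamma>) \<le> n + 2" "even (k + card (cyc {1..n} \<gamma>) + n)"
proof -
  let ?g = "inv' f \<circ> \<gamma>"
  have f: "f permutes {1..n}" "transitive_on {1..n} {f, \<gamma>}" "card (cyc {1..n} f) + card (cyc {1..n} ?g) = k"
    using assms(2) by (auto simp: factorizations_def)
  have e: "f \<circ> ?g = \<gamma>" using permutes_inv_o(1)[OF f(1)] by (simp flip: comp_assoc)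
  have g: "?g permutes {1..n}" using permutes_compose[OF assms(3) permutes_inv[OF f(1)]] .
  have "transitive_on {1..n} {f, ?g}" using transitive_pair_product[OF f(1) g] e f(2) by simp
  then have "card (comps {1..n} {f, ?g}) = 1"
    using card_comps_transitive[of "{1..n}" "{f, ?g}"] f(1) g assms(1) by simp
  then show "k + card (cyc {1..n} \<gamma>) \<le> n + 2" "even (k + card (cyc {1..n} \<gamma>) + n)"
    using genus_bound[OF _ f(1) g] unfolding e f(3) by simp_all
qed

lemma wt_conj:
  assumes "finite X" "\<tau> permutes X" "\<alpha> permutes X"
  shows "wt u X (\<tau> \<circ> \<alpha> \<circ> inv' \<tau>) = wt u X \<alpha>"
proof -
  have "inj_on (\<lambda>V. \<tau> ` V) (cyc X \<alpha>)"
    using inj_image_eq_iff[OF permutes_inj[OF assms(2)]] by (auto simp: inj_on_def)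
  moreover have "card (\<tau> ` V) = card V" for V
    by (rule card_image) (use permutes_inj[OF assms(2)] in \<open>auto simp: inj_on_def dest: injD\<close>)
  ultimately show ?thesis
    unfolding wt_def cyc_conj[OF assms] by (simp add: prod.reindex)
qed

lemma conj_factorization:
  assumes t: "\<tau> permutes {1..n}" and f: "f \<in> factorizations n k \<gamma>" and g: "\<gamma> permutes {1..n}"
  shows "\<tau> \<circ> f \<circ> inv' \<tau> \<in> factorizations n k (\<tau> \<circ> \<gamma> \<circ> inv' \<tau>)"
proof -
  let ?X = "{1..n}" and ?c = "\<lambda>h. \<tau> \<circ> h \<circ> inv' \<tau>"
  have f': "f permutes ?X" "transitive_on ?X {f, \<gamma>}" "card (cyc ?X f) + card (cyc ?X (inv' f \<circ> \<gamma>)) = k"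
    using f by (auto simp: factorizations_def)
  have perm: "?c h permutes ?X" if "h permutes ?X" for h
    using permutes_compose[OF permutes_inv[OF t] permutes_compose[OF that t]] .
  have it: "inv' \<tau> \<circ> \<tau> = id" using permutes_inv_o(2)[OF t] .
  have cc: "?c a \<circ> ?c b = ?c (a \<circ> b)" for a b
    using permutes_inverses(2)[OF t] by (simp add: fun_eq_iff)
  have "inv' (?c f) = ?c (inv' f)"
  proof (rule inv_unique_comp)
    have "?c (f \<circ> inv' f) = id" "?c (inv' f \<circ> f) = id"
      using permutes_inv_o[OF f'(1)] permutes_inv_o(1)[OF t] by simp_all
    then show "?c f \<circ> ?c (inv' f) = id" "?c (inv' f) \<circ> ?c f = id" unfolding cc .
  qed
  then have inv: "inv' (?c f) \<circ> ?c \<gamma> = ?c (inv' f \<circ> \<gamma>)" by (simp only: cc)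
  have ig: "inv' f \<circ> \<gamma> permutes ?X" using permutes_compose[OF g permutes_inv[OF f'(1)]] .
  have tr: "(\<tau> x, \<tau> y) \<in> conn {?c f, ?c \<gamma>}" if "(x, y) \<in> conn {f, \<gamma>}" for x y
    using that
  proof (induction rule: conn_induct)
    case (step y h)
    have "(\<tau> y, ?c h (\<tau> y)) \<in> conn {?c f, ?c \<gamma>}" by (rule conn_step) (use step(2) in auto)
    moreover have "?c h (\<tau> y) = \<tau> (h y)" using permutes_inverses(2)[OF t] by simp
    ultimately show ?case using step(3) conn_trans by metis
  qed simp
  have "transitive_on ?X {?c f, ?c \<gamma>}"
    unfolding transitive_on_def
  proof (intro ballI)
    fix x y assume "x \<in> ?X" "y \<in> ?X"
    then have "inv' \<tau> x \<in> ?X" "inv' \<tau> y \<in> ?X" using permutes_in_image[OF permutes_inv[OF t]] by auto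
    then have "(inv' \<tau> x, inv' \<tau> y) \<in> conn {f, \<gamma>}" using f'(2) by (simp add: transitive_on_def)
    then show "(x, y) \<in> conn {?c f, ?c \<gamma>}" using tr permutes_inverses(1)[OF t] by metis
  qed
  then show ?thesis
    unfolding factorizations_def mem_Collect_eq inv
    using card_cyc_conj[OF _ t f'(1)] card_cyc_conj[OF _ t ig] f'(3) perm[OF f'(1)] by simp
qed

text \<open>Simultaneous conjugation preserves transitivity, cycle counts and weights, so the inner
  sum depends only on the conjugacy class of \<open>\<gamma>\<close>.\<close>

lemma sum_factorizations_conj:
  assumes t: "\<tau> permutes {1..n}" and g: "\<gamma> permutes {1..n}"
  shows "(\<Sum>f\<in>factorizations n k (\<tau> \<circ> \<gamma> \<circ> inv' \<tau>). wt u {1..n} f) = (\<Sum>f\<in>factorizations n k \<gamma>. wt u {1..n} f)"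
proof (rule sum.reindex_bij_witness[where i = "\<lambda>f. \<tau> \<circ> f \<circ> inv' \<tau>" and j = "\<lambda>f. inv' \<tau> \<circ> f \<circ> \<tau>"])
  have it: "inv' \<tau> permutes {1..n}" using permutes_inv[OF t] .
  have ii: "inv' (inv' \<tau>) = \<tau>" using permutes_inv_inv[OF t] .
  have back1: "inv' \<tau> \<circ> (\<tau> \<circ> h \<circ> inv' \<tau>) \<circ> \<tau> = h" for h
    using permutes_inverses[OF t] by (simp add: fun_eq_iff)
  have back2: "\<tau> \<circ> (inv' \<tau> \<circ> h \<circ> \<tau>) \<circ> inv' \<tau> = h" for h
    using permutes_inverses[OF t] by (simp add: fun_eq_iff)
  have cg: "\<tau> \<circ> \<gamma> \<circ> inv' \<tau> permutes {1..n}" using permutes_compose[OF it permutes_compose[OF g t]] .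
  fix f
  show "inv' \<tau> \<circ> (\<tau> \<circ> f \<circ> inv' \<tau>) \<circ> \<tau> = f" by (rule back1)
  show "\<tau> \<circ> (inv' \<tau> \<circ> f \<circ> \<tau>) \<circ> inv' \<tau> = f" by (rule back2)
  {
    assume f: "f \<in> factorizations n k (\<tau> \<circ> \<gamma> \<circ> inv' \<tau>)"
    show "inv' \<tau> \<circ> f \<circ> \<tau> \<in> factorizations n k \<gamma>"
      using conj_factorization[OF it f cg] unfolding ii back1 .
    have "f permutes {1..n}" using f by (simp add: factorizations_def)
    then show "wt u {1..n} (inv' \<tau> \<circ> f \<circ> \<tau>) = wt u {1..n} f"
      using wt_conj[OF _ it, of f u] unfolding ii by simp
  next
    assume "f \<in> factorizations n k \<gamma>"
    then show "\<tau> \<circ> f \<circ> inv' \<tau> \<in> factorizations n k (\<tau> \<circ> \<gamma> \<circ> inv' \<tau>)"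
      by (rule conj_factorization[OF t _ g])
  }
qed

lemma cyclic_perms_iff:
  assumes "finite X" "X \<noteq> {}" "f permutes X"
  shows "f \<in> cyclic_perms X \<longleftrightarrow> card (cyc X f) = 1"
  using card_comps_transitive[of X "{f}"] assms by (simp add: cyclic_perms_def cyc_comps)

lemma long_cycle_conj:
  assumes "\<gamma> \<in> cyclic_perms {1..n}"
  shows "\<exists>\<tau>. \<tau> permutes {1..n} \<and> \<gamma> = \<tau> \<circ> long_cycle n \<circ> inv' \<tau>"
proof -
  have "long_cycle n \<in> cyclic_perms {1..n}"
    using long_cycle_permutes transitive_long_cycle by (simp add: cyclic_perms_def)
  moreover have "id \<in> cyclic_perms {}" by (simp add: cyclic_perms_def transitive_on_def)
  ultimately show ?thesis
    using two_cycles_conj[of "{1..n}" "{1..n}" "{}" "{1..n}" "{}" "long_cycle n" id \<gamma> id] assms by simp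
qed

lemma transitive_on_mono:
  assumes "transitive_on X M" "M \<subseteq> N"
  shows "transitive_on X N"
  using assms(1) conn_mono[OF assms(2)] by (auto simp: transitive_on_def)

lemma factorizations_long_cycle:
  "factorizations n (n + 1) (long_cycle n) = {\<alpha>. geodesic n \<alpha>}"
  using transitive_on_mono[OF transitive_long_cycle, of n "{f, long_cycle n}" for f]
  by (auto simp: factorizations_def geodesic_def)

text \<open>The product of such a pair is a long cycle. There are \<open>(n - 1)!\<close> of them,
  all conjugate, and for the standard one the first factors correspond to non-crossing
  partitions.\<close>

lemma sum_planar:
  fixes u :: "nat \<Rightarrow> complex"
  assumes n: "1 \<le> n"
  shows "(\<Sum>(f, g)\<in>transitive_pairs n (n + 1). wt u {1..n} f) =
    fact (n - 1) * (\<Sum>\<pi>\<in>NC n. \<Prod>V\<in>\<pi>. u (card V))"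
proof -
  let ?X = "{1..n}"
  let ?h = "\<lambda>\<gamma>. \<Sum>f\<in>factorizations n (n + 1) \<gamma>. wt u ?X f"
  have ne: "?X \<noteq> {}" using n by simp
  have "(\<Sum>(f, g)\<in>transitive_pairs n (n + 1). wt u ?X f) = (\<Sum>\<gamma> | \<gamma> permutes ?X. ?h \<gamma>)"
    by (rule sum_pairs_factorizations)
  also have "\<dots> = (\<Sum>\<gamma>\<in>cyclic_perms ?X. ?h \<gamma>)"
  proof (rule sum.mono_neutral_right)
    show "cyclic_perms ?X \<subseteq> {\<gamma>. \<gamma> permutes ?X}" by (auto simp: cyclic_perms_def)
    show "\<forall>\<gamma>\<in>{\<gamma>. \<gamma> permutes ?X} - cyclic_perms ?X. ?h \<gamma> = 0"
    proof
      fix \<gamma> assume g: "\<gamma> \<in> {\<gamma>. \<gamma> permutes ?X} - cyclic_perms ?X"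
      then have "card (cyc ?X \<gamma>) \<noteq> 1" using cyclic_perms_iff[OF _ ne] by auto
      moreover have "card (cyc ?X \<gamma>) \<noteq> 0" using ne by (simp add: cyc_def)
      ultimately have "f \<notin> factorizations n (n + 1) \<gamma>" for f
        using factorization_cycles(1)[OF n, of f "n + 1" \<gamma>] g by force
      then have "factorizations n (n + 1) \<gamma> = {}" by blast
      then show "?h \<gamma> = 0" by simp
    qed
  qed (simp add: finite_permutations)
  also have "\<dots> = (\<Sum>\<gamma>\<in>cyclic_perms ?X. ?h (long_cycle n))"
  proof (rule sum.cong[OF refl])
    fix \<gamma> assume "\<gamma> \<in> cyclic_perms ?X"
    then obtain \<tau> where "\<tau> permutes ?X" "\<gamma> = \<tau> \<circ> long_cycle n \<circ> inv' \<tau>" using long_cycle_conj by blast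
    then show "?h \<gamma> = ?h (long_cycle n)" using sum_factorizations_conj[OF _ long_cycle_permutes] by simp
  qed
  also have "\<dots> = fact (n - 1) * ?h (long_cycle n)"
    using card_cyclic_perms[OF _ ne] by simp
  also have "?h (long_cycle n) = (\<Sum>\<pi>\<in>NC n. \<Prod>V\<in>\<pi>. u (card V))"
    unfolding factorizations_long_cycle wt_def
    by (rule sum.reindex_bij_betw[OF bij_betw_geodesic_NC[OF n]])
  finally show ?thesis .
qed

lemma factorizations_annulus: "factorizations (r + s) (r + s) (annulus_perm r s) = S_NC r s"
proof -
  have "f \<in> factorizations (r + s) (r + s) (annulus_perm r s) \<longleftrightarrow> f \<in> S_NC r s" for f
    unfolding factorizations_def S_NC_def num_cycles_def cycle_partition_def cyc_def mem_Collect_eq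
    using transitive_generate[OF _ annulus_perm_permutes, of f r s] by blast
  then show ?thesis by blast
qed

lemma cyc_eq_singleton:
  assumes "finite X" "\<gamma> permutes X" "x \<in> X" "orbit \<gamma> x = X"
  shows "cyc X \<gamma> = {X}"
proof -
  have "X \<in> cyc X \<gamma>" unfolding cyc_def by (rule image_eqI[of _ _ x]) (simp_all add: assms)
  then have "orbit \<gamma> y = X" if "y \<in> X" for y using cyc_blockD(1)[OF assms(1,2)] that by simp
  then have "cyc X \<gamma> = (\<lambda>_. X) ` X" unfolding cyc_def by (rule image_cong[OF refl])
  then show ?thesis using assms(3) by auto
qed

text \<open>The set \<open>A\<close> is the cycle of \<open>\<gamma>\<close> containing \<open>x\<close>.\<close>

lemma sum_two_cycle_perms:
  fixes h :: "('a \<Rightarrow> 'a) \<Rightarrow> complex"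
  assumes X: "finite X" "x \<in> X"
  shows "(\<Sum>\<gamma> | \<gamma> permutes X \<and> card (cyc X \<gamma>) = 2. h \<gamma>) =
    (\<Sum>A | x \<in> A \<and> A \<subset> X. \<Sum>f\<in>cyclic_perms A. \<Sum>g\<in>cyclic_perms (X - A). h (f \<circ> g))"
proof -
  let ?T = "{\<gamma>. \<gamma> permutes X \<and> card (cyc X \<gamma>) = 2}"
  let ?S = "{A. x \<in> A \<and> A \<subset> X}"
  have fT: "finite ?T" using finite_permutations[OF X(1)] by (rule finite_subset[rotated]) auto
  have fS: "finite ?S" using X(1) by (rule finite_subset[rotated, OF finite_Pow_iff[THEN iffD2]]) auto
  have orb: "orbit \<gamma> x \<in> ?S" if "\<gamma> \<in> ?T" for \<gamma>
  proof -
    have g: "\<gamma> permutes X" "card (cyc X \<gamma>) = 2" using that by auto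
    have "orbit \<gamma> x \<noteq> X"
    proof
      assume e: "orbit \<gamma> x = X"
      have "cyc X \<gamma> = {X}" by (rule cyc_eq_singleton[OF X(1) g(1) X(2) e])
      then show False using g(2) by simp
    qed
    then show ?thesis using orbit_subset_perm[OF g(1) X(2)] orbit_self[OF X(1) g(1)] by auto
  qed
  have "(\<Sum>\<gamma>\<in>?T. h \<gamma>) = (\<Sum>A\<in>?S. \<Sum>\<gamma> | \<gamma> \<in> ?T \<and> orbit \<gamma> x = A. h \<gamma>)"
    by (rule sum.group[symmetric, OF fT fS]) (use orb in auto)
  also have "\<dots> = (\<Sum>A\<in>?S. \<Sum>f\<in>cyclic_perms A. \<Sum>g\<in>cyclic_perms (X - A). h (f \<circ> g))"
  proof (rule sum.cong[OF refl])
    fix A assume "A \<in> ?S"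
    then have A: "x \<in> A" "A \<subseteq> X" "A \<noteq> {}" "X - A \<noteq> {}" by auto
    have fin: "finite A" "finite (X - A)" using A X finite_subset by auto
    have dis: "A \<inter> (X - A) = {}" and un: "A \<union> (X - A) = X" using A by auto
    let ?Q = "{\<gamma>. \<gamma> permutes X \<and> \<gamma> ` A = A}"
    have fQ: "finite ?Q" using finite_permutations[OF X(1)] by (rule finite_subset[rotated]) auto
    have sub: "{\<gamma>. \<gamma> \<in> ?T \<and> orbit \<gamma> x = A} \<subseteq> ?Q"
    proof
      fix \<gamma> assume g: "\<gamma> \<in> {\<gamma>. \<gamma> \<in> ?T \<and> orbit \<gamma> x = A}"
      have "\<gamma> ` A = A"
      proof (rule card_subset_eq[OF fin(1)])
        show "\<gamma> ` A \<subseteq> A" using g by (auto intro: orbit.step)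
        show "card (\<gamma> ` A) = card A"
          by (rule card_image) (use g permutes_inj in \<open>auto simp: inj_on_def dest: injD\<close>)
      qed
      then show "\<gamma> \<in> ?Q" using g by simp
    qed
    have "(\<Sum>\<gamma> | \<gamma> \<in> ?T \<and> orbit \<gamma> x = A. h \<gamma>) =
      (\<Sum>\<gamma>\<in>?Q. if \<gamma> \<in> {\<gamma>. \<gamma> \<in> ?T \<and> orbit \<gamma> x = A} then h \<gamma> else 0)"
    proof -
      have "{\<gamma>. \<gamma> \<in> ?T \<and> orbit \<gamma> x = A} = {\<gamma> \<in> ?Q. \<gamma> \<in> {\<gamma>. \<gamma> \<in> ?T \<and> orbit \<gamma> x = A}}"
        using sub by blast
      then show ?thesis using sum.inter_filter[OF fQ] by (rule ssubst)
    qed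
    also have "\<dots> = (\<Sum>f | f permutes A. \<Sum>g | g permutes X - A.
        if f \<circ> g \<in> {\<gamma>. \<gamma> \<in> ?T \<and> orbit \<gamma> x = A} then h (f \<circ> g) else 0)"
      by (rule sum_permutes_invariant[OF X(1) A(2)])
    also have "\<dots> = (\<Sum>f | f permutes A. \<Sum>g | g permutes X - A.
        if f \<in> cyclic_perms A then (if g \<in> cyclic_perms (X - A) then h (f \<circ> g) else 0) else 0)"
    proof (intro sum.cong refl)
      fix f g assume "f \<in> {f. f permutes A}" "g \<in> {g. g permutes X - A}"
      then have p: "f permutes A" "g permutes X - A" by auto
      have fg: "f \<circ> g permutes X" using permutes_Un_comp[OF p] un by simp
      have "cyc X (f \<circ> g) = cyc A f \<union> cyc (X - A) g"
        using cyc_comp_disjoint(1)[OF p dis] un by simp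
      then have c: "card (cyc X (f \<circ> g)) = card (cyc A f) + card (cyc (X - A) g)"
        using card_Un_disjoint[OF _ _ cyc_comp_disjoint(2)[OF p dis]] fin by simp
      have o: "orbit (f \<circ> g) x = orbit f x" by (rule orbit_comp_disjoint(1)[OF p dis A(1)])
      have i1: "f \<in> cyclic_perms A \<longleftrightarrow> card (cyc A f) = 1" by (rule cyclic_perms_iff[OF fin(1) A(3) p(1)])
      have i2: "g \<in> cyclic_perms (X - A) \<longleftrightarrow> card (cyc (X - A) g) = 1" by (rule cyclic_perms_iff[OF fin(2) A(4) p(2)])
      have i3: "orbit f x = A \<longleftrightarrow> card (cyc A f) = 1"
      proof
        assume e: "orbit f x = A"
        have "cyc A f = {A}" by (rule cyc_eq_singleton[OF fin(1) p(1) A(1) e])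
        then show "card (cyc A f) = 1" by simp
      next
        assume "card (cyc A f) = 1"
        then have "cyc A f = {A}" using i1 cyc_transitive[OF fin(1) A(3) p(1)] by (auto simp: cyclic_perms_def)
        then show "orbit f x = A" using A(1) by (auto simp: cyc_def)
      qed
      have "f \<circ> g \<in> {\<gamma>. \<gamma> \<in> ?T \<and> orbit \<gamma> x = A} \<longleftrightarrow> f \<in> cyclic_perms A \<and> g \<in> cyclic_perms (X - A)"
        unfolding i1 i2 mem_Collect_eq o i3 c using fg by auto
      then show "(if f \<circ> g \<in> {\<gamma>. \<gamma> \<in> ?T \<and> orbit \<gamma> x = A} then h (f \<circ> g) else 0) =
        (if f \<in> cyclic_perms A then (if g \<in> cyclic_perms (X - A) then h (f \<circ> g) else 0) else 0)"
        by simp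
    qed
    also have "\<dots> = (\<Sum>f | f permutes A. if f \<in> cyclic_perms A then
        (\<Sum>g | g permutes X - A. if g \<in> cyclic_perms (X - A) then h (f \<circ> g) else 0) else 0)"
      by (intro sum.cong refl) simp
    also have "\<dots> = (\<Sum>f\<in>cyclic_perms A. \<Sum>g\<in>cyclic_perms (X - A). h (f \<circ> g))"
    proof -
      have i: "{f. f permutes B} \<inter> cyclic_perms B = cyclic_perms B" for B :: "'a set"
        by (auto simp: cyclic_perms_def)
      show ?thesis
        by (simp only: sum.inter_restrict[OF finite_permutations[OF fin(1)], symmetric]
          sum.inter_restrict[OF finite_permutations[OF fin(2)], symmetric] i)
    qed
    finally show "(\<Sum>\<gamma> | \<gamma> \<in> ?T \<and> orbit \<gamma> x = A. h \<gamma>) =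
      (\<Sum>f\<in>cyclic_perms A. \<Sum>g\<in>cyclic_perms (X - A). h (f \<circ> g))" .
  qed
  finally show ?thesis .
qed

subsection \<open>The genus expansion\<close>

text \<open>The product has exactly two cycles. Grouping by the cycle \<open>A\<close> through 1
  reduces each product to an annulus permutation of the same cycle lengths.\<close>

lemma sum_annular:
  fixes u :: "nat \<Rightarrow> complex"
  assumes n: "1 \<le> n"
  shows "(\<Sum>(f, g)\<in>transitive_pairs n n. wt u {1..n} f) =
    fact n / 2 * (\<Sum>(r, s)\<in>{(r, s). r \<ge> 1 \<and> s \<ge> 1 \<and> r + s = n}.
      \<Sum>\<alpha>\<in>S_NC r s. wt u {1..n} \<alpha> / (of_nat r * of_nat s))"
proof -
  let ?X = "{1..n}"
  let ?h = "\<lambda>\<gamma>. \<Sum>f\<in>factorizations n n \<gamma>. wt u ?X f"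
  define H where "H r = ?h (annulus_perm r (n - r))" for r
  let ?RS = "{(r, s). r \<ge> 1 \<and> s \<ge> 1 \<and> r + s = n}"
  have ne: "?X \<noteq> {}" and one: "1 \<in> ?X" using n by auto
  have "(\<Sum>(f, g)\<in>transitive_pairs n n. wt u ?X f) = (\<Sum>\<gamma> | \<gamma> permutes ?X. ?h \<gamma>)"
    by (rule sum_pairs_factorizations)
  also have "\<dots> = (\<Sum>\<gamma> | \<gamma> permutes ?X \<and> card (cyc ?X \<gamma>) = 2. ?h \<gamma>)"
  proof (rule sum.mono_neutral_right)
    show "\<forall>\<gamma>\<in>{\<gamma>. \<gamma> permutes ?X} - {\<gamma>. \<gamma> permutes ?X \<and> card (cyc ?X \<gamma>) = 2}. ?h \<gamma> = 0"
    proof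
      fix \<gamma> assume g: "\<gamma> \<in> {\<gamma>. \<gamma> permutes ?X} - {\<gamma>. \<gamma> permutes ?X \<and> card (cyc ?X \<gamma>) = 2}"
      have "f \<notin> factorizations n n \<gamma>" for f
      proof
        assume f: "f \<in> factorizations n n \<gamma>"
        have p: "\<gamma> permutes ?X" "card (cyc ?X \<gamma>) \<noteq> 2" using g by auto
        have le: "card (cyc ?X \<gamma>) \<le> 2" using factorization_cycles(1)[OF n f p(1)] by simp
        \<comment> \<open>For \<open>k = n\<close> the parity condition concerns the number of
          cycles plus \<open>2 n\<close>, so the number of cycles itself is even.\<close>
        have ev: "even (card (cyc ?X \<gamma>))" using factorization_cycles(2)[OF n f p(1)] unfolding even_add by blast
        have "card (cyc ?X \<gamma>) \<noteq> 0" using ne by (simp add: cyc_def)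
        then have "card (cyc ?X \<gamma>) = 1" using le p(2) by linarith
        then show False using ev by simp
      qed
      then have "factorizations n n \<gamma> = {}" by blast
      then show "?h \<gamma> = 0" by simp
    qed
  qed (auto simp: finite_permutations)
  also have "\<dots> = (\<Sum>A | 1 \<in> A \<and> A \<subset> ?X. \<Sum>f\<in>cyclic_perms A. \<Sum>g\<in>cyclic_perms (?X - A). ?h (f \<circ> g))"
    by (rule sum_two_cycle_perms) (use one in auto)
  also have "\<dots> = (\<Sum>A | 1 \<in> A \<and> A \<subset> ?X. fact (card A - 1) * H (card A) * (fact (card (?X - A)) * (1 / of_nat (card (?X - A)))))"
  proof (rule sum.cong[OF refl])
    fix A assume "A \<in> {A. 1 \<in> A \<and> A \<subset> ?X}"
    then have A: "A \<subseteq> ?X" "A \<noteq> {}" "?X - A \<noteq> {}" by auto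
    have fin: "finite A" "finite (?X - A)" using A finite_subset by auto
    have "?h (f \<circ> g) = H (card A)" if fg: "f \<in> cyclic_perms A" "g \<in> cyclic_perms (?X - A)" for f g
    proof -
      obtain \<tau> where "\<tau> permutes ?X" "annulus_perm (card A) (n - card A) = \<tau> \<circ> (f \<circ> g) \<circ> inv' \<tau>"
        using annulus_perm_conj[OF fin(1) A(1) fg] by blast
      moreover have "f \<circ> g permutes ?X"
        using permutes_Un_comp[of f A g "?X - A"] fg A(1) by (simp add: cyclic_perms_def Un_absorb1)
      ultimately show ?thesis
        unfolding H_def using sum_factorizations_conj[of \<tau> n "f \<circ> g" u n] by simp
    qed
    then have "(\<Sum>f\<in>cyclic_perms A. \<Sum>g\<in>cyclic_perms (?X - A). ?h (f \<circ> g)) =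
        of_nat (card (cyclic_perms A)) * (of_nat (card (cyclic_perms (?X - A))) * H (card A))"
      by simp
    also have "\<dots> = fact (card A - 1) * (fact (card (?X - A) - 1) * H (card A))"
      unfolding card_cyclic_perms[OF fin(1) A(2)] card_cyclic_perms[OF fin(2) A(3)] of_nat_fact ..
    \<comment> \<open>Written with a full factorial to fit \<open>sum_subsets_containing\<close>,
      with \<open>1 / j\<close> in the role of \<open>\<tau> j\<close>.\<close>
    also have "fact (card (?X - A) - 1) = fact (card (?X - A)) * (1 / of_nat (card (?X - A)) :: complex)"
    proof -
      have "card (?X - A) \<noteq> 0" using fin A(3) by simp
      then show ?thesis by (cases "card (?X - A)") (simp_all del: of_nat_Suc)
    qed
    finally show "(\<Sum>f\<in>cyclic_perms A. \<Sum>g\<in>cyclic_perms (?X - A). ?h (f \<circ> g)) =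
      fact (card A - 1) * H (card A) * (fact (card (?X - A)) * (1 / of_nat (card (?X - A))))"
      by (simp only: ac_simps)
  qed
  also have "\<dots> = (\<Sum>A | 1 \<in> A \<and> A \<subseteq> ?X. fact (card A - 1) * H (card A) * (fact (card (?X - A)) * (1 / of_nat (card (?X - A)))))"
    \<comment> \<open>the term \<open>A = {1..n}\<close> vanishes because \<open>1 / 0 = 0\<close>\<close>
    by (rule sum.mono_neutral_left) auto
  also have "\<dots> = fact (card ?X - 1) * (\<Sum>j=1..card ?X. H j * (1 / of_nat (card ?X - j)))"
    by (rule sum_subsets_containing) (use one in auto)
  also have "\<dots> = fact (n - 1) * (\<Sum>j=1..n. H j * (1 / of_nat (n - j)))" by simp
  also have "(\<Sum>j=1..n. H j * (1 / of_nat (n - j))) = (\<Sum>j\<in>{1..<n}. H j * (1 / of_nat (n - j)))"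
    by (rule sum.mono_neutral_right) auto
  \<comment> \<open>Fixing the cycle through 1 made the sum asymmetric. As
    \<open>H (n - j) = H j\<close>, the factor \<open>1 / (n - j)\<close> may be averaged with
    \<open>1 / j\<close>, which gives \<open>n / (2 j (n - j))\<close>.\<close>
  also have "\<dots> = (\<Sum>j\<in>{1..<n}. H j * (of_nat n / (2 * (of_nat j * of_nat (n - j)))))"
  proof -
    have sym: "H (n - j) = H j" if j: "j \<in> {1..<n}" for j
    proof -
      obtain \<tau> where \<tau>: "\<tau> permutes {1..j + (n - j)}"
        "annulus_perm (n - j) j = \<tau> \<circ> annulus_perm j (n - j) \<circ> inv' \<tau>"
        using annulus_perm_swap_conj by blast
      have "j + (n - j) = n" "n - (n - j) = j" using j by auto
      then show ?thesis
        unfolding H_def using \<tau> sum_factorizations_conj[of \<tau> n "annulus_perm j (n - j)"]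
          annulus_perm_permutes[of j "n - j"] by simp
    qed
    let ?S = "\<Sum>j\<in>{1..<n}. H j * (1 / of_nat (n - j))"
    have "?S = (\<Sum>j\<in>{1..<n}. H (n - j) * (1 / of_nat j))"
      by (rule sum.reindex_bij_witness[where i = "\<lambda>j. n - j" and j = "\<lambda>j. n - j"]) auto
    also have "\<dots> = (\<Sum>j\<in>{1..<n}. H j * (1 / of_nat j))"
      by (rule sum.cong[OF refl]) (simp add: sym)
    finally have "2 * ?S = (\<Sum>j\<in>{1..<n}. H j * (1 / of_nat (n - j)) + H j * (1 / of_nat j))"
      by (simp add: sum.distrib)
    also have "\<dots> = (\<Sum>j\<in>{1..<n}. 2 * (H j * (of_nat n / (2 * (of_nat j * of_nat (n - j))))))"
    proof (rule sum.cong[OF refl])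
      fix j assume j: "j \<in> {1..<n}"
      define a b :: complex where "a = of_nat j" and "b = of_nat (n - j)"
      have "of_nat n = a + b" using j unfolding a_def b_def by (simp flip: of_nat_add)
      moreover have "a \<noteq> 0" "b \<noteq> 0" using j by (auto simp: a_def b_def)
      ultimately show "H j * (1 / of_nat (n - j)) + H j * (1 / of_nat j) =
          2 * (H j * (of_nat n / (2 * (of_nat j * of_nat (n - j)))))"
        unfolding a_def[symmetric] b_def[symmetric] by (simp add: field_simps)
    qed
    also have "\<dots> = 2 * (\<Sum>j\<in>{1..<n}. H j * (of_nat n / (2 * (of_nat j * of_nat (n - j)))))"
      by (rule sum_distrib_left[symmetric])
    finally show ?thesis unfolding mult_cancel_left by simp
  qed
  also have "\<dots> = (\<Sum>(r, s)\<in>?RS. \<Sum>\<alpha>\<in>S_NC r s. of_nat n / 2 * (wt u ?X \<alpha> / (of_nat r * of_nat s)))"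
  proof (rule sum.reindex_bij_witness[where i = fst and j = "\<lambda>j. (j, n - j)"])
    fix j assume j: "j \<in> {1..<n}"
    then have jn: "j + (n - j) = n" by simp
    have Hj: "H j = (\<Sum>\<alpha>\<in>S_NC j (n - j). wt u ?X \<alpha>)"
      unfolding H_def factorizations_annulus[of j "n - j", unfolded jn] ..
    show "(case (j, n - j) of (r, s) \<Rightarrow> \<Sum>\<alpha>\<in>S_NC r s. of_nat n / 2 * (wt u ?X \<alpha> / (of_nat r * of_nat s))) =
        H j * (of_nat n / (2 * (of_nat j * of_nat (n - j))))"
      unfolding case_prod_conv Hj sum_distrib_left[symmetric] sum_divide_distrib[symmetric]
      by (simp add: ac_simps)
  qed auto
  also have "fact (n - 1) * \<dots> = fact n / 2 * (\<Sum>(r, s)\<in>?RS. \<Sum>\<alpha>\<in>S_NC r s. wt u ?X \<alpha> / (of_nat r * of_nat s))"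
  proof -
    have "(\<Sum>(r, s)\<in>?RS. \<Sum>\<alpha>\<in>S_NC r s. of_nat n / 2 * (wt u ?X \<alpha> / (of_nat r * of_nat s))) =
        of_nat n / 2 * (\<Sum>(r, s)\<in>?RS. \<Sum>\<alpha>\<in>S_NC r s. wt u ?X \<alpha> / (of_nat r * of_nat s))"
      unfolding case_prod_unfold sum_distrib_left ..
    moreover have "fact n = (of_nat n * fact (n - 1) :: complex)" using n by (simp add: fact_reduce)
    ultimately show ?thesis by simp
  qed
  finally show ?thesis .
qed

text \<open>Up to sign and division by \<open>(n - 1)!\<close>, these integers are the coefficients
  of the error terms; they involve neither the degree nor the polynomial.\<close>

definition pair_count :: "nat \<Rightarrow> nat \<Rightarrow> nat set set \<Rightarrow> nat" where
  "pair_count n k \<sigma> = card {(f, g) \<in> transitive_pairs n k. cyc {1..n} f = \<sigma>}"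

lemma sum_by_partition:
  fixes u :: "nat \<Rightarrow> complex"
  shows "(\<Sum>(f, g)\<in>transitive_pairs n k. wt u {1..n} f) =
    (\<Sum>\<sigma>\<in>set_partitions n. of_nat (pair_count n k \<sigma>) * (\<Prod>V\<in>\<sigma>. u (card V)))"
proof -
  let ?T = "transitive_pairs n k" and ?c = "\<lambda>a. cyc {1..n} (fst a)"
  have "(\<Sum>(f, g)\<in>?T. wt u {1..n} f) = (\<Sum>a\<in>?T. \<Prod>V\<in>?c a. u (card V))"
    by (simp add: wt_def case_prod_unfold)
  also have "\<dots> = (\<Sum>\<sigma>\<in>set_partitions n. \<Sum>a | a \<in> ?T \<and> ?c a = \<sigma>. \<Prod>V\<in>?c a. u (card V))"
  proof (rule sum.group[symmetric, OF finite_transitive_pairs])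
    show "finite (set_partitions n)" by (simp add: set_partitions_def finitely_many_partition_on)
    show "?c ` ?T \<subseteq> set_partitions n"
      using cyc_partition[of "{1..n}"] by (auto simp: transitive_pairs_def set_partitions_def)
  qed
  also have "\<dots> = (\<Sum>\<sigma>\<in>set_partitions n. of_nat (pair_count n k \<sigma>) * (\<Prod>V\<in>\<sigma>. u (card V)))"
  proof (rule sum.cong[OF refl])
    fix \<sigma>
    have "{(f, g) \<in> ?T. cyc {1..n} f = \<sigma>} = {a. a \<in> ?T \<and> ?c a = \<sigma>}" by auto
    moreover have "(\<Sum>a | a \<in> ?T \<and> ?c a = \<sigma>. \<Prod>V\<in>?c a. u (card V)) =
        (\<Sum>a | a \<in> ?T \<and> ?c a = \<sigma>. \<Prod>V\<in>\<sigma>. u (card V))"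
      by (rule sum.cong) auto
    ultimately show "(\<Sum>a | a \<in> ?T \<and> ?c a = \<sigma>. \<Prod>V\<in>?c a. u (card V)) =
        of_nat (pair_count n k \<sigma>) * (\<Prod>V\<in>\<sigma>. u (card V))"
      by (simp add: pair_count_def)
  qed
  finally show ?thesis .
qed

lemma wt_const_mult: "finite X \<Longrightarrow> wt (\<lambda>k. c * u k) X f = c ^ card (cyc X f) * wt u X f"
  by (simp add: wt_def prod.distrib)

text \<open>Each transitive pair carries \<open>-d\<close> to its total number of cycles, and
  \<open>k\<close> is the deficit of that number from the maximum \<open>n + 1\<close>. Dividing by
  \<open>(-1)^(n - 1) (n - 1)! d^(n + 1)\<close> leaves \<open>d^-k\<close>.\<close>

lemma genus_expansion:
  fixes p :: "complex poly"
  assumes n: "1 \<le> n" "n \<le> d" and p: "degree p = d" "lead_coeff p = 1"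
  shows "root_moment p n = (\<Sum>k=0..n. (-1) ^ k / (fact (n - 1) * of_nat d ^ k) *
    (\<Sum>(f, g)\<in>transitive_pairs n (n + 1 - k). wt (ff_cumulant p) {1..n} f))"
proof -
  define D :: complex where "D = of_nat d"
  have D: "D \<noteq> 0" using n by (auto simp: D_def)
  let ?X = "{1..n}"
  let ?w = "wt (ff_cumulant p) ?X" and ?N = "\<lambda>f. card (cyc ?X f)"
  let ?T = "{(f, g). f permutes ?X \<and> g permutes ?X \<and> transitive_on ?X {f, g}}"
  let ?P = "{f. f permutes ?X}"
  have ne: "?X \<noteq> {}" using n by simp
  have fP: "finite ?P" by (simp add: finite_permutations)
  have fT: "finite ?T" by (rule finite_subset[of _ "?P \<times> ?P"]) (auto simp: finite_permutations)
  \<comment> \<open>The upper bound comes from the genus inequality, as the product has at least one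
    cycle. The lower bound 1 is weaker than the true bound 2, so \<open>k = n\<close> still appears
    here.\<close>
  have range: "?N f + ?N g \<in> (\<lambda>k. n + 1 - k) ` {0..n}" if "(f, g) \<in> ?T" for f g
  proof -
    have fg: "f permutes ?X" "g permutes ?X" "transitive_on ?X {f, g}" using that by auto
    have "card (comps ?X {f, g}) = 1" using card_comps_transitive[OF _ ne, of "{f, g}"] fg by simp
    then have "?N f + ?N g + ?N (f \<circ> g) \<le> n + 2" using genus_bound[OF _ fg(1,2)] by simp
    moreover have "?N h \<noteq> 0" for h using ne by (simp add: cyc_def)
    ultimately have "?N f + ?N g \<le> n + 1" "1 \<le> ?N f + ?N g"
      using \<open>?N (f \<circ> g) \<noteq> 0\<close> \<open>?N f \<noteq> 0\<close> by linarith+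
    then show ?thesis by (intro image_eqI[of _ _ "n + 1 - (?N f + ?N g)"]) auto
  qed
  have "(-1) ^ (n - 1) * fact (n - 1) * D ^ (n + 1) * root_moment p n =
      pair_conn (\<lambda>k. - D * ff_cumulant p k) (\<lambda>_. - D) ?X"
    using pair_conn_cumulant[OF p _ ne] n by (simp add: D_def)
  also have "\<dots> = (\<Sum>(f, g)\<in>?P \<times> ?P. if transitive_on ?X {f, g} then (- D) ^ (?N f + ?N g) * ?w f else 0)"
  proof -
    have "wt (\<lambda>_. - D) ?X g = (- D) ^ ?N g" for g
      by (simp add: wt_def)
    then show ?thesis
      unfolding pair_conn_def sum.cartesian_product[symmetric] wt_const_mult[OF finite_atLeastAtMost]
      by (intro sum.cong refl if_cong) (simp_all add: power_add)
  qed
  also have "\<dots> = (\<Sum>(f, g)\<in>?T. (- D) ^ (?N f + ?N g) * ?w f)"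
  proof -
    have "?T = {a \<in> ?P \<times> ?P. transitive_on ?X {fst a, snd a}}" by auto
    moreover have "finite (?P \<times> ?P)" using fP by simp
    ultimately show ?thesis
      by (simp only: case_prod_unfold sum.inter_filter)
  qed
  also have "\<dots> = (\<Sum>m\<in>(\<lambda>k. n + 1 - k) ` {0..n}. \<Sum>a | a \<in> ?T \<and> (case a of (f, g) \<Rightarrow> ?N f + ?N g) = m.
      case a of (f, g) \<Rightarrow> (- D) ^ (?N f + ?N g) * ?w f)"
    by (rule sum.group[symmetric, OF fT]) (use range in auto)
  also have "\<dots> = (\<Sum>k=0..n. \<Sum>a | a \<in> ?T \<and> (case a of (f, g) \<Rightarrow> ?N f + ?N g) = n + 1 - k.
      case a of (f, g) \<Rightarrow> (- D) ^ (?N f + ?N g) * ?w f)"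
    by (subst sum.reindex) (auto simp: inj_on_def)
  also have "\<dots> = (\<Sum>k=0..n. (- D) ^ (n + 1 - k) * (\<Sum>(f, g)\<in>transitive_pairs n (n + 1 - k). ?w f))"
  proof (rule sum.cong[OF refl])
    fix k
    have "{a. a \<in> ?T \<and> (case a of (f, g) \<Rightarrow> ?N f + ?N g) = n + 1 - k} = transitive_pairs n (n + 1 - k)"
      by (auto simp: transitive_pairs_def)
    then show "(\<Sum>a | a \<in> ?T \<and> (case a of (f, g) \<Rightarrow> ?N f + ?N g) = n + 1 - k.
        case a of (f, g) \<Rightarrow> (- D) ^ (?N f + ?N g) * ?w f) =
        (- D) ^ (n + 1 - k) * (\<Sum>(f, g)\<in>transitive_pairs n (n + 1 - k). ?w f)"
      unfolding sum_distrib_left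
      by (intro sum.cong) (auto simp: transitive_pairs_def)
  qed
  finally have main: "(-1) ^ (n - 1) * fact (n - 1) * D ^ (n + 1) * root_moment p n =
    (\<Sum>k=0..n. (- D) ^ (n + 1 - k) * (\<Sum>(f, g)\<in>transitive_pairs n (n + 1 - k). ?w f))" .
  let ?K = "(-1) ^ (n - 1) * fact (n - 1) * D ^ (n + 1) :: complex"
  have K: "?K \<noteq> 0" using D by simp
  \<comment> \<open>The signs match because \<open>n - 1 + k\<close> and \<open>n + 1 - k\<close>
    have the same parity.\<close>
  have coef: "(- D) ^ (n + 1 - k) = ?K * ((-1) ^ k / (fact (n - 1) * D ^ k))" if "k \<in> {0..n}" for k
  proof -
    obtain m where m: "n + 1 = k + m" using \<open>k \<in> {0..n}\<close> by (metis atLeastAtMost_iff le_Suc_ex le_SucI Suc_eq_plus1)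
    obtain l where l: "n = Suc l" using n by (cases n) auto
    have sgn: "(-1) ^ l * (-1) ^ k = ((-1) ^ m :: complex)"
    proof -
      have "even (l + k) = even m" using m l by presburger
      then show ?thesis by (simp add: power_add[symmetric] minus_one_power_iff) blast
    qed
    have "?K * ((-1) ^ k / (fact (n - 1) * D ^ k)) = ((-1) ^ l * (-1) ^ k) * D ^ m"
      unfolding m power_add using D l by simp
    also have "\<dots> = (- D) ^ m" unfolding sgn by (simp flip: power_mult_distrib)
    finally have "?K * ((-1) ^ k / (fact (n - 1) * D ^ k)) = (- D) ^ m" .
    moreover have "n + 1 - k = m" using m by simp
    ultimately show ?thesis by (simp only:)
  qed
  have "?K * root_moment p n = ?K * (\<Sum>k=0..n. (-1) ^ k / (fact (n - 1) * D ^ k) *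
    (\<Sum>(f, g)\<in>transitive_pairs n (n + 1 - k). ?w f))"
    unfolding main sum_distrib_left[of ?K]
    by (rule sum.cong[OF refl]) (simp only: coef mult.assoc)
  then show ?thesis using K unfolding D_def by simp
qed

theorem theorem1p3:
  fixes n :: nat
  assumes "n \<ge> 1"
  shows "\<exists>c :: nat \<Rightarrow> nat set set \<Rightarrow> complex.
    \<forall>(d::nat) (p::complex poly).
      d \<ge> n \<longrightarrow> Polynomial.degree p = d \<longrightarrow> Polynomial.lead_coeff p = 1 \<longrightarrow>
      root_moment p n - (\<Sum>\<pi>\<in>NC n. ff_cumulant_part p \<pi>) =
        - (of_nat n / (2 * of_nat d)) *
          (\<Sum>(r, s)\<in>{(r, s). r \<ge> 1 \<and> s \<ge> 1 \<and> r + s = n}.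
             \<Sum>\<alpha>\<in>S_NC r s. ff_cumulant_perm n p \<alpha> / (of_nat r * of_nat s))
        + (\<Sum>k = 2..n - 1. (1 / of_nat d ^ k) *
             (\<Sum>\<sigma>\<in>set_partitions n. c k \<sigma> * ff_cumulant_part p \<sigma>))"
proof (intro exI allI impI)
  fix d :: nat and p :: "complex poly"
  assume p: "n \<le> d" "degree p = d" "lead_coeff p = 1"
  let ?S = "\<lambda>m. \<Sum>(f, g)\<in>transitive_pairs n m. wt (ff_cumulant p) {1..n} f"
  let ?t = "\<lambda>k. (-1) ^ k / (fact (n - 1) * of_nat d ^ k) * ?S (n + 1 - k)"
  let ?A = "\<Sum>(r, s)\<in>{(r, s). r \<ge> 1 \<and> s \<ge> 1 \<and> r + s = n}.
             \<Sum>\<alpha>\<in>S_NC r s. ff_cumulant_perm n p \<alpha> / (of_nat r * of_nat s)"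
  have perm: "ff_cumulant_perm n p \<alpha> = wt (ff_cumulant p) {1..n} \<alpha>" for \<alpha>
    by (simp add: ff_cumulant_perm_def ff_cumulant_part_def cycle_partition_def wt_def cyc_def)
  have t0: "?t 0 = (\<Sum>\<pi>\<in>NC n. ff_cumulant_part p \<pi>)"
    using sum_planar[OF assms, of "ff_cumulant p"] by (simp add: ff_cumulant_part_def)
  have fn: "fact n = (of_nat n * fact (n - 1) :: complex)" using assms by (simp add: fact_reduce)
  have t1: "?t 1 = - (of_nat n / (2 * of_nat d)) * ?A"
  proof -
    have cancel: "(-1) ^ 1 / (F * D ^ 1) * (N * F / 2 * A) = - (N / (2 * D)) * A"
      if "F \<noteq> 0" "D \<noteq> 0" for F D N A :: complex
      using that by (simp add: field_simps)
    have S: "?S (n + 1 - 1) = of_nat n * fact (n - 1) / 2 * ?A"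
      using sum_annular[OF assms, of "ff_cumulant p"] unfolding perm fn by (simp only: add_diff_cancel_right')
    show ?thesis unfolding S by (rule cancel) (use p(1) assms in simp_all)
  qed
  \<comment> \<open>For \<open>k = n\<close> the two permutations would have one cycle in total, but
    each has at least one.\<close>
  have tn: "?t n = 0"
  proof -
    have "transitive_pairs n (n + 1 - n) = {}"
    proof -
      have "card (cyc {1..n} h) \<noteq> 0" for h using assms by (simp add: cyc_def)
      then have "card (cyc {1..n} f) + card (cyc {1..n} g) \<noteq> 1" for f g
        by (metis One_nat_def add_is_1)
      then show ?thesis by (auto simp: transitive_pairs_def)
    qed
    then show ?thesis by simp
  qed
  have "root_moment p n = (\<Sum>k\<in>{0..n}. ?t k)"
    by (rule genus_expansion[OF assms p])
  \<comment> \<open>For \<open>n = 1\<close> the set \<open>{2..n}\<close> is empty, and the term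
    \<open>k = 1\<close> is still covered by \<open>t1\<close>, whose index set of pairs
    \<open>r\<close>, \<open>s\<close> is then empty.\<close>
  also have "{0..n} = insert 0 (insert 1 {2..n})" using assms by auto
  also have "(\<Sum>k\<in>\<dots>. ?t k) = ?t 0 + (?t 1 + (\<Sum>k\<in>{2..n}. ?t k))" by simp
  also have "(\<Sum>k\<in>{2..n}. ?t k) = (\<Sum>k=2..n - 1. ?t k)"
  proof (rule sum.mono_neutral_right)
    show "\<forall>k\<in>{2..n} - {2..n - 1}. ?t k = 0"
    proof
      fix k assume "k \<in> {2..n} - {2..n - 1}"
      then have "k = n" by auto
      then show "?t k = 0" using tn by simp
    qed
  qed auto
  \<comment> \<open>The coefficients found here instantiate the existential. That variable was
    introduced before \<open>d\<close> and \<open>p\<close> were fixed, so they depend on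
    \<open>n\<close>, \<open>k\<close> and \<open>\<sigma>\<close> alone.\<close>
  also have "\<dots> = (\<Sum>k=2..n - 1. (1 / of_nat d ^ k) * (\<Sum>\<sigma>\<in>set_partitions n.
      ((-1) ^ k * of_nat (pair_count n (n + 1 - k) \<sigma>) / fact (n - 1)) * ff_cumulant_part p \<sigma>))"
    unfolding sum_by_partition ff_cumulant_part_def sum_distrib_left
    by (intro sum.cong refl) (simp add: ac_simps)
  finally show "root_moment p n - (\<Sum>\<pi>\<in>NC n. ff_cumulant_part p \<pi>) = - (of_nat n / (2 * of_nat d)) * ?A
    + (\<Sum>k=2..n - 1. (1 / of_nat d ^ k) * (\<Sum>\<sigma>\<in>set_partitions n.
      (\<lambda>k \<sigma>. (-1) ^ k * of_nat (pair_count n (n + 1 - k) \<sigma>) / fact (n - 1)) k \<sigma> * ff_cumulant_part p \<sigma>))"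
    unfolding t0 t1 by simp
qed

end
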